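(* Let $p>3$ and $k>0$, and let $F\in C^1(\mathbb{R})$ satisfy $F(0)=F'(0)=0$ and $$|F'(u)|\le C\left(\ln\frac{1}{|u|}\right)^{1-p}\quad\text{for all } 0<|u|\le \delta$$ for some constants $C>0$ and $\delta\in(0,1)$. Then there exists $\varepsilon_0>0$ such that for every $\varepsilon$ with $|\varepsilon|<\varepsilon_0$ and all initial data $(u_0,u_1)\in C^1(\mathbb{H}^2)\times C(\mathbb{H}^2)$ satisfying $$|u_0(x)|+|u_1(x)|+|\nabla u_0(x)|\le (\cosh |x|)^{-k-\frac12}\quad\text{for all } x\in\mathbb{H}^2,$$ the Cauchy problem $$\partial_t^2u-\left(\Delta_{\mathbb{H}^2}+\tfrac14\right)u=F(u),\qquad u(0,x)=\varepsilon u_0(x),\quad u_t(0,x)=\varepsilon u_1(x)$$ admits a global weak solution $u\in C(\mathbb{R}\times\mathbb{H}^2)$. Here $\varepsilon_0$ is independent of $\varepsilon$ and of the data $(u_0,u_1)$.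
   Context: $\mathbb{H}^2$ is the two-dimensional hyperbolic space (curvature $-1$) with a fixed origin $O$; in geodesic polar coordinates $(r,\omega)\in(0,\infty)\times\mathbb{S}^1$ around $O$ the metric is $dr^2+(\sinh r)^2d\omega^2$. $d(x,y)$ is the geodesic distance, $|x|=d(O,x)$, $\Delta_{\mathbb{H}^2}$ is the Laplace–Beltrami operator, $|\nabla f|=\left((\partial_rf)^2+\left|\frac{\partial_\omega f}{\sinh r}\right|^2\right)^{1/2}$ is the Riemannian norm of the gradient. All functions are real-valued. For $s>0$, $M^sf(x)=\frac{1}{|S_s(x)|}\int_{S_s(x)}f\,d\sigma$ is the mean of $f$ over the geodesic circle $S_s(x)=\{y: d(x,y)=s\}$. $I(t,x,f)$ denotes the solution at $(t,x)$ of the linear equation $\partial_t^2w-(\Delta_{\mathbb{H}^2}+\frac14)w=0$ with data $w(0,\cdot)=0$, $w_t(0,\cdot)=f$; for $t>0$, $$I(t,x,f)=\int_0^t\frac{\sinh s}{\sqrt{2\cosh t-2\cosh s}}\,M^sf(x)\,ds,$$ and $I(-t,x,f)=-I(t,x,f)$. A weak solution of the Cauchy problem is a continuous function $u$ satisfying the Duhamel integral equation $$u(t,x)=\varepsilon\left[\partial_tI(t,x,u_0)+I(t,x,u_1)\right]+\int_0^tI(t-\tau,x,F(u(\tau,\cdot)))\,d\tau.$$ *)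

theory Defs
  imports "HOL-Analysis.Analysis"
begin

text \<open>
  The hyperbolic plane of curvature \<open>-1\<close> is realised as the Poincare disc: the open unit disc of
  \<open>\<complex>\<close> with the Riemannian metric \<open>4 |dz|\<^sup>2 / (1 - |z|\<^sup>2)\<^sup>2\<close> and origin \<open>O = 0\<close>.  Geodesic polar
  coordinates around \<open>O\<close> are \<open>z = tanh (r / 2) e\<^sup>i\<^sup>\<omega>\<close>; that the metric is
  \<open>dr\<^sup>2 + (sinh r)\<^sup>2 d\<omega>\<^sup>2\<close> in these coordinates is proved below.  Functions on the hyperbolic plane are
  functions on \<open>\<complex>\<close> of which only the values on the disc matter.
\<close>

definition H2 :: "complex set" where
  "H2 = ball 0 1"

definition hmetric :: "complex \<Rightarrow> complex \<Rightarrow> complex \<Rightarrow> real" where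
  "hmetric z v w = 4 * (v \<bullet> w) / (1 - (cmod z)\<^sup>2)\<^sup>2"

definition hnorm :: "complex \<Rightarrow> complex \<Rightarrow> real" where
  "hnorm z v = sqrt (hmetric z v v)"

definition hlength :: "(real \<Rightarrow> complex) \<Rightarrow> real" where
  "hlength \<gamma> = integral {0..1} (\<lambda>t. hnorm (\<gamma> t) (vector_derivative \<gamma> (at t)))"

text \<open>
  Only curves that are \<open>C\<^sup>1\<close> up to the endpoints are admitted, because \<^const>\<open>valid_path\<close> allows
  unbounded derivatives, hence non-rectifiable curves, for which \<^const>\<open>integral\<close> would be \<open>0\<close>.
\<close>

definition hdist :: "complex \<Rightarrow> complex \<Rightarrow> real" where
  "hdist x y = Inf {hlength \<gamma> | \<gamma>. \<gamma> C1_differentiable_on {0..1} \<and> \<gamma> ` {0..1} \<subseteq> H2 \<and>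
     \<gamma> 0 = x \<and> \<gamma> 1 = y}"

definition C1_H2 :: "(complex \<Rightarrow> real) \<Rightarrow> bool" where
  "C1_H2 f \<longleftrightarrow> (\<exists>D :: complex \<Rightarrow> complex \<Rightarrow>\<^sub>L real.
     (\<forall>z\<in>H2. (f has_derivative blinfun_apply (D z)) (at z)) \<and> continuous_on H2 D)"

definition hgrad :: "(complex \<Rightarrow> real) \<Rightarrow> complex \<Rightarrow> complex" where
  "hgrad f z = (THE G. (f has_derivative hmetric z G) (at z))"

text \<open>
  The geodesic circle of radius \<open>s\<close> about \<open>x\<close>, for \<open>\<theta> \<in> [0, 2\<pi>]\<close>: the image of the circle
  of radius \<open>s\<close> about \<open>O\<close> under an isometry that moves \<open>O\<close> to \<open>x\<close>; see \<open>hcircle_image\<close> and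
  \<open>inj_on_hcircle\<close> below.
\<close>

definition mobius :: "complex \<Rightarrow> complex \<Rightarrow> complex" where
  "mobius a z = (z + a) / (1 + cnj a * z)"

definition hcircle :: "complex \<Rightarrow> real \<Rightarrow> real \<Rightarrow> complex" where
  "hcircle x s \<theta> = mobius x (of_real (tanh (s / 2)) * cis \<theta>)"

definition circle_integral :: "complex \<Rightarrow> real \<Rightarrow> (complex \<Rightarrow> real) \<Rightarrow> real" where
  "circle_integral x s f = integral {0..2 * pi}
     (\<lambda>\<theta>. f (hcircle x s \<theta>) * hnorm (hcircle x s \<theta>) (vector_derivative (hcircle x s) (at \<theta>)))"

definition circle_mean :: "real \<Rightarrow> (complex \<Rightarrow> real) \<Rightarrow> complex \<Rightarrow> real" where
  "circle_mean s f x = circle_integral x s f / circle_integral x s (\<lambda>_. 1)"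

definition I_op :: "real \<Rightarrow> complex \<Rightarrow> (complex \<Rightarrow> real) \<Rightarrow> real" where
  "I_op t x f = sgn t *
     (LBINT s=0..\<bar>t\<bar>. sinh s / sqrt (2 * cosh \<bar>t\<bar> - 2 * cosh s) * circle_mean s f x)"

text \<open>
  The interval integral over \<open>\<tau>\<close> is oriented, so the formula also makes sense for \<open>t < 0\<close>.
\<close>

definition global_weak_solution ::
  "(real \<Rightarrow> real) \<Rightarrow> real \<Rightarrow> (complex \<Rightarrow> real) \<Rightarrow> (complex \<Rightarrow> real) \<Rightarrow> (real \<Rightarrow> complex \<Rightarrow> real) \<Rightarrow> bool" where
  "global_weak_solution F \<epsilon> u0 u1 u \<longleftrightarrow>
     continuous_on (UNIV \<times> H2) (\<lambda>(t, x). u t x) \<and>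
     (\<forall>t. \<forall>x\<in>H2. (\<lambda>s. I_op s x u0) differentiable (at t) \<and>
        u t x = \<epsilon> * (deriv (\<lambda>s. I_op s x u0) t + I_op t x u1)
                + (LBINT \<tau>=0..t. I_op (t - \<tau>) x (\<lambda>y. F (u \<tau> y))))"


subsection \<open>The metric and the gradient in geodesic polar coordinates\<close>

lemma H2_iff: "z \<in> H2 \<longleftrightarrow> cmod z < 1"
  by (simp add: H2_def)

lemma H2_pos: "z \<in> H2 \<Longrightarrow> 1 - (cmod z)\<^sup>2 > 0"
  by (simp add: H2_iff abs_square_less_1)

lemma hnorm_eq: "z \<in> H2 \<Longrightarrow> hnorm z v = 2 * cmod v / (1 - (cmod z)\<^sup>2)"
  using H2_pos[of z]
  by (simp add: hnorm_def hmetric_def dot_square_norm real_sqrt_divide real_sqrt_mult)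

lemma hgrad_eqI:
  assumes z: "z \<in> H2" and d: "(f has_derivative hmetric z G) (at z)"
  shows "hgrad f z = G"
  unfolding hgrad_def
proof (rule the_equality)
  fix G' assume "(f has_derivative hmetric z G') (at z)"
  then have "hmetric z G' = hmetric z G"
    using d has_derivative_unique by blast
  then have "\<forall>w. G' \<bullet> w = G \<bullet> w"
    using H2_pos[OF z] by (auto simp: fun_eq_iff hmetric_def)
  then show "G' = G"
    by (metis vector_eq_rdot)
qed (rule d)

lemma has_derivative_hgrad:
  assumes z: "z \<in> H2" and f: "f differentiable (at z)"
  shows "(f has_derivative hmetric z (hgrad f z)) (at z)"
proof -
  obtain L where L: "(f has_derivative L) (at z)"
    using f by (auto simp: differentiable_def)
  then have lin: "bounded_linear L"
    by (rule has_derivative_bounded_linear)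
  define E where "E = (\<Sum>b\<in>Basis. L b *\<^sub>R b)"
  have LE: "L w = E \<bullet> w" for w
  proof -
    have "L w = L (\<Sum>b\<in>Basis. (w \<bullet> b) *\<^sub>R b)"
      by (simp add: euclidean_representation)
    also have "\<dots> = (\<Sum>b\<in>Basis. (w \<bullet> b) * L b)"
      using lin by (simp add: linear_sum linear_scale bounded_linear.linear)
    also have "\<dots> = E \<bullet> w"
      by (simp add: E_def inner_sum_left inner_commute[of w] mult.commute)
    finally show ?thesis .
  qed
  define G where "G = ((1 - (cmod z)\<^sup>2)\<^sup>2 / 4) *\<^sub>R E"
  have "L = hmetric z G"
    using H2_pos[OF z] by (auto simp: fun_eq_iff LE hmetric_def G_def)
  then show ?thesis
    using L hgrad_eqI[OF z] by metis
qed

lemma one_minus_tanh_square: "1 - (tanh x)\<^sup>2 = 1 / (cosh x)\<^sup>2" for x :: real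
  using hyperbolic_pythagoras[of x] cosh_real_pos[of x]
  by (simp add: tanh_def power_divide diff_divide_distrib[symmetric] diff_divide_eq_iff)

lemma sinh_tanh_half: "sinh r = 2 * tanh (r / 2) / (1 - (tanh (r / 2))\<^sup>2)" for r :: real
proof -
  have "sinh r = 2 * sinh (r / 2) * cosh (r / 2)"
    using sinh_double[of "r / 2"] by simp
  also have "\<dots> = 2 * tanh (r / 2) * (cosh (r / 2))\<^sup>2"
    by (simp add: tanh_def power2_eq_square)
  finally show ?thesis
    by (simp add: one_minus_tanh_square)
qed

definition polar :: "real \<Rightarrow> real \<Rightarrow> complex" where
  "polar r \<omega> = of_real (tanh (r / 2)) * cis \<omega>"

lemma cmod_polar: "cmod (polar r \<omega>) = \<bar>tanh (r / 2)\<bar>"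
  by (simp add: polar_def norm_mult)

lemma polar_in_H2: "polar r \<omega> \<in> H2"
  using tanh_real_bounds[of "r / 2"] by (auto simp: H2_iff cmod_polar abs_less_iff)

lemma polar_deriv_r:
  "((\<lambda>r. polar r \<omega>) has_vector_derivative ((1 - (tanh (r / 2))\<^sup>2) / 2) *\<^sub>R cis \<omega>) (at r)"
  unfolding polar_def
  by (auto intro!: derivative_eq_intros has_vector_derivative_real_field
      simp: has_real_derivative_iff_has_vector_derivative[symmetric] scaleR_conv_of_real field_simps)

lemma polar_deriv_omega:
  "(polar r has_vector_derivative tanh (r / 2) *\<^sub>R (\<i> * cis \<omega>)) (at \<omega>)"
  unfolding polar_def[abs_def] cis_conv_exp
  by (auto intro!: derivative_eq_intros has_vector_derivative_real_field
      simp: scaleR_conv_of_real field_simps)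

lemma inner_rotated:
  fixes \<alpha> \<beta> \<omega> :: real
  defines "v \<equiv> \<alpha> *\<^sub>R cis \<omega> + \<beta> *\<^sub>R (\<i> * cis \<omega>)"
  shows "v \<bullet> v = \<alpha>\<^sup>2 + \<beta>\<^sup>2"
proof -
  have "v \<bullet> v = (\<alpha> * cos \<omega> - \<beta> * sin \<omega>)\<^sup>2 + (\<alpha> * sin \<omega> + \<beta> * cos \<omega>)\<^sup>2"
    by (simp add: v_def inner_complex_def power2_eq_square)
  also have "\<dots> = (\<alpha>\<^sup>2 + \<beta>\<^sup>2) * ((cos \<omega>)\<^sup>2 + (sin \<omega>)\<^sup>2)"
    by algebra
  finally show ?thesis by simp
qed

lemma polar_metric:
  assumes "V = a *\<^sub>R vector_derivative (\<lambda>r. polar r \<omega>) (at r) +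
    b *\<^sub>R vector_derivative (polar r) (at \<omega>)"
  shows "hmetric (polar r \<omega>) V V = a\<^sup>2 + (sinh r)\<^sup>2 * b\<^sup>2"
proof -
  define T where "T = tanh (r / 2)"
  have T: "1 - T\<^sup>2 > 0"
    using H2_pos[OF polar_in_H2[of r \<omega>]] by (simp add: cmod_polar T_def)
  have V: "V = (a * ((1 - T\<^sup>2) / 2)) *\<^sub>R cis \<omega> + (b * T) *\<^sub>R (\<i> * cis \<omega>)"
    unfolding assms T_def vector_derivative_at[OF polar_deriv_r]
      vector_derivative_at[OF polar_deriv_omega] by simp
  have "V \<bullet> V = (a * ((1 - T\<^sup>2) / 2))\<^sup>2 + (b * T)\<^sup>2"
    unfolding V by (rule inner_rotated)
  then have "hmetric (polar r \<omega>) V V = 4 * ((a * ((1 - T\<^sup>2) / 2))\<^sup>2 + (b * T)\<^sup>2) / (1 - T\<^sup>2)\<^sup>2"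
    by (simp add: hmetric_def cmod_polar T_def)
  also have "\<dots> = a\<^sup>2 + (2 * T / (1 - T\<^sup>2))\<^sup>2 * b\<^sup>2"
  proof -
    have "4 * ((a * (S / 2))\<^sup>2 + (b * T)\<^sup>2) / S\<^sup>2 = a\<^sup>2 + (2 * T / S)\<^sup>2 * b\<^sup>2" if "S > 0" for S
      using that by (simp add: field_simps power2_eq_square)
    then show ?thesis using T .
  qed
  finally show ?thesis
    by (simp add: sinh_tanh_half T_def)
qed

lemma hnorm_hgrad_polar:
  assumes r: "r > 0" and f: "f differentiable (at (polar r \<omega>))"
  shows "hnorm (polar r \<omega>) (hgrad f (polar r \<omega>)) =
    sqrt ((deriv (\<lambda>r. f (polar r \<omega>)) r)\<^sup>2 + (deriv (\<lambda>\<omega>. f (polar r \<omega>)) \<omega> / sinh r)\<^sup>2)"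
proof -
  define T where "T = tanh (r / 2)"
  define z where "z = polar r \<omega>"
  define G where "G = hgrad f z"
  define A where "A = G \<bullet> cis \<omega>"
  define B where "B = G \<bullet> (\<i> * cis \<omega>)"
  have T: "1 - T\<^sup>2 > 0" "T > 0" and nz: "(cmod z)\<^sup>2 = T\<^sup>2"
    using H2_pos[OF polar_in_H2[of r \<omega>]] r by (simp_all add: cmod_polar T_def z_def)
  have D: "(f has_derivative hmetric z G) (at z)"
    unfolding G_def using has_derivative_hgrad[OF polar_in_H2 f] by (simp add: z_def)
  have "((\<lambda>r. f (polar r \<omega>)) has_vector_derivative
      hmetric z G (((1 - T\<^sup>2) / 2) *\<^sub>R cis \<omega>)) (at r)"
    using vector_derivative_diff_chain_within[OF polar_deriv_r[of \<omega> r], of f "hmetric z G"]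
      has_derivative_at_withinI[OF D] by (simp add: o_def z_def T_def)
  then have "deriv (\<lambda>r. f (polar r \<omega>)) r = 4 * ((1 - T\<^sup>2) / 2 * A) / (1 - T\<^sup>2)\<^sup>2"
    by (auto dest!: DERIV_imp_deriv
        simp: has_real_derivative_iff_has_vector_derivative[symmetric] hmetric_def nz A_def)
  then have dr: "deriv (\<lambda>r. f (polar r \<omega>)) r = 2 * A / (1 - T\<^sup>2)"
    using T by (simp add: power2_eq_square)
  have "((\<lambda>\<omega>. f (polar r \<omega>)) has_vector_derivative
      hmetric z G (T *\<^sub>R (\<i> * cis \<omega>))) (at \<omega>)"
    using vector_derivative_diff_chain_within[OF polar_deriv_omega[of r \<omega>], of f "hmetric z G"]
      has_derivative_at_withinI[OF D] by (simp add: o_def z_def T_def)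
  then have dw: "deriv (\<lambda>\<omega>. f (polar r \<omega>)) \<omega> = 4 * (T * B) / (1 - T\<^sup>2)\<^sup>2"
    by (auto dest!: DERIV_imp_deriv
        simp: has_real_derivative_iff_has_vector_derivative[symmetric] hmetric_def nz B_def)
  have dw': "deriv (\<lambda>\<omega>. f (polar r \<omega>)) \<omega> / sinh r = 2 * B / (1 - T\<^sup>2)"
  proof -
    have "4 * (T * B) / S\<^sup>2 / (2 * T / S) = 2 * B / S" if "S > 0" for S
      using that T(2) by (simp add: field_simps power2_eq_square)
    from this[OF T(1)] dw show ?thesis
      by (simp only: sinh_tanh_half T_def[symmetric])
  qed
  have "A = Re G * cos \<omega> + Im G * sin \<omega>" "B = Im G * cos \<omega> - Re G * sin \<omega>"
    by (simp_all add: A_def B_def inner_complex_def)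
  then have "A\<^sup>2 + B\<^sup>2 = ((Re G)\<^sup>2 + (Im G)\<^sup>2) * ((cos \<omega>)\<^sup>2 + (sin \<omega>)\<^sup>2)"
    by algebra
  then have G2: "(cmod G)\<^sup>2 = A\<^sup>2 + B\<^sup>2"
    by (simp add: cmod_power2)
  have "hnorm z G = sqrt ((2 * A / (1 - T\<^sup>2))\<^sup>2 + (2 * B / (1 - T\<^sup>2))\<^sup>2)"
    unfolding hnorm_def hmetric_def nz dot_square_norm G2
    by (simp add: power_divide add_divide_distrib power_mult_distrib algebra_simps)
  then show ?thesis
    by (simp add: dr dw' G_def z_def)
qed


subsection \<open>Isometries, distance and geodesic circles\<close>

lemma mobius_denom: "a \<in> H2 \<Longrightarrow> z \<in> H2 \<Longrightarrow> 1 + cnj a * z \<noteq> 0"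
proof
  assume a: "a \<in> H2" "z \<in> H2" and "1 + cnj a * z = 0"
  then have "cnj a * z = - 1"
    by (simp add: add_eq_0_iff)
  then have "cmod a * cmod z = 1"
    by (metis complex_mod_cnj norm_minus_cancel norm_mult norm_one)
  moreover have "cmod a * cmod z < 1 * 1"
    using a by (intro mult_strict_mono) (auto simp: H2_iff)
  ultimately show False by simp
qed

lemma mobius_norm_identity:
  "(cmod (1 + cnj a * z))\<^sup>2 - (cmod (z + a))\<^sup>2 = (1 - (cmod a)\<^sup>2) * (1 - (cmod z)\<^sup>2)"
  unfolding cmod_power2 by (simp add: algebra_simps power2_eq_square)

lemma mobius_norm:
  assumes "a \<in> H2" "z \<in> H2"
  shows "1 - (cmod (mobius a z))\<^sup>2
    = (1 - (cmod a)\<^sup>2) * (1 - (cmod z)\<^sup>2) / (cmod (1 + cnj a * z))\<^sup>2"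
  using mobius_denom[OF assms] mobius_norm_identity[of a z, symmetric]
  by (simp add: mobius_def norm_divide power_divide diff_divide_distrib)

lemma mobius_in_H2: "a \<in> H2 \<Longrightarrow> z \<in> H2 \<Longrightarrow> mobius a z \<in> H2"
proof -
  assume az: "a \<in> H2" "z \<in> H2"
  have "1 - (cmod (mobius a z))\<^sup>2 > 0"
    unfolding mobius_norm[OF az]
    using mobius_denom[OF az] by (intro divide_pos_pos mult_pos_pos H2_pos az) simp
  then show ?thesis
    by (simp add: H2_iff abs_square_less_1)
qed

lemma minus_in_H2 [simp]: "- a \<in> H2 \<longleftrightarrow> a \<in> H2"
  by (simp add: H2_iff)

lemma mobius_inverse:
  assumes "a \<in> H2" "z \<in> H2"
  shows "mobius (- a) (mobius a z) = z"
proof -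
  have n: "1 + cnj a * z \<noteq> 0"
    using assms by (rule mobius_denom)
  have "1 - cnj a * a \<noteq> 0"
    using mobius_denom[of "- a" a] assms by simp
  moreover have "mobius a z + - a = z * (1 - cnj a * a) / (1 + cnj a * z)"
    using n by (simp add: mobius_def field_simps)
  moreover have "1 + cnj (- a) * mobius a z = (1 - cnj a * a) / (1 + cnj a * z)"
    using n by (simp add: mobius_def field_simps)
  ultimately show ?thesis
    using n unfolding mobius_def[of "- a"] by simp
qed

lemma mobius_deriv:
  assumes "a \<in> H2" "z \<in> H2"
  shows "(mobius a has_field_derivative of_real (1 - (cmod a)\<^sup>2) / (1 + cnj a * z)\<^sup>2) (at z)"
proof -
  have "((\<lambda>z. (z + a) / (1 + cnj a * z)) has_field_derivative
      (1 * (1 + cnj a * z) - (z + a) * cnj a) / ((1 + cnj a * z) * (1 + cnj a * z))) (at z)"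
    using mobius_denom[OF assms] by (intro DERIV_divide) (auto intro!: derivative_eq_intros)
  moreover have "1 * (1 + cnj a * z) - (z + a) * cnj a = of_real (1 - (cmod a)\<^sup>2)"
    unfolding of_real_diff complex_norm_square by (simp add: algebra_simps)
  ultimately show ?thesis
    by (simp only: mobius_def[abs_def] power2_eq_square[of "1 + cnj a * z"])
qed

lemma hnorm_mobius:
  assumes "a \<in> H2" "z \<in> H2"
  shows "hnorm (mobius a z) (v * (of_real (1 - (cmod a)\<^sup>2) / (1 + cnj a * z)\<^sup>2)) = hnorm z v"
proof -
  have n: "cmod (1 + cnj a * z) \<noteq> 0"
    using mobius_denom[OF assms] by simp
  have "cmod (of_real (1 - (cmod a)\<^sup>2)) = 1 - (cmod a)\<^sup>2"
    using H2_pos[OF assms(1)] by (simp only: norm_of_real)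
  then have "cmod (v * (of_real (1 - (cmod a)\<^sup>2) / (1 + cnj a * z)\<^sup>2))
      = cmod v * ((1 - (cmod a)\<^sup>2) / (cmod (1 + cnj a * z))\<^sup>2)"
    by (simp only: norm_mult norm_divide norm_power)
  then show ?thesis
    using n H2_pos[OF assms(1)] H2_pos[OF assms(2)]
    by (simp only: hnorm_eq mobius_in_H2 assms mobius_norm) simp
qed

lemma mobius_path:
  assumes a: "a \<in> H2" and g: "\<gamma> C1_differentiable_on {0..1}" "\<gamma> ` {0..1} \<subseteq> H2"
  shows "(\<lambda>t. mobius a (\<gamma> t)) C1_differentiable_on {0..1}"
    and "hlength (\<lambda>t. mobius a (\<gamma> t)) = hlength \<gamma>"
proof -
  let ?k = "\<lambda>t. of_real (1 - (cmod a)\<^sup>2) / (1 + cnj a * \<gamma> t)\<^sup>2"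
  obtain D where D0: "\<forall>t\<in>{0..1}. (\<gamma> has_vector_derivative D t) (at t)"
    and cD: "continuous_on {0..1} D"
    using g(1) unfolding C1_differentiable_on_def by blast
  note D = bspec[OF D0]
  have cg: "continuous_on {0..1} \<gamma>"
    by (rule C1_differentiable_imp_continuous_on[OF g(1)])
  have in_H2: "\<gamma> t \<in> H2" if "t \<in> {0..1}" for t
    using g(2) that by auto
  have M: "((\<lambda>t. mobius a (\<gamma> t)) has_vector_derivative D t * ?k t) (at t)" if "t \<in> {0..1}" for t
    using field_vector_diff_chain_at[OF D[OF that] mobius_deriv[OF a in_H2[OF that]]]
    by (simp add: o_def)
  have "continuous_on {0..1} (\<lambda>t. D t * ?k t)"
    by (intro continuous_intros cD cg) (use mobius_denom[OF a in_H2] in auto)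
  then show "(\<lambda>t. mobius a (\<gamma> t)) C1_differentiable_on {0..1}"
    unfolding C1_differentiable_on_def
    by (intro exI[of _ "\<lambda>t. D t * ?k t"] conjI ballI) (erule M)
  show "hlength (\<lambda>t. mobius a (\<gamma> t)) = hlength \<gamma>"
    unfolding hlength_def
    by (rule Henstock_Kurzweil_Integration.integral_cong)
      (simp only: vector_derivative_at[OF M] vector_derivative_at[OF D] hnorm_mobius[OF a in_H2])
qed

lemma hdist_mobius:
  assumes a: "a \<in> H2" and x: "x \<in> H2" and y: "y \<in> H2"
  shows "hdist (mobius a x) (mobius a y) = hdist x y"
proof -
  define L where "L x y = {hlength \<gamma> | \<gamma>. \<gamma> C1_differentiable_on {0..1} \<and> \<gamma> ` {0..1} \<subseteq> H2 \<and>
     \<gamma> 0 = x \<and> \<gamma> 1 = y}" for x y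
  have sub: "L x y \<subseteq> L (mobius a x) (mobius a y)" if a: "a \<in> H2" for a x y
  proof
    fix l assume "l \<in> L x y"
    then obtain \<gamma> where g: "\<gamma> C1_differentiable_on {0..1}" "\<gamma> ` {0..1} \<subseteq> H2"
      "\<gamma> 0 = x" "\<gamma> 1 = y" "l = hlength \<gamma>"
      by (auto simp: L_def)
    have "(\<lambda>t. mobius a (\<gamma> t)) ` {0..1} \<subseteq> H2"
      using g(2) mobius_in_H2[OF a] by auto
    then show "l \<in> L (mobius a x) (mobius a y)"
      unfolding L_def using mobius_path[OF a g(1,2)] g(3-5)
      by (intro CollectI exI[of _ "\<lambda>t. mobius a (\<gamma> t)"]) auto
  qed
  have "L (mobius a x) (mobius a y) \<subseteq> L x y"
    using sub[of "- a" "mobius a x" "mobius a y"] a x y by (simp add: mobius_inverse)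
  with sub[OF a, of x y] show ?thesis
    unfolding hdist_def L_def by auto
qed

lemma continuous_on_speed:
  assumes g: "\<gamma> C1_differentiable_on {0..1}" "\<gamma> ` {0..1} \<subseteq> H2"
  shows "continuous_on {0..1} (\<lambda>t. hnorm (\<gamma> t) (vector_derivative \<gamma> (at t)))"
proof -
  have "continuous_on {0..1} (\<lambda>t. vector_derivative \<gamma> (at t))"
    using g(1) by (simp add: C1_differentiable_on_eq)
  moreover have "continuous_on {0..1} \<gamma>"
    by (rule C1_differentiable_imp_continuous_on[OF g(1)])
  moreover have "(cmod (\<gamma> t))\<^sup>2 \<noteq> 1" if "t \<in> {0..1}" for t
    using H2_pos[of "\<gamma> t"] g(2) that by force
  ultimately have
    "continuous_on {0..1} (\<lambda>t. 2 * cmod (vector_derivative \<gamma> (at t)) / (1 - (cmod (\<gamma> t))\<^sup>2))"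
    by (intro continuous_intros) auto
  then show ?thesis
    by (rule continuous_on_eq) (use g(2) in \<open>simp add: hnorm_eq image_subset_iff\<close>)
qed

lemma hlength_lower:
  assumes g: "\<gamma> C1_differentiable_on {0..1}" "\<gamma> ` {0..1} \<subseteq> H2" "\<gamma> 0 = 0" "\<gamma> 1 = z"
  shows "2 * artanh (cmod z) \<le> hlength \<gamma>"
proof -
  define e where "e = sgn z"
  have e: "cmod e \<le> 1" "e \<bullet> z = cmod z"
    by (cases "z = 0"; simp add: e_def sgn_div_norm dot_square_norm power2_eq_square)+
  have in_H2: "\<gamma> t \<in> H2" if "t \<in> {0..1}" for t
    using g(2) that by auto
  have le: "\<bar>e \<bullet> w\<bar> \<le> cmod w" for w
    using Cauchy_Schwarz_ineq2[of e w] e(1) mult_right_mono[OF e(1), of "cmod w"] by simp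
  define h where "h t = 2 * artanh (e \<bullet> \<gamma> t)" for t
  define h' where "h' t = 2 * (e \<bullet> vector_derivative \<gamma> (at t)) / (1 - (e \<bullet> \<gamma> t)\<^sup>2)" for t
  have dh: "(h has_vector_derivative h' t) (at t)" if t: "t \<in> {0..1}" for t
  proof -
    have "(\<gamma> has_vector_derivative vector_derivative \<gamma> (at t)) (at t)"
      using g(1) t by (simp add: C1_differentiable_on_eq vector_derivative_works)
    then have i: "((\<lambda>t. e \<bullet> \<gamma> t) has_real_derivative e \<bullet> vector_derivative \<gamma> (at t)) (at t)"
      unfolding has_real_derivative_iff_has_vector_derivative
      by (rule bounded_linear.has_vector_derivative[OF bounded_linear_inner_right])
    have lt: "\<bar>e \<bullet> \<gamma> t\<bar> < 1"
      using le[of "\<gamma> t"] in_H2[OF t] by (simp add: H2_iff)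
    have "(h has_real_derivative h' t) (at t)"
      unfolding h_def[abs_def] h'_def
      by (auto intro!: derivative_eq_intros DERIV_chain2[OF artanh_real_has_field_derivative i] lt)
    then show ?thesis
      by (simp add: has_real_derivative_iff_has_vector_derivative)
  qed
  have "(h' has_integral (h 1 - h 0)) {0..1}"
    by (rule fundamental_theorem_of_calculus) (simp_all add: has_vector_derivative_at_within dh)
  moreover have "((\<lambda>t. hnorm (\<gamma> t) (vector_derivative \<gamma> (at t))) has_integral hlength \<gamma>) {0..1}"
    unfolding hlength_def
    by (intro integrable_integral integrable_continuous_real continuous_on_speed g)
  moreover have "h' t \<le> hnorm (\<gamma> t) (vector_derivative \<gamma> (at t))" if t: "t \<in> {0..1}" for t
  proof -
    have "(e \<bullet> \<gamma> t)\<^sup>2 \<le> (cmod (\<gamma> t))\<^sup>2"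
      using power_mono[OF le[of "\<gamma> t"], of 2] by simp
    moreover have "e \<bullet> vector_derivative \<gamma> (at t) \<le> cmod (vector_derivative \<gamma> (at t))"
      using le[of "vector_derivative \<gamma> (at t)"] by simp
    ultimately show ?thesis
      unfolding h'_def hnorm_eq[OF in_H2[OF t]]
      using H2_pos[OF in_H2[OF t]] by (intro frac_le) auto
  qed
  ultimately have "h 1 - h 0 \<le> hlength \<gamma>"
    by (rule has_integral_le)
  then show ?thesis
    by (simp add: h_def g(3,4) e)
qed

lemma hdist_0:
  assumes z: "z \<in> H2"
  shows "hdist 0 z = 2 * artanh (cmod z)"
proof -
  define \<gamma> where "\<gamma> t = t *\<^sub>R z" for t :: real
  have d: "(\<gamma> has_vector_derivative z) (at t)" for t
    unfolding \<gamma>_def[abs_def] by (auto intro!: derivative_eq_intros)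
  have lt: "t * cmod z < 1" "\<bar>t * cmod z\<bar> < 1" if "t \<in> {0..1}" for t
    using that z mult_right_mono[of t 1 "cmod z"] by (auto simp: H2_iff)
  have C1: "\<gamma> C1_differentiable_on {0..1}"
    unfolding C1_differentiable_on_def using d by (intro exI[of _ "\<lambda>_. z"]) auto
  have sub: "\<gamma> ` {0..1} \<subseteq> H2"
    using lt by (auto simp: \<gamma>_def H2_iff)
  have "((\<lambda>t. 2 * artanh (t * cmod z)) has_real_derivative
      hnorm (\<gamma> t) (vector_derivative \<gamma> (at t))) (at t)" if t: "t \<in> {0..1}" for t
  proof -
    have "hnorm (\<gamma> t) (vector_derivative \<gamma> (at t)) = 2 * cmod z / (1 - (t * cmod z)\<^sup>2)"
      using t sub by (simp add: vector_derivative_at[OF d] hnorm_eq image_subset_iff)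
        (simp add: \<gamma>_def power_mult_distrib)
    moreover have "((\<lambda>t. t * cmod z) has_real_derivative cmod z) (at t)"
      by (auto intro!: derivative_eq_intros)
    note DERIV_cmult[OF DERIV_chain2[OF artanh_real_has_field_derivative[OF lt(2)[OF t]] this], of 2]
    ultimately show ?thesis by simp
  qed
  then have "((\<lambda>t. hnorm (\<gamma> t) (vector_derivative \<gamma> (at t))) has_integral
      (2 * artanh (1 * cmod z) - 2 * artanh (0 * cmod z))) {0..1}"
    by (intro fundamental_theorem_of_calculus)
      (auto simp: has_real_derivative_iff_has_vector_derivative[symmetric]
        intro: has_field_derivative_at_within)
  then have len: "hlength \<gamma> = 2 * artanh (cmod z)"
    by (simp add: hlength_def integral_unique)
  show ?thesis
    unfolding hdist_def
  proof (rule cInf_eq_minimum)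
    show "2 * artanh (cmod z) \<in> {hlength \<gamma> | \<gamma>. \<gamma> C1_differentiable_on {0..1} \<and>
        \<gamma> ` {0..1} \<subseteq> H2 \<and> \<gamma> 0 = 0 \<and> \<gamma> 1 = z}"
      using C1 sub len by (intro CollectI exI[of _ \<gamma>]) (auto simp: \<gamma>_def)
  qed (auto intro: hlength_lower)
qed

lemma mobius_0 [simp]: "mobius a 0 = a"
  by (simp add: mobius_def)

lemma hdist_eq:
  assumes x: "x \<in> H2" and y: "y \<in> H2"
  shows "hdist x y = 2 * artanh (cmod (mobius (- x) y))"
proof -
  have "mobius (- x) x = 0"
    by (simp add: mobius_def)
  then have "hdist x y = hdist 0 (mobius (- x) y)"
    using hdist_mobius[of "- x" x y] x y by simp
  then show ?thesis
    using hdist_0[OF mobius_in_H2[of "- x" y]] x y by simp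
qed

lemma hdist_polar: "r \<ge> 0 \<Longrightarrow> hdist 0 (polar r \<omega>) = r"
  by (simp add: hdist_0 polar_in_H2 cmod_polar artanh_tanh_real)

lemma hcircle_eq: "hcircle x s \<theta> = mobius x (polar s \<theta>)"
  by (simp add: hcircle_def polar_def)

lemma artanh_real_inject:
  fixes x y :: real
  assumes "\<bar>x\<bar> < 1" "\<bar>y\<bar> < 1" "artanh x = artanh y"
  shows "x = y"
proof -
  have "ln ((1 + x) / (1 - x)) = ln ((1 + y) / (1 - y))"
    using assms(3) by (simp add: artanh_def)
  then have "(1 + x) / (1 - x) = (1 + y) / (1 - y)"
    using assms(1,2) by (subst (asm) ln_inj_iff) auto
  then show ?thesis
    using assms(1,2) by (simp add: frac_eq_eq) (simp add: algebra_simps)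
qed

lemma hcircle_image:
  assumes x: "x \<in> H2" and s: "s > 0"
  shows "hcircle x s ` {0..2 * pi} = {y \<in> H2. hdist x y = s}"
proof (intro equalityI subsetI)
  fix y assume "y \<in> hcircle x s ` {0..2 * pi}"
  then obtain \<theta> where y: "y = mobius x (polar s \<theta>)"
    by (auto simp: hcircle_eq)
  have "hdist (mobius x 0) (mobius x (polar s \<theta>)) = hdist 0 (polar s \<theta>)"
    by (rule hdist_mobius[OF x _ polar_in_H2]) (simp add: H2_iff)
  then show "y \<in> {y \<in> H2. hdist x y = s}"
    using s x by (simp add: y hdist_polar mobius_in_H2 polar_in_H2)
next
  fix y assume "y \<in> {y \<in> H2. hdist x y = s}"
  then have y: "y \<in> H2" and d: "hdist x y = s" by auto
  define w where "w = mobius (- x) y"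
  have w: "w \<in> H2"
    using x y by (simp add: w_def mobius_in_H2)
  have "artanh (cmod w) = s / 2"
    using hdist_eq[OF x y] d by (simp add: w_def)
  then have T: "tanh (s / 2) = cmod w"
    using w tanh_real_bounds[of "s / 2"] artanh_real_inject[of "tanh (s / 2)" "cmod w"]
    by (simp add: H2_iff artanh_tanh_real abs_less_iff)
  have A: "Arg2pi w \<in> {0..2 * pi}" "w = of_real (cmod w) * cis (Arg2pi w)"
    using Arg2pi[of w] Arg2pi_eq[of w] by (simp_all add: cis_conv_exp less_imp_le)
  have "hcircle x s (Arg2pi w) = mobius x w"
    using A(2) by (simp only: hcircle_def T)
  also have "\<dots> = y"
    using mobius_inverse[of "- x" y] x y by (simp add: w_def)
  finally show "y \<in> hcircle x s ` {0..2 * pi}"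
    using A(1) by blast
qed

lemma inj_on_hcircle:
  assumes x: "x \<in> H2" and s: "s > 0"
  shows "inj_on (hcircle x s) {0..<2 * pi}"
proof
  fix a b assume ab: "a \<in> {0..<2 * pi}" "b \<in> {0..<2 * pi}" and "hcircle x s a = hcircle x s b"
  then have "polar s a = polar s b"
    by (metis hcircle_eq mobius_inverse polar_in_H2 x)
  then have "cis a = cis b"
    using s by (simp add: polar_def)
  then have "sin a = sin b" "cos a = cos b"
    by (simp_all add: complex_eq_iff)
  then obtain n :: int where n: "a = b + 2 * pi * n"
    using sin_cos_eq_iff[of a b] by blast
  then have "\<bar>2 * pi * n\<bar> < 2 * pi * 1"
    using ab by auto
  then have "\<bar>real_of_int n\<bar> < 1"
    by (simp add: abs_mult)
  then show "a = b"
    using n by simp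
qed

lemma hcircle_speed:
  assumes x: "x \<in> H2" and s: "s \<ge> 0"
  shows "hnorm (hcircle x s \<theta>) (vector_derivative (hcircle x s) (at \<theta>)) = sinh s"
proof -
  have "((\<lambda>\<theta>. mobius x (polar s \<theta>)) has_vector_derivative
      tanh (s / 2) *\<^sub>R (\<i> * cis \<theta>) *
      (of_real (1 - (cmod x)\<^sup>2) / (1 + cnj x * polar s \<theta>)\<^sup>2)) (at \<theta>)"
    using field_vector_diff_chain_at[OF polar_deriv_omega mobius_deriv[OF x polar_in_H2]]
    by (simp add: o_def)
  then have "vector_derivative (hcircle x s) (at \<theta>) = tanh (s / 2) *\<^sub>R (\<i> * cis \<theta>) *
      (of_real (1 - (cmod x)\<^sup>2) / (1 + cnj x * polar s \<theta>)\<^sup>2)"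
    by (simp only: hcircle_eq[abs_def] vector_derivative_at)
  then have "hnorm (hcircle x s \<theta>) (vector_derivative (hcircle x s) (at \<theta>))
      = hnorm (polar s \<theta>) (tanh (s / 2) *\<^sub>R (\<i> * cis \<theta>))"
    by (simp only: hcircle_eq hnorm_mobius[OF x polar_in_H2])
  also have "\<dots> = sinh s"
    using s by (simp add: hnorm_eq polar_in_H2 cmod_polar norm_mult sinh_tanh_half)
  finally show ?thesis .
qed

lemma circle_integral_eq:
  "x \<in> H2 \<Longrightarrow> s \<ge> 0 \<Longrightarrow>
    circle_integral x s f = sinh s * integral {0..2 * pi} (\<lambda>\<theta>. f (hcircle x s \<theta>))"
  by (simp add: circle_integral_def hcircle_speed)

lemma circle_mean_eq:
  "x \<in> H2 \<Longrightarrow> s > 0 \<Longrightarrow>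
    circle_mean s f x = integral {0..2 * pi} (\<lambda>\<theta>. f (hcircle x s \<theta>)) / (2 * pi)"
  by (simp add: circle_mean_def circle_integral_eq)

end

theory Submission
  imports Defs
begin

text \<open>
Small solutions are found by contraction in a weighted space of continuous functions.  With \<open>r = |x|\<close>
the weight is \<open>W(t,x) = e\<^sup>-\<^sup>r\<^sup>/\<^sup>2 (1 + ||t| - r|)\<^sup>-\<^sup>a\<close> for some \<open>a > 1\<close>.  It has no decay along the light
cone \<open>|t| = r\<close> beyond the factor \<open>e\<^sup>-\<^sup>r\<^sup>/\<^sup>2\<close>, and only polynomial decay away from it.

A nonlinearity that vanishes just by a power of a logarithm is sufficient because of this factor: for
\<open>|u| \<le> \<kappa> W\<close> the number \<open>ln (1/|u|)\<close> is at least \<open>ln (1/\<kappa>) + r/2\<close>, so \<open>F(u)\<close> is smaller than \<open>u\<close> by a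
factor of order \<open>(1+r)\<^sup>1\<^sup>-\<^sup>p\<close>.  A small part of this power is spent on \<open>ln (1/\<kappa>)\<close>, which makes the constant small
when \<open>\<kappa>\<close> is small; \<open>(1+r)\<^sup>-\<^sup>b\<close> with \<open>b\<close> slightly below \<open>p - 1\<close> remains (\<open>log_nonlinearity_lipschitz\<close>).

The operator \<open>I\<close> is monotone for positive times, so it has to be estimated on positive radial majorants only.
The substitution \<open>sinh (s/2) = sinh (t/2) sin \<phi>\<close> turns it into an integral over a hemisphere without a
singular kernel (\<open>I_op_eq_hemisphere_integral\<close>).  For \<open>C\<^sup>1\<close> data this makes it differentiable in time, \<open>t = 0\<close>
included, and the gradient controls the contribution of the moving circles, because \<open>|\<partial>s/\<partial>t| \<le> 1\<close>.

The core is a bound for circle means.  A majorant \<open>e\<^sup>-\<^sup>r\<^sup>/\<^sup>2 G(r)\<close> is dominated by a sum over \<open>n\<close> of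
\<open>G(n) e\<^sup>n (cosh n + cosh r)\<^sup>-\<^sup>3\<^sup>/\<^sup>2\<close>, a bump at distance \<open>n\<close> from the origin.  On a circle \<open>cosh r\<close> is
\<open>P + Q cos \<theta>\<close>, and with the exponent \<open>3/2\<close> the integral over \<open>\<theta>\<close> has an elementary bound
(\<open>integral_circle_kernel_le\<close>).  The outcome (\<open>hemisphere_integral_le\<close>) is that at time \<open>t\<close> and distance \<open>r\<close>
the wave is at most a constant times \<open>e\<^sup>-\<^sup>r\<^sup>/\<^sup>2 \<Sum>\<^sub>n G(n) exp (- max 0 (|t - r| - n) / 4)\<close>: data at distance \<open>n\<close> arrive
only where \<open>|t - r| \<le> n\<close>, up to an exponentially small error.

For the data, \<open>G\<close> decays exponentially and the sum is harmless (\<open>linear_decay\<close>).  For the Duhamel term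
\<open>G(n) = (1+n)\<^sup>-\<^sup>b (1+|\<tau>-n|)\<^sup>-\<^sup>a\<close>, and with \<open>d = t - r\<close> the factor \<open>(1+|d|)\<^sup>a\<close> can be absorbed at the price of a
factor \<open>(1+n)\<^sup>a\<close> (\<open>shell_weight_pointwise\<close>).  Integration over \<open>\<tau>\<close> needs \<open>a > 1\<close> and summation over \<open>n\<close> needs
\<open>b - a > 1\<close> (\<open>duhamel_decay\<close>).  Numbers \<open>a > 1\<close> and \<open>a + 1 < b < p - 1\<close> exist exactly when \<open>p > 3\<close>.
\<close>

section \<open>Inequalities for real functions\<close>

text \<open>
Jordan's inequality: the concave function \<open>sin\<close> lies above its chord on \<open>[0, \<pi>/2]\<close>.
\<close>

lemma two_div_pi_mult_le_sin:
  fixes u :: real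
  assumes "0 \<le> u" "u \<le> pi / 2"
  shows "2 * u / pi \<le> sin u"
proof -
  have "convex_on {0..pi / 2} (\<lambda>x::real. - sin x)"
  proof (rule f''_ge0_imp_convex)
    show "((\<lambda>x::real. - sin x) has_real_derivative - cos x) (at x)" for x
      by (auto intro!: derivative_eq_intros)
    show "((\<lambda>x::real. - cos x) has_real_derivative sin x) (at x)" for x
      by (auto intro!: derivative_eq_intros)
    show "0 \<le> sin x" if "x \<in> {0..pi / 2}" for x :: real
      using that by (intro sin_ge_zero) auto
  qed simp
  then have "- sin ((1 - 2 * u / pi) * 0 + (2 * u / pi) * (pi / 2))
      \<le> (1 - 2 * u / pi) * (- sin 0) + (2 * u / pi) * (- sin (pi / 2))"
    using assms by (intro convex_onD_Icc[where f = "\<lambda>x::real. - sin x", simplified real_scaleR_def])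
       (auto simp: field_simps)
  then show ?thesis by simp
qed

lemma square_le_one_minus_cos:
  fixes u :: real
  assumes "\<bar>u\<bar> \<le> pi"
  shows "2 * u\<^sup>2 / pi\<^sup>2 \<le> 1 - cos u"
proof -
  have "2 * (\<bar>u\<bar> / 2) / pi \<le> sin (\<bar>u\<bar> / 2)"
    using assms by (intro two_div_pi_mult_le_sin) auto
  then have "(\<bar>u\<bar> / pi)\<^sup>2 \<le> (sin (\<bar>u\<bar> / 2))\<^sup>2"
    by (intro power_mono) auto
  moreover have "cos u = 1 - 2 * (sin (\<bar>u\<bar> / 2))\<^sup>2"
    using cos_double_sin[of "\<bar>u\<bar> / 2"] by simp
  ultimately show ?thesis
    by (simp add: power_divide)
qed

lemma integral_periodic_shift:
  fixes h :: "real \<Rightarrow> real"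
  assumes h: "continuous_on UNIV h" and per: "\<And>x. h (x + 2 * pi) = h x"
    and c: "0 \<le> c" "c \<le> 2 * pi"
  shows "integral {0..2 * pi} (\<lambda>x. h (x + c)) = integral {0..2 * pi} h"
proof -
  have i: "h integrable_on {a..b}" for a b
    by (rule integrable_continuous_real) (rule continuous_on_subset[OF h], simp)
  have sh: "integral {a..b} (\<lambda>x. h (x + d)) = integral {a + d..b + d} h" for a b d
    using integral_shift[of a d b h] continuous_on_subset[OF h] by (simp add: o_def)
  have "integral {0..2 * pi} (\<lambda>x. h (x + c)) = integral {c..2 * pi + c} h"
    using sh[of 0 "2 * pi" c] by simp
  also have "\<dots> = integral {c..2 * pi} h + integral {2 * pi..2 * pi + c} h"
    using Henstock_Kurzweil_Integration.integral_combine[of c "2 * pi" "2 * pi + c" h] i c by simp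
  also have "integral {2 * pi..2 * pi + c} h = integral {0..c} h"
    using sh[of 0 c "2 * pi"] per by (simp add: add.commute)
  also have "integral {c..2 * pi} h + integral {0..c} h = integral {0..2 * pi} h"
    using Henstock_Kurzweil_Integration.integral_combine[of 0 c "2 * pi" h] i c by simp
  finally show ?thesis .
qed

text \<open>
The mean of \<open>(cosh n + cosh |y|)\<^sup>-\<^sup>3\<^sup>/\<^sup>2\<close> over a geodesic circle has this shape.  After a rotation
\<open>1 - cos v \<ge> 2 v\<^sup>2 / \<pi>\<^sup>2\<close> bounds the integrand by \<open>(m + q v\<^sup>2)\<^sup>-\<^sup>3\<^sup>/\<^sup>2\<close>, which has the algebraic
antiderivative \<open>v / (m (m + q v\<^sup>2)\<^sup>1\<^sup>/\<^sup>2)\<close>.  Since \<open>m + q \<pi>\<^sup>2 = m + 2 Q\<close>, the minimum \<open>m\<close>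
and the maximum \<open>m + 2 Q\<close> of \<open>X\<close> both show up in the bound.
\<close>

lemma integral_circle_kernel_le:
  fixes m Q \<omega> :: real
  assumes m: "m > 0" and Q: "Q \<ge> 0" and w: "0 \<le> \<omega>" "\<omega> \<le> 2 * pi"
  defines "X \<equiv> \<lambda>\<theta>. m + Q * (1 + cos (\<theta> - \<omega>))"
  shows "integral {0..2 * pi} (\<lambda>\<theta>. 1 / (X \<theta> * sqrt (X \<theta>))) \<le> 2 * pi / (m * sqrt (m + 2 * Q))"
proof -
  define Z where "Z v = m + Q * (1 - cos v)" for v
  define h where "h v = 1 / (Z v * sqrt (Z v))" for v
  define q where "q = 2 * Q / pi\<^sup>2"
  define Y where "Y v = m + q * v\<^sup>2" for v
  have Zpos: "Z v > 0" for v
    unfolding Z_def using m Q cos_le_one[of v] by (intro add_pos_nonneg mult_nonneg_nonneg) auto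
  have q: "q \<ge> 0"
    using Q by (simp add: q_def)
  have Ypos: "Y v > 0" for v
    unfolding Y_def using m q by (intro add_pos_nonneg mult_nonneg_nonneg) auto
  have hc: "continuous_on A h" for A
    unfolding h_def Z_def using Zpos unfolding Z_def
    by (intro continuous_intros) (auto simp: less_imp_neq[symmetric])
  \<comment> \<open>A shift by \<open>\<pi> - \<omega>\<close> modulo \<open>2\<pi>\<close>, chosen in \<open>[0, 2\<pi>]\<close>, moves the maximum of the integrand to \<open>v = 0\<close>.\<close>
  define d where "d = (if \<omega> \<le> pi then pi - \<omega> else 3 * pi - \<omega>)"
  have d: "0 \<le> d" "d \<le> 2 * pi"
    using w by (auto simp: d_def)
  have per: "h (v + 2 * pi) = h v" for v
    by (simp add: h_def Z_def)
  have Xh: "1 / (X \<theta> * sqrt (X \<theta>)) = h (\<theta> + d)" for \<theta>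
  proof -
    have "cos (\<theta> + d) = - cos (\<theta> - \<omega>)"
    proof (cases "\<omega> \<le> pi")
      case True
      then show ?thesis
        using cos_periodic_pi[of "\<theta> - \<omega>"] by (simp add: d_def algebra_simps)
    next
      case False
      have "cos (\<theta> + d) = cos ((\<theta> - \<omega> + pi) + 2 * pi)"
        using False by (simp add: d_def algebra_simps)
      also have "\<dots> = cos (\<theta> - \<omega> + pi)"
        by (rule cos_periodic)
      also have "\<dots> = - cos (\<theta> - \<omega>)"
        by (rule cos_periodic_pi)
      finally show ?thesis .
    qed
    then show ?thesis
      by (simp add: h_def X_def Z_def)
  qed
  have "integral {0..2 * pi} (\<lambda>\<theta>. 1 / (X \<theta> * sqrt (X \<theta>))) = integral {0..2 * pi} h"
    unfolding Xh by (rule integral_periodic_shift[OF hc per d])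
  also have "\<dots> = integral {0..2 * pi} (\<lambda>x. h (x + pi))"
    by (rule integral_periodic_shift[OF hc per, symmetric]) auto
  also have "\<dots> = integral {0..2 * pi} (\<lambda>x. h (x + - pi))"
  proof -
    have "h (x + pi) = h (x + - pi)" for x
      using per[of "x - pi"] by (simp add: algebra_simps)
    then show ?thesis by simp
  qed
  also have "\<dots> = integral {- pi..pi} h"
    using integral_shift[of 0 "- pi" "2 * pi" h] hc by (simp add: o_def)
  also have "\<dots> \<le> pi / (m * sqrt (Y pi)) - (- pi) / (m * sqrt (Y (- pi)))"
  proof (rule has_integral_le)
    show "(h has_integral integral {- pi..pi} h) {- pi..pi}"
      by (intro integrable_integral integrable_continuous_real hc)
    show "((\<lambda>v. 1 / (Y v * sqrt (Y v))) has_integral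
        (pi / (m * sqrt (Y pi)) - (- pi) / (m * sqrt (Y (- pi))))) {- pi..pi}"
    proof (rule fundamental_theorem_of_calculus)
      fix v
      have "((\<lambda>v. v / (m * sqrt (Y v))) has_real_derivative
          (m * sqrt (Y v) - v * (m * (2 * q * v / (2 * sqrt (Y v))))) / (m * sqrt (Y v))\<^sup>2) (at v)"
        using Ypos[of v] m unfolding Y_def
        by (auto intro!: derivative_eq_intros simp: power2_eq_square field_simps)
      moreover have "(m * sqrt (Y v) - v * (m * (2 * q * v / (2 * sqrt (Y v))))) / (m * sqrt (Y v))\<^sup>2
          = 1 / (Y v * sqrt (Y v))"
      proof -
        define z where "z = sqrt (Y v)"
        have z: "z > 0" "z * z = Y v" using Ypos[of v] by (auto simp: z_def)
        have "m * z - v * (m * (2 * q * v / (2 * z))) = m * (Y v - q * v\<^sup>2) / z"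
          using z by (simp add: field_simps power2_eq_square)
        also have "Y v - q * v\<^sup>2 = m" by (simp add: Y_def)
        finally show ?thesis
          using z m by (simp add: z_def[symmetric] z(2)[symmetric] power2_eq_square)
      qed
      ultimately show "((\<lambda>v. v / (m * sqrt (Y v))) has_vector_derivative 1 / (Y v * sqrt (Y v)))
          (at v within {- pi..pi})"
        by (simp add: has_real_derivative_iff_has_vector_derivative has_vector_derivative_at_within)
    qed simp
    show "h v \<le> 1 / (Y v * sqrt (Y v))" if "v \<in> {- pi..pi}" for v
    proof -
      have "Y v \<le> Z v"
        unfolding Y_def Z_def q_def
        using mult_left_mono[OF square_le_one_minus_cos[of v] Q] that
        by (simp add: abs_le_iff algebra_simps)
      then show ?thesis
        unfolding h_def using Ypos[of v]
        by (intro divide_left_mono mult_mono real_sqrt_le_mono mult_pos_pos) (auto intro: less_le_trans)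
    qed
  qed
  also have "\<dots> = 2 * pi / (m * sqrt (m + 2 * Q))"
    by (simp add: Y_def q_def)
  finally show ?thesis .
qed

text \<open>
From \<open>ln z \<le> z\<close> at \<open>z = (1 + x) / M\<close>, with \<open>M\<close> so large that \<open>a / M \<le> k\<close>.
\<close>

lemma power_le_exp:
  fixes a k :: real
  assumes "a \<ge> 0" "k > 0"
  shows "\<exists>B>0. \<forall>x\<ge>0. (1 + x) powr a \<le> B * exp (k * x)"
proof (intro exI[of _ "((a + 1) / k) powr a * exp k"] conjI allI impI)
  show "((a + 1) / k) powr a * exp k > 0"
    using assms by simp
  fix x :: real assume x: "x \<ge> 0"
  define M where "M = (a + 1) / k"
  have M: "M > 0" "a / M \<le> k"
    using assms by (auto simp: M_def field_simps)
  have "(1 + x) powr a = (M * ((1 + x) / M)) powr a"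
    using M by simp
  also have "\<dots> = M powr a * ((1 + x) / M) powr a"
    by (rule powr_mult)
  also have "((1 + x) / M) powr a \<le> exp (k * (1 + x))"
  proof -
    have "((1 + x) / M) powr a = exp (a * ln ((1 + x) / M))"
      using M x by (simp add: powr_def)
    also have "\<dots> \<le> exp (k * (1 + x))"
    proof -
      have "ln ((1 + x) / M) \<le> (1 + x) / M"
        using ln_le_minus_one[of "(1 + x) / M"] M x by simp
      then have "a * ln ((1 + x) / M) \<le> a * ((1 + x) / M)"
        using assms by (intro mult_left_mono) auto
      also have "\<dots> = (a / M) * (1 + x)" by simp
      also have "\<dots> \<le> k * (1 + x)"
        using M x by (intro mult_right_mono) auto
      finally show ?thesis by simp
    qed
    finally show ?thesis .
  qed
  finally have "(1 + x) powr a \<le> M powr a * exp (k * (1 + x))"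
    by (simp add: mult_left_mono)
  then show "(1 + x) powr a \<le> ((a + 1) / k) powr a * exp k * exp (k * x)"
    by (simp add: M_def distrib_left exp_add mult.assoc)
qed

text \<open>
The bound is the integral over the whole line, so it depends neither on \<open>c\<close> nor on \<open>t\<close>.
\<close>

lemma integral_power_decay_le:
  fixes a c t :: real
  assumes a: "a > 1" and t: "t \<ge> 0"
  shows "integral {0..t} (\<lambda>\<tau>. (1 + \<bar>\<tau> - c\<bar>) powr (- a)) \<le> 2 / (a - 1)"
proof -
  \<comment> \<open>The odd antiderivative of \<open>(1 + |y|)\<^sup>-\<^sup>a\<close>.\<close>
  define H where "H y = sgn y * (1 - (1 + \<bar>y\<bar>) powr (1 - a)) / (a - 1)" for y :: real
  have H: "\<bar>H y\<bar> \<le> 1 / (a - 1)" for y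
  proof -
    have "(1 + \<bar>y\<bar>) powr (1 - a) \<le> (1 + \<bar>y\<bar>) powr 0"
      using a by (intro powr_mono) auto
    also have "(1 + \<bar>y\<bar>) powr 0 = 1"
      using abs_ge_zero[of y] by (simp del: abs_ge_zero)
    finally have "(1 + \<bar>y\<bar>) powr (1 - a) \<le> 1" .
    moreover have "0 \<le> (1 + \<bar>y\<bar>) powr (1 - a)"
      by simp
    ultimately have "\<bar>sgn y\<bar> * \<bar>1 - (1 + \<bar>y\<bar>) powr (1 - a)\<bar> \<le> 1 * 1"
      by (intro mult_mono) (auto simp: abs_sgn_eq)
    then show ?thesis
      using a by (simp add: H_def abs_mult divide_right_mono)
  qed
  have cancel: "(0 - (1 - a) * z) / (a - 1) = z" "- (0 - (1 - a) * z * - 1) / (a - 1) = z" for z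
    using a by (simp_all add: field_simps)
  have Hpos: "((\<lambda>y. (1 - (1 + y) powr (1 - a)) / (a - 1)) has_real_derivative (1 + y) powr (- a)) (at y)"
    if "y > -1" for y
  proof -
    have "((\<lambda>y. (1 + y) powr (1 - a)) has_real_derivative (1 - a) * (1 + y) powr (- a)) (at y)"
      using that by (auto intro!: derivative_eq_intros)
    from DERIV_cdivide[OF DERIV_diff[OF DERIV_const this], of 1 "a - 1"] show ?thesis
      by (simp only: cancel)
  qed
  have Hneg: "((\<lambda>y. - (1 - (1 - y) powr (1 - a)) / (a - 1)) has_real_derivative (1 - y) powr (- a)) (at y)"
    if "y < 1" for y
  proof -
    have "((\<lambda>y. 1 - (1 + - y) powr (1 - a)) has_real_derivative 0 - (1 - a) * (1 + - y) powr (- a) * - 1) (at y)"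
      using that by (auto intro!: derivative_eq_intros)
    from DERIV_cdivide[OF DERIV_minus[OF this], of "a - 1"] show ?thesis
      by (simp only: cancel add_uminus_conv_diff)
  qed
  have D: "(H has_real_derivative (1 + \<bar>y\<bar>) powr (- a)) (at y)" for y
  proof -
    consider "y > 0" | "y < 0" | "y = 0" by linarith
    then show ?thesis
    proof cases
      case 1
      have "(H has_real_derivative (1 + y) powr (- a)) (at y)"
        by (rule has_field_derivative_transform_within_open[OF Hpos, where S = "{0<..}"])
          (use 1 in \<open>auto simp: H_def\<close>)
      then show ?thesis using 1 by simp
    next
      case 2
      have "(H has_real_derivative (1 - y) powr (- a)) (at y)"
        by (rule has_field_derivative_transform_within_open[OF Hneg, where S = "{..<0}"])
          (use 2 in \<open>auto simp: H_def\<close>)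
      then show ?thesis using 2 by simp
    next
      case 3
      have "(H has_real_derivative (1 + y) powr (- a)) (at y within {0..} \<union> {..0})"
        unfolding has_field_derivative_iff
      proof (rule Lim_Un; unfold has_field_derivative_iff[symmetric])
        show "(H has_real_derivative (1 + y) powr (- a)) (at y within {0..})"
          by (rule has_field_derivative_transform_within[OF has_field_derivative_at_within[OF Hpos], of _ 1])
            (use 3 in \<open>auto simp: H_def sgn_if\<close>)
        have "(H has_real_derivative (1 - y) powr (- a)) (at y within {..0})"
          by (rule has_field_derivative_transform_within[OF has_field_derivative_at_within[OF Hneg], of _ 1])
            (use 3 in \<open>auto simp: H_def sgn_if\<close>)
        then show "(H has_real_derivative (1 + y) powr (- a)) (at y within {..0})"
          using 3 by simp
      qed
      moreover have "{0..} \<union> {..0} = (UNIV :: real set)" by auto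
      ultimately show ?thesis using 3 by simp
    qed
  qed
  have "((\<lambda>\<tau>. (1 + \<bar>\<tau> - c\<bar>) powr (- a)) has_integral (H (t - c) - H (0 - c))) {0..t}"
  proof (rule fundamental_theorem_of_calculus[OF t])
    fix \<tau>
    have "((\<lambda>\<tau>. H (\<tau> - c)) has_real_derivative (1 + \<bar>\<tau> - c\<bar>) powr (- a) * 1) (at \<tau>)"
      by (rule DERIV_chain2[OF D]) (auto intro!: derivative_eq_intros)
    then show "((\<lambda>\<tau>. H (\<tau> - c)) has_vector_derivative (1 + \<bar>\<tau> - c\<bar>) powr (- a)) (at \<tau> within {0..t})"
      by (simp add: has_real_derivative_iff_has_vector_derivative has_vector_derivative_at_within)
  qed
  then have "integral {0..t} (\<lambda>\<tau>. (1 + \<bar>\<tau> - c\<bar>) powr (- a)) = H (t - c) - H (0 - c)"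
    by (rule integral_unique)
  also have "\<dots> \<le> 1 / (a - 1) + 1 / (a - 1)"
    using H[of "t - c"] H[of "0 - c"] by linarith
  finally show ?thesis by simp
qed


text \<open>
With \<open>y = t - r\<close>: up to a constant, a bound for the share of a wave sent out at time \<open>0\<close> from the shell of radius \<open>n\<close> that is seen at time
\<open>t\<close> and distance \<open>r\<close>, once the common factor \<open>e\<^sup>-\<^sup>r\<^sup>/\<^sup>2\<close> is split off.  The rate \<open>1/4\<close> is small enough for
\<open>wave_radius_bounds\<close> to pass from the radius of a circle to the time.
\<close>

definition shell_decay :: "nat \<Rightarrow> real \<Rightarrow> real" where
  "shell_decay n y = exp (- max 0 (\<bar>y\<bar> - real n) / 4)"

text \<open>
Put \<open>x = max 0 (|\<tau> - d| - n)\<close>.  Since \<open>|d| \<le> x + 2 n + |\<tau> - n|\<close>, the factor \<open>(1 + |d|)\<^sup>a\<close> splits into powers of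
\<open>1 + x\<close>, which the exponential absorbs, and either \<open>(1 + |\<tau> - n|)\<^sup>a\<close> or \<open>(1 + n)\<^sup>a\<close>.  In the first case the
integrability in \<open>\<tau>\<close> is regained from the exponential, because \<open>1 + |\<tau> - d| \<le> (1 + x) (1 + n)\<close>.  Both cases
cost exactly one factor \<open>(1 + n)\<^sup>a\<close>.
\<close>

lemma shell_weight_pointwise:
  fixes a b :: real
  assumes a: "a \<ge> 0"
  shows "\<exists>B>0. \<forall>(d::real) (\<tau>::real) (n::nat).
    (1 + \<bar>d\<bar>) powr a * ((1 + \<bar>\<tau> - n\<bar>) powr (- a) * (1 + real n) powr (- b) * shell_decay n (\<tau> - d))
    \<le> B * (1 + real n) powr (a - b) * ((1 + \<bar>\<tau> - n\<bar>) powr (- a) + (1 + \<bar>\<tau> - d\<bar>) powr (- a))"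
proof -
  obtain B0 where B0: "B0 > 0" "\<And>x. x \<ge> 0 \<Longrightarrow> (1 + x) powr (2 * a) \<le> B0 * exp (1 / 4 * x)"
    using power_le_exp[of "2 * a" "1 / 4"] a by auto
  show ?thesis
  proof (intro exI[of _ "4 powr a * B0"] conjI allI)
    show "4 powr a * B0 > 0"
      using B0 by simp
    fix d \<tau> :: real and n :: nat
    define x where "x = max 0 (\<bar>\<tau> - d\<bar> - real n)"
    define X D E N A where "X = 1 + x" and "D = 1 + \<bar>d\<bar>" and "E = 1 + \<bar>\<tau> - d\<bar>"
      and "N = 1 + real n" and "A = 1 + \<bar>\<tau> - n\<bar>"
    have ge: "X \<ge> 1" "D \<ge> 1" "E \<ge> 1" "N \<ge> 1" "A \<ge> 1"
      by (auto simp: X_def D_def E_def N_def A_def x_def)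
    have ker: "shell_decay n (\<tau> - d) \<le> B0 * (X powr (- a) * X powr (- a))"
    proof -
      have "X powr (2 * a) \<le> B0 * exp (1 / 4 * x)"
        unfolding X_def by (rule B0) (simp add: x_def)
      moreover have "X powr (2 * a) > 0"
        using ge by auto
      ultimately have "exp (- (1 / 4 * x)) \<le> B0 * inverse (X powr (2 * a))"
        by (simp add: exp_minus field_simps)
      then show ?thesis
        by (simp add: shell_decay_def x_def powr_add[symmetric] powr_minus[symmetric])
    qed
    have "D \<le> X + \<bar>\<tau> - n\<bar> + 2 * real n"
      by (auto simp: D_def X_def x_def)
    also have "\<dots> \<le> X * (2 * (A + N))"
    proof -
      have "X * 1 \<le> X * A" "1 * (A + 2 * N) \<le> X * (A + 2 * N)"
        using ge by (auto intro!: mult_left_mono mult_right_mono)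
      then have "X + (A + 2 * N) \<le> X * A + X * (A + 2 * N)"
        by simp
      then show ?thesis
        by (simp add: A_def N_def algebra_simps)
    qed
    also have "\<dots> \<le> 4 * X * max A N"
      using ge by (simp add: max_def)
    finally have "D powr a \<le> (4 * X * max A N) powr a"
      using ge a by (intro powr_mono2) auto
    also have "\<dots> = 4 powr a * X powr a * (max A N) powr a"
      by (simp add: powr_mult)
    also have "\<dots> \<le> 4 powr a * X powr a * (A powr a + N powr a)"
      by (intro mult_left_mono) (auto simp: max_def)
    finally have D: "D powr a \<le> 4 powr a * X powr a * (A powr a + N powr a)" .
    have "E \<le> X * N"
    proof -
      have "E \<le> x + N" by (auto simp: E_def N_def x_def)
      also have "\<dots> \<le> x * N + N"
        using ge mult_left_mono[of 1 N x] by (simp add: X_def)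
      finally show ?thesis by (simp add: X_def algebra_simps)
    qed
    then have "E powr a \<le> X powr a * N powr a"
      using ge a powr_mono2[of a E "X * N"] by (simp add: powr_mult)
    then have XE: "X powr (- a) \<le> N powr a * E powr (- a)"
      using ge by (simp add: powr_minus field_simps)
    have X1: "X powr (- a) \<le> 1"
      using ge a powr_mono[of "- a" 0 X] by simp
    have "D powr a * (A powr (- a) * N powr (- b) * shell_decay n (\<tau> - d))
      \<le> (4 powr a * X powr a * (A powr a + N powr a)) * (A powr (- a) * N powr (- b) *
          (B0 * (X powr (- a) * X powr (- a))))"
      using D ker by (intro mult_mono mult_left_mono) (auto simp: shell_decay_def)
    also have "\<dots> = 4 powr a * B0 * (X powr a * X powr (- a)) *
        (X powr (- a) * (A powr a * A powr (- a)) * N powr (- b)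
          + X powr (- a) * A powr (- a) * (N powr a * N powr (- b)))"
      by (simp add: algebra_simps)
    also have "\<dots> = 4 powr a * B0 * (X powr (- a) * N powr (- b) + X powr (- a) * A powr (- a) * N powr (a - b))"
      using ge by (simp add: powr_add[symmetric])
    also have "\<dots> \<le> 4 powr a * B0 * ((N powr a * E powr (- a)) * N powr (- b) + 1 * A powr (- a) * N powr (a - b))"
      using XE X1 B0 by (intro mult_left_mono add_mono mult_right_mono) auto
    also have "\<dots> = 4 powr a * B0 * N powr (a - b) * (A powr (- a) + E powr (- a))"
      by (simp add: algebra_simps powr_add[symmetric])
    finally show "(1 + \<bar>d\<bar>) powr a * ((1 + \<bar>\<tau> - n\<bar>) powr (- a) * (1 + real n) powr (- b) * shell_decay n (\<tau> - d))
      \<le> 4 powr a * B0 * (1 + real n) powr (a - b) * ((1 + \<bar>\<tau> - n\<bar>) powr (- a) + (1 + \<bar>\<tau> - d\<bar>) powr (- a))"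
      by (simp add: D_def A_def N_def E_def)
  qed
qed

section \<open>The solution operator as an integral over a hemisphere\<close>

lemma hcircle_in_H2: "x \<in> H2 \<Longrightarrow> hcircle x s \<theta> \<in> H2"
  by (simp add: hcircle_eq mobius_in_H2 polar_in_H2)

lemma continuous_on_hcircle [continuous_intros]:
  assumes "continuous_on A X" "continuous_on A S" "continuous_on A \<Theta>"
    and H: "\<And>p. p \<in> A \<Longrightarrow> X p \<in> H2"
  shows "continuous_on A (\<lambda>p. hcircle (X p) (S p) (\<Theta> p))"
proof -
  have *: "1 + cnj (X p) * (of_real (tanh (S p / 2)) * cis (\<Theta> p)) \<noteq> 0" if "p \<in> A" for p
    using mobius_denom[OF H[OF that] polar_in_H2] by (simp add: polar_def)
  have c: "continuous_on A (\<lambda>p. cis (\<Theta> p))"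
    unfolding cis_conv_exp using assms by (intro continuous_intros)
  have t: "continuous_on A (\<lambda>p. tanh (S p / 2))"
    using assms by (intro continuous_intros) auto
  show ?thesis
    unfolding hcircle_def mobius_def
    by (intro continuous_intros c t assms) (use * in auto)
qed

text \<open>
The geodesic radius \<open>s\<close> with \<open>sinh (s/2) = sinh (t/2) sin \<phi>\<close>.  For \<open>t \<ge> 0\<close> it increases from \<open>0\<close> to \<open>t\<close>
with \<open>\<phi> \<in> [0, \<pi>/2]\<close>; it is odd and smooth in \<open>t\<close>.
\<close>

definition wave_radius :: "real \<Rightarrow> real \<Rightarrow> real" where
  "wave_radius t \<phi> = 2 * arsinh (sinh (t / 2) * sin \<phi>)"

text \<open>
Since \<open>sin \<phi> d\<phi> d\<theta>\<close> is the area element of the unit sphere, this is an integral over a hemisphere.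
\<close>

definition hemisphere_integral :: "(complex \<Rightarrow> real) \<Rightarrow> real \<Rightarrow> complex \<Rightarrow> real" where
  "hemisphere_integral f t x = integral (cbox (0, 0) (pi / 2, 2 * pi))
     (\<lambda>(\<phi>, \<theta>). sin \<phi> * f (hcircle x (wave_radius t \<phi>) \<theta>))"

lemma sinh_half_wave_radius: "sinh (wave_radius t \<phi> / 2) = sinh (t / 2) * sin \<phi>"
  by (simp add: wave_radius_def)

lemma continuous_on_arsinh_real [continuous_intros]:
  "continuous_on A f \<Longrightarrow> continuous_on A (\<lambda>x. arsinh (f x :: real))"
  unfolding arsinh_real_def
  by (intro continuous_intros) (auto simp: arsinh_real_aux[THEN less_imp_neq, symmetric])

lemma continuous_on_wave_radius [continuous_intros]:
  fixes T \<Phi> :: "'a::t2_space \<Rightarrow> real"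
  shows "continuous_on A T \<Longrightarrow> continuous_on A \<Phi> \<Longrightarrow> continuous_on A (\<lambda>p. wave_radius (T p) (\<Phi> p))"
  unfolding wave_radius_def by (intro continuous_intros) auto

lemma wave_radius_deriv_time:
  "((\<lambda>t. wave_radius t \<phi>) has_real_derivative cosh (t / 2) * sin \<phi> / cosh (wave_radius t \<phi> / 2)) (at t)"
  unfolding wave_radius_def
  by (auto intro!: derivative_eq_intros DERIV_chain2[OF arsinh_real_has_field_derivative]
      simp: cosh_arsinh_real field_simps)

lemma wave_radius_deriv_angle:
  "((\<lambda>\<phi>. wave_radius t \<phi>) has_real_derivative 2 * sinh (t / 2) * cos \<phi> / cosh (wave_radius t \<phi> / 2)) (at \<phi>)"
  unfolding wave_radius_def
  by (auto intro!: derivative_eq_intros DERIV_chain2[OF arsinh_real_has_field_derivative]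
      simp: cosh_arsinh_real field_simps)

text \<open>
This says that \<open>wave_radius\<close> has speed at most one in time, see \<open>wave_radius_deriv_time\<close>.
\<close>

lemma cosh_mult_sin_le:
  assumes "0 \<le> \<phi>" "\<phi> \<le> pi / 2"
  shows "cosh (t / 2) * sin \<phi> \<le> cosh (wave_radius t \<phi> / 2)"
proof (rule power2_le_imp_le)
  have "(sin \<phi>)\<^sup>2 \<le> 1"
    by (simp add: abs_square_le_1)
  then show "(cosh (t / 2) * sin \<phi>)\<^sup>2 \<le> (cosh (wave_radius t \<phi> / 2))\<^sup>2"
    by (simp add: cosh_square_eq sinh_half_wave_radius power_mult_distrib algebra_simps)
qed simp

text \<open>
The integrand may depend on the same parameter as the time and the centre; this is what the Duhamel term needs.
\<close>

lemma continuous_on_hemisphere_integral: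
  fixes T :: "'a::t2_space \<Rightarrow> real"
  assumes T: "continuous_on P T" and X: "continuous_on P X" "\<And>p. p \<in> P \<Longrightarrow> X p \<in> H2"
    and h: "continuous_on (P \<times> H2) (\<lambda>(p, y). h p y)"
  shows "continuous_on P (\<lambda>p. hemisphere_integral (h p) (T p) (X p))"
  unfolding hemisphere_integral_def
proof (rule integral_continuous_on_param)
  let ?D = "P \<times> cbox (0, 0) (pi / 2, 2 * pi :: real)"
  have c: "continuous_on ?D (\<lambda>z. hcircle (X (fst z)) (wave_radius (T (fst z)) (fst (snd z))) (snd (snd z)))"
    by (intro continuous_intros continuous_on_compose2[OF T] continuous_on_compose2[OF X(1)])
      (auto simp: X(2))
  have "continuous_on ?D (\<lambda>z. h (fst z) (hcircle (X (fst z)) (wave_radius (T (fst z)) (fst (snd z))) (snd (snd z))))"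
  proof -
    have "(\<lambda>z. (fst z, hcircle (X (fst z)) (wave_radius (T (fst z)) (fst (snd z))) (snd (snd z)))) ` ?D \<subseteq> P \<times> H2"
      by (auto simp: hcircle_in_H2 X(2))
    from continuous_on_compose2[OF h continuous_on_Pair[OF continuous_on_fst[OF continuous_on_id] c] this]
    show ?thesis by simp
  qed
  then have "continuous_on ?D (\<lambda>z. sin (fst (snd z)) *
      h (fst z) (hcircle (X (fst z)) (wave_radius (T (fst z)) (fst (snd z))) (snd (snd z))))"
    by (intro continuous_intros)
  then show "continuous_on ?D (\<lambda>(p, q). case q of (\<phi>, \<theta>) \<Rightarrow> sin \<phi> * h p (hcircle (X p) (wave_radius (T p) \<phi>) \<theta>))"
    by (simp add: case_prod_unfold)
qed

definition angular_integral :: "(complex \<Rightarrow> real) \<Rightarrow> complex \<Rightarrow> real \<Rightarrow> real" where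
  "angular_integral f x s = integral {0..2 * pi} (\<lambda>\<theta>. f (hcircle x s \<theta>))"

lemma continuous_on_angular_integral:
  assumes f: "continuous_on H2 f" and x: "x \<in> H2"
  shows "continuous_on A (angular_integral f x)"
proof -
  have "continuous_on (A \<times> cbox 0 (2 * pi)) (\<lambda>(s, \<theta>). f (hcircle x s \<theta>))"
    unfolding case_prod_unfold
    by (intro continuous_on_compose2[OF f] continuous_intros) (auto simp: x hcircle_in_H2)
  from integral_continuous_on_param[OF this] show ?thesis
    by (simp add: angular_integral_def[abs_def])
qed

lemma continuous_on_hemisphere_integrand:
  assumes f: "continuous_on H2 f" and x: "x \<in> H2"
  shows "continuous_on A (\<lambda>(\<phi>, \<theta>). sin \<phi> * f (hcircle x (wave_radius t \<phi>) \<theta>))"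
  unfolding case_prod_unfold
  by (intro continuous_intros continuous_on_compose2[OF f]) (auto simp: x hcircle_in_H2)

lemma hemisphere_integral_iterated:
  assumes f: "continuous_on H2 f" and x: "x \<in> H2"
  shows "hemisphere_integral f t x = integral {0..pi / 2} (\<lambda>\<phi>. sin \<phi> * angular_integral f x (wave_radius t \<phi>))"
  using integral_prod_continuous[OF continuous_on_hemisphere_integrand[OF f x]]
  by (simp add: hemisphere_integral_def angular_integral_def)

lemma abs_hemisphere_integral_le:
  assumes f: "continuous_on H2 f" and w: "continuous_on H2 w" and x: "x \<in> H2"
    and le: "\<And>y. y \<in> H2 \<Longrightarrow> \<bar>f y\<bar> \<le> w y"
  shows "\<bar>hemisphere_integral f t x\<bar> \<le> hemisphere_integral w t x"
  unfolding hemisphere_integral_def real_norm_def[symmetric]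
proof (rule integral_norm_bound_integral)
  fix q :: "real \<times> real" assume "q \<in> cbox (0, 0) (pi / 2, 2 * pi)"
  then have "0 \<le> sin (fst q)"
    by (cases q) (auto simp: cbox_Pair_eq intro!: sin_ge_zero)
  then show "norm (case q of (\<phi>, \<theta>) \<Rightarrow> sin \<phi> * f (hcircle x (wave_radius t \<phi>) \<theta>))
      \<le> (case q of (\<phi>, \<theta>) \<Rightarrow> sin \<phi> * w (hcircle x (wave_radius t \<phi>) \<theta>))"
    by (cases q) (simp add: abs_mult mult_left_mono le hcircle_in_H2[OF x])
qed (intro integrable_continuous continuous_on_hemisphere_integrand f w x)+

text \<open>
The point with polar coordinates \<open>(-s, \<theta>)\<close> is the one with coordinates \<open>(s, \<theta> + \<pi>)\<close>.
\<close>

lemma angular_integral_minus: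
  assumes f: "continuous_on H2 f" and x: "x \<in> H2"
  shows "angular_integral f x (- s) = angular_integral f x s"
proof -
  have "hcircle x (- s) \<theta> = hcircle x s (\<theta> + pi)" for \<theta>
    by (simp add: hcircle_def cis_mult[symmetric])
  then have "angular_integral f x (- s) = integral {0..2 * pi} (\<lambda>\<theta>. f (hcircle x s (\<theta> + pi)))"
    by (simp add: angular_integral_def)
  also have "\<dots> = angular_integral f x s"
    unfolding angular_integral_def
  proof (rule integral_periodic_shift)
    show "continuous_on UNIV (\<lambda>\<theta>. f (hcircle x s \<theta>))"
      by (intro continuous_on_compose2[OF f] continuous_intros) (auto simp: x hcircle_in_H2)
    show "f (hcircle x s (\<theta> + 2 * pi)) = f (hcircle x s \<theta>)" for \<theta>
      by (simp add: hcircle_def cis_mult[symmetric])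
  qed auto
  finally show ?thesis .
qed

text \<open>
Together with the odd factor \<open>sinh (t/2)\<close> this yields the odd extension of \<open>I\<close> to negative times.
\<close>

lemma hemisphere_integral_minus:
  assumes f: "continuous_on H2 f" and x: "x \<in> H2"
  shows "hemisphere_integral f (- t) x = hemisphere_integral f t x"
proof -
  have "wave_radius (- t) \<phi> = - wave_radius t \<phi>" for \<phi>
    by (simp add: wave_radius_def)
  then show ?thesis
    by (simp add: hemisphere_integral_iterated[OF f x] angular_integral_minus[OF f x])
qed

section \<open>Pointwise decay of the hemisphere integral\<close>

lemma hdist_0_nonneg: "x \<in> H2 \<Longrightarrow> 0 \<le> hdist 0 x"
  by (auto simp: hdist_0 H2_iff artanh_def intro!: ln_ge_zero)

lemma cosh_sinh_hdist:
  assumes x: "x \<in> H2"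
  shows "cosh (hdist 0 x) = (1 + (cmod x)\<^sup>2) / (1 - (cmod x)\<^sup>2)"
    and "sinh (hdist 0 x) = 2 * cmod x / (1 - (cmod x)\<^sup>2)"
proof -
  define y where "y = cmod x"
  have y: "0 \<le> y" "y < 1" "1 - y\<^sup>2 = (1 - y) * (1 + y)"
    using x by (auto simp: y_def H2_iff power2_eq_square algebra_simps)
  have h: "hdist 0 x = ln ((1 + y) / (1 - y))"
    using x by (simp add: hdist_0 artanh_def y_def)
  have p: "(1 + y) / (1 - y) > 0"
    using y by auto
  have frac: "(v / u + inverse (v / u)) / 2 = (v * v + u * u) / 2 / (u * v)"
    "(v / u - inverse (v / u)) / 2 = (v * v - u * u) / 2 / (u * v)" if "u \<noteq> 0" "v \<noteq> 0" for u v :: real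
    using that by (simp_all add: field_simps)
  have "cosh (hdist 0 x) = ((1 + y) * (1 + y) + (1 - y) * (1 - y)) / 2 / (1 - y\<^sup>2)"
    unfolding h cosh_ln_real[OF p] y(3) using y by (intro frac) auto
  also have "((1 + y) * (1 + y) + (1 - y) * (1 - y)) / 2 = 1 + y\<^sup>2"
    by (simp add: power2_eq_square algebra_simps)
  finally have "cosh (hdist 0 x) = (1 + y\<^sup>2) / (1 - y\<^sup>2)" .
  moreover have "sinh (hdist 0 x) = ((1 + y) * (1 + y) - (1 - y) * (1 - y)) / 2 / (1 - y\<^sup>2)"
    unfolding h sinh_ln_real[OF p] y(3) using y by (intro frac) auto
  then have "sinh (hdist 0 x) = 2 * y / (1 - y\<^sup>2)"
    by (simp add: algebra_simps)
  ultimately show "cosh (hdist 0 x) = (1 + (cmod x)\<^sup>2) / (1 - (cmod x)\<^sup>2)"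
    and "sinh (hdist 0 x) = 2 * cmod x / (1 - (cmod x)\<^sup>2)"
    by (simp_all add: y_def)
qed

text \<open>
The hyperbolic law of cosines, for the triangle formed by the origin, \<open>x\<close> and a point of the circle.  The
angle \<open>\<omega>\<close> is the argument of \<open>x\<close>.
\<close>

lemma cosh_hdist_hcircle:
  assumes x: "x \<in> H2" and s: "s \<ge> 0"
  obtains \<omega> where "0 \<le> \<omega>" "\<omega> \<le> 2 * pi"
    "\<And>\<theta>. cosh (hdist 0 (hcircle x s \<theta>)) =
      cosh (hdist 0 x) * cosh s + sinh (hdist 0 x) * sinh s * cos (\<theta> - \<omega>)"
proof
  define \<omega> where "\<omega> = Arg2pi x"
  show "0 \<le> \<omega>" "\<omega> \<le> 2 * pi"
    using Arg2pi[of x] by (auto simp: \<omega>_def)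
  fix \<theta>
  define y where "y = hcircle x s \<theta>"
  define z where "z = polar s \<theta>"
  define a b where "a = cmod x" and "b = tanh (s / 2)"
  have b: "0 \<le> b" "b < 1"
    using s tanh_real_lt_1[of "s / 2"] by (auto simp: b_def)
  have a: "0 \<le> a" "a < 1"
    using x by (auto simp: a_def H2_iff)
  have b2: "1 - b\<^sup>2 > 0" and a2: "1 - a\<^sup>2 > 0"
    using a b by (auto simp: abs_square_less_1)
  have nz: "cmod z = b"
    using b by (simp add: z_def cmod_polar b_def)
  have zH: "z \<in> H2"
    by (simp add: z_def polar_in_H2)
  have yz: "y = mobius x z"
    by (simp add: y_def z_def hcircle_eq)
  have yH: "y \<in> H2"
    using x zH by (simp add: yz mobius_in_H2)
  have xw: "x = of_real a * cis \<omega>"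
    using Arg2pi_eq[of x] by (simp add: a_def \<omega>_def cis_conv_exp)
  have "cnj x * z = of_real (a * b) * cis (\<theta> - \<omega>)"
    by (simp add: xw z_def polar_def b_def cis_cnj cis_mult)
  then have den: "(cmod (1 + cnj x * z))\<^sup>2 = 1 + 2 * a * b * cos (\<theta> - \<omega>) + a\<^sup>2 * b\<^sup>2"
  proof -
    assume *: "cnj x * z = of_real (a * b) * cis (\<theta> - \<omega>)"
    have "(cmod (1 + cnj x * z))\<^sup>2 = (1 + a * b * cos (\<theta> - \<omega>))\<^sup>2 + (a * b * sin (\<theta> - \<omega>))\<^sup>2"
      unfolding * cmod_power2 by simp
    also have "\<dots> = 1 + 2 * a * b * cos (\<theta> - \<omega>) + a\<^sup>2 * b\<^sup>2 * ((cos (\<theta> - \<omega>))\<^sup>2 + (sin (\<theta> - \<omega>))\<^sup>2)"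
      by algebra
    finally show ?thesis by simp
  qed
  have pos: "(cmod (1 + cnj x * z))\<^sup>2 > 0"
    using mobius_denom[OF x zH] by simp
  have y1: "1 - (cmod y)\<^sup>2 = (1 - a\<^sup>2) * (1 - b\<^sup>2) / (cmod (1 + cnj x * z))\<^sup>2"
    using mobius_norm[OF x zH] by (simp add: yz a_def nz)
  have "cosh (hdist 0 y) = 2 / (1 - (cmod y)\<^sup>2) - 1"
    using cosh_sinh_hdist(1)[OF yH] H2_pos[OF yH] by (simp add: field_simps)
  also have "\<dots> = 2 * (1 + 2 * a * b * cos (\<theta> - \<omega>) + a\<^sup>2 * b\<^sup>2) / ((1 - a\<^sup>2) * (1 - b\<^sup>2)) - 1"
    unfolding y1 den by simp
  also have "\<dots> = ((1 + a\<^sup>2) / (1 - a\<^sup>2)) * ((1 + b\<^sup>2) / (1 - b\<^sup>2))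
      + (2 * a / (1 - a\<^sup>2)) * (2 * b / (1 - b\<^sup>2)) * cos (\<theta> - \<omega>)"
  proof -
    have "2 * (1 + 2 * a * b * c + a\<^sup>2 * b\<^sup>2) / (u * v) - 1 =
        ((1 + a\<^sup>2) / u) * ((1 + b\<^sup>2) / v) + (2 * a / u) * (2 * b / v) * c"
      if "u = 1 - a\<^sup>2" "v = 1 - b\<^sup>2" for u v c
    proof -
      have "u \<noteq> 0" "v \<noteq> 0" using that a2 b2 by auto
      then have "2 * (1 + 2 * a * b * c + a\<^sup>2 * b\<^sup>2) / (u * v) - 1
          = (2 * (1 + 2 * a * b * c + a\<^sup>2 * b\<^sup>2) - u * v) / (u * v)"
        by (simp add: field_simps)
      also have "2 * (1 + 2 * a * b * c + a\<^sup>2 * b\<^sup>2) - u * v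
          = (1 + a\<^sup>2) * (1 + b\<^sup>2) + (2 * a) * (2 * b) * c"
        unfolding that by (simp add: algebra_simps)
      also have "(A * B + C * D * c) / (u * v) = (A / u) * (B / v) + (C / u) * (D / v) * c" for A B C D
        by (simp add: add_divide_distrib)
      finally show ?thesis .
    qed
    then show ?thesis by blast
  qed
  also have "(1 + a\<^sup>2) / (1 - a\<^sup>2) = cosh (hdist 0 x)"
    using cosh_sinh_hdist(1)[OF x] by (simp add: a_def)
  also have "2 * a / (1 - a\<^sup>2) = sinh (hdist 0 x)"
    using cosh_sinh_hdist(2)[OF x] by (simp add: a_def)
  also have "2 * b / (1 - b\<^sup>2) = sinh s"
    by (simp add: sinh_tanh_half[of s] b_def)
  also have "(1 + b\<^sup>2) / (1 - b\<^sup>2) = cosh s"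
  proof -
    have "hdist 0 (polar s 0) = s"
      using s by (rule hdist_polar)
    then show ?thesis
      using cosh_sinh_hdist(1)[OF polar_in_H2[of s 0]] b by (simp add: cmod_polar b_def)
  qed
  finally show "cosh (hdist 0 (hcircle x s \<theta>)) =
      cosh (hdist 0 x) * cosh s + sinh (hdist 0 x) * sinh s * cos (\<theta> - \<omega>)"
    by (simp add: y_def)
qed

lemma cosh_ge_half_exp: "exp \<bar>y\<bar> / 2 \<le> cosh y" for y :: real
proof -
  have "exp \<bar>y\<bar> / 2 \<le> cosh \<bar>y\<bar>"
    by (simp add: cosh_def)
  then show ?thesis
    using cosh_real_abs[of y] by simp
qed

lemma cosh_le_exp: "cosh y \<le> exp \<bar>y\<bar>" for y :: real
proof -
  have "exp (- \<bar>y\<bar>) \<le> exp \<bar>y\<bar>" by simp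
  then have "cosh \<bar>y\<bar> \<le> exp \<bar>y\<bar>"
    by (simp add: cosh_def)
  then show ?thesis
    by simp
qed

text \<open>
The term \<open>n = \<lfloor>\<rho>\<rfloor>\<close> alone is large enough: there \<open>cosh n + cosh \<rho> \<le> 2 e\<^sup>\<rho>\<close> and \<open>e\<^sup>n \<ge> e\<^sup>\<rho>\<^sup>-\<^sup>1\<close>.
A finite sum suffices because the points of a given circle have bounded distance from the origin, and
it can be interchanged with the integral freely.
\<close>

lemma exp_half_le_shell_bumps:
  fixes G :: "nat \<Rightarrow> real"
  assumes rho: "0 \<le> \<rho>" "\<rho> < real N" and G: "\<And>n. G n \<ge> 0"
  shows "exp (- \<rho> / 2) * G (nat \<lfloor>\<rho>\<rfloor>) \<le> 2 * sqrt 2 * exp 1 *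
    (\<Sum>n<N. G n * exp (real n) * (1 / ((cosh n + cosh \<rho>) * sqrt (cosh n + cosh \<rho>))))"
proof -
  define m where "m = nat \<lfloor>\<rho>\<rfloor>"
  have m: "real m \<le> \<rho>" "\<rho> - 1 \<le> real m" "m < N"
    using rho by (auto simp: m_def) linarith+
  define X where "X = cosh (real m) + cosh \<rho>"
  have X0: "X > 0"
    by (simp add: X_def add_pos_pos)
  have "X \<le> 2 * exp \<rho>"
  proof -
    have "cosh (real m) \<le> cosh \<rho>"
      using m by (simp add: cosh_real_nonneg_le_iff)
    then show ?thesis
      using cosh_le_exp[of \<rho>] rho by (simp add: X_def)
  qed
  then have "X * sqrt X \<le> (2 * exp \<rho>) * sqrt (2 * exp \<rho>)"
    using X0 by (intro mult_mono real_sqrt_le_mono) auto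
  also have "\<dots> = 2 * sqrt 2 * exp 1 * (exp (\<rho> - 1) * exp (\<rho> / 2))"
  proof -
    have "sqrt (exp \<rho>) = exp (\<rho> / 2)"
      by (rule real_sqrt_unique) (auto simp: power2_eq_square exp_add[symmetric])
    then show ?thesis
      by (simp add: real_sqrt_mult exp_diff)
  qed
  also have "\<dots> \<le> 2 * sqrt 2 * exp 1 * (exp (real m) * exp (\<rho> / 2))"
    using m by (intro mult_left_mono mult_right_mono) auto
  finally have "exp (- \<rho> / 2) \<le> 2 * sqrt 2 * exp 1 * (exp (real m) * (1 / (X * sqrt X)))"
    using X0 by (simp add: exp_minus field_simps)
  then have "exp (- \<rho> / 2) * G m \<le> 2 * sqrt 2 * exp 1 * (exp (real m) * (1 / (X * sqrt X))) * G m"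
    using G by (rule mult_right_mono)
  also have "\<dots> = 2 * sqrt 2 * exp 1 * (G m * exp (real m) * (1 / (X * sqrt X)))"
    by simp
  also have "\<dots> \<le> 2 * sqrt 2 * exp 1 *
    (\<Sum>n<N. G n * exp (real n) * (1 / ((cosh n + cosh \<rho>) * sqrt (cosh n + cosh \<rho>))))"
    unfolding X_def using m(3)
    by (intro mult_left_mono member_le_sum[where f = "\<lambda>n. G n * exp (real n) *
          (1 / ((cosh (real n) + cosh \<rho>) * sqrt (cosh (real n) + cosh \<rho>)))"])
      (auto intro!: mult_nonneg_nonneg divide_nonneg_nonneg G add_nonneg_nonneg)
  finally show ?thesis
    by (simp add: m_def)
qed

text \<open>
On the circle \<open>cosh n + cosh |y|\<close> runs between \<open>cosh n + cosh (r - s)\<close> and \<open>cosh n + cosh (r + s)\<close>.  Hence the mean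
of the \<open>n\<close>-th bump is at most \<open>e\<^sup>n / ((cosh n + cosh (r - s)) (cosh (r + s))\<^sup>1\<^sup>/\<^sup>2)\<close>.  The second factor
of the denominator gives \<open>e\<^sup>-\<^sup>(\<^sup>r\<^sup>+\<^sup>s\<^sup>)\<^sup>/\<^sup>2\<close>; the first one compensates \<open>e\<^sup>n\<close> unless \<open>|r - s| > n\<close>.
\<close>

lemma angular_integral_le:
  fixes G :: "nat \<Rightarrow> real"
  assumes f: "continuous_on H2 f" and x: "x \<in> H2" and s: "s \<ge> 0"
    and G: "\<And>n. G n \<ge> 0"
    and fG: "\<And>y. y \<in> H2 \<Longrightarrow> f y \<le> exp (- hdist 0 y / 2) * G (nat \<lfloor>hdist 0 y\<rfloor>)"
    and N: "hdist 0 x + s < real N"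
  shows "angular_integral f x s \<le> 16 * pi * exp 1 * exp (- (hdist 0 x + s) / 2) *
    (\<Sum>n<N. G n * exp (- max 0 (\<bar>hdist 0 x - s\<bar> - real n)))"
proof -
  define r where "r = hdist 0 x"
  have r: "r \<ge> 0"
    unfolding r_def by (rule hdist_0_nonneg[OF x])
  define \<rho> where "\<rho> \<theta> = hdist 0 (hcircle x s \<theta>)" for \<theta>
  obtain \<omega> where w: "0 \<le> \<omega>" "\<omega> \<le> 2 * pi"
    "\<And>\<theta>. cosh (\<rho> \<theta>) = cosh r * cosh s + sinh r * sinh s * cos (\<theta> - \<omega>)"
    using cosh_hdist_hcircle[OF x s] unfolding r_def \<rho>_def by blast
  define Q where "Q = sinh r * sinh s"
  have Q: "Q \<ge> 0"
    using r s by (simp add: Q_def)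
  define M where "M n = cosh (real n) + cosh (r - s)" for n
  have M: "M n > 0" for n
    by (simp add: M_def add_pos_pos)
  have X: "cosh (real n) + cosh (\<rho> \<theta>) = M n + Q * (1 + cos (\<theta> - \<omega>))" for n \<theta>
    by (simp add: w(3) M_def Q_def cosh_diff algebra_simps)
  have rho: "0 \<le> \<rho> \<theta>" "\<rho> \<theta> \<le> r + s" for \<theta>
  proof -
    show 0: "0 \<le> \<rho> \<theta>"
      unfolding \<rho>_def by (intro hdist_0_nonneg hcircle_in_H2 x)
    have "Q * cos (\<theta> - \<omega>) \<le> Q * 1"
      using Q by (intro mult_left_mono) auto
    then have "cosh (\<rho> \<theta>) \<le> cosh (r + s)"
      by (simp add: w(3) Q_def cosh_add)
    then show "\<rho> \<theta> \<le> r + s"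
      using 0 r s by (simp add: cosh_real_nonneg_le_iff)
  qed
  define b where "b n \<theta> = 1 / ((M n + Q * (1 + cos (\<theta> - \<omega>))) * sqrt (M n + Q * (1 + cos (\<theta> - \<omega>))))" for n \<theta>
  have bpos: "M n + Q * (1 + cos v) > 0" for n v
    using M[of n] Q cos_ge_minus_one[of v] by (intro add_pos_nonneg mult_nonneg_nonneg) linarith+
  have bcont: "continuous_on A (b n)" for A n
    unfolding b_def using bpos
    by (intro continuous_intros) (auto simp: less_imp_neq[symmetric])
  have bint: "(\<lambda>\<theta>. G n * exp (real n) * b n \<theta>) integrable_on {0..2 * pi}" for n
    by (intro integrable_continuous_real continuous_intros bcont)
  have "angular_integral f x s \<le> integral {0..2 * pi} (\<lambda>\<theta>. 2 * sqrt 2 * exp 1 * (\<Sum>n<N. G n * exp (real n) * b n \<theta>))"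
    unfolding angular_integral_def
  proof (rule integral_le)
    show "(\<lambda>\<theta>. f (hcircle x s \<theta>)) integrable_on {0..2 * pi}"
      by (intro integrable_continuous_real continuous_on_compose2[OF f] continuous_intros)
        (auto simp: x hcircle_in_H2)
    show "(\<lambda>\<theta>. 2 * sqrt 2 * exp 1 * (\<Sum>n<N. G n * exp (real n) * b n \<theta>)) integrable_on {0..2 * pi}"
      by (intro integrable_continuous_real continuous_intros bcont)
    fix \<theta>
    have "f (hcircle x s \<theta>) \<le> exp (- \<rho> \<theta> / 2) * G (nat \<lfloor>\<rho> \<theta>\<rfloor>)"
      unfolding \<rho>_def by (intro fG hcircle_in_H2 x)
    also have "\<dots> \<le> 2 * sqrt 2 * exp 1 *
        (\<Sum>n<N. G n * exp (real n) * (1 / ((cosh n + cosh (\<rho> \<theta>)) * sqrt (cosh n + cosh (\<rho> \<theta>)))))"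
      using rho[of \<theta>] N by (intro exp_half_le_shell_bumps G) (auto simp: r_def)
    finally show "f (hcircle x s \<theta>) \<le> 2 * sqrt 2 * exp 1 * (\<Sum>n<N. G n * exp (real n) * b n \<theta>)"
      by (simp only: X b_def)
  qed
  also have "\<dots> = 2 * sqrt 2 * exp 1 * (\<Sum>n<N. G n * exp (real n) * integral {0..2 * pi} (b n))"
    by (simp add: integral_sum bint)
  also have "\<dots> \<le> 2 * sqrt 2 * exp 1 * (\<Sum>n<N. G n * (4 * sqrt 2 * pi *
      (exp (- (r + s) / 2) * exp (- max 0 (\<bar>r - s\<bar> - real n)))))"
  proof (intro mult_left_mono sum_mono)
    fix n
    have m1: "exp (max (real n) \<bar>r - s\<bar>) / 2 \<le> M n"
    proof -
      have "exp (max (real n) \<bar>r - s\<bar>) \<le> exp \<bar>real n\<bar> + exp \<bar>r - s\<bar>"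
        by (simp add: max_def)
      then show ?thesis
        using cosh_ge_half_exp[of "real n"] cosh_ge_half_exp[of "r - s"]
        unfolding M_def by linarith
    qed
    have m2: "exp (r + s) / 2 \<le> M n + 2 * Q"
    proof -
      have "exp (r + s) / 2 \<le> cosh (r + s)"
        using cosh_ge_half_exp[of "r + s"] r s by simp
      also have "\<dots> = cosh (r - s) + 2 * Q"
        by (simp add: Q_def cosh_add cosh_diff)
      finally show ?thesis
        using cosh_real_pos[of "real n"] unfolding M_def by linarith
    qed
    have sq: "sqrt (exp (r + s) / 2) = exp ((r + s) / 2) / sqrt 2"
    proof -
      have "sqrt (exp (r + s)) = exp ((r + s) / 2)"
        by (rule real_sqrt_unique) (auto simp: power2_eq_square exp_add[symmetric])
      then show ?thesis
        by (simp add: real_sqrt_divide)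
    qed
    have "integral {0..2 * pi} (b n) \<le> 2 * pi / (M n * sqrt (M n + 2 * Q))"
      unfolding b_def[abs_def] by (rule integral_circle_kernel_le[OF M Q w(1,2)])
    also have "\<dots> \<le> 2 * pi / ((exp (max (real n) \<bar>r - s\<bar>) / 2) * sqrt (exp (r + s) / 2))"
      using m1 m2 M[of n] Q
      by (intro divide_left_mono mult_mono real_sqrt_le_mono mult_pos_pos) auto
    also have "\<dots> = 4 * sqrt 2 * pi * (exp (- (r + s) / 2) * exp (- max (real n) \<bar>r - s\<bar>))"
    proof -
      have "exp (- (r + s) / 2) = inverse (exp ((r + s) / 2))"
        using exp_minus[of "(r + s) / 2"] by (simp only: minus_divide_left)
      then show ?thesis
        unfolding sq by (simp add: exp_minus field_simps)
    qed
    finally have "exp (real n) * integral {0..2 * pi} (b n)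
        \<le> exp (real n) * (4 * sqrt 2 * pi * (exp (- (r + s) / 2) * exp (- max (real n) \<bar>r - s\<bar>)))"
      by (intro mult_left_mono) auto
    also have "\<dots> = 4 * sqrt 2 * pi * (exp (- (r + s) / 2) * (exp (real n) * exp (- max (real n) \<bar>r - s\<bar>)))"
      by simp
    also have "exp (real n) * exp (- max (real n) \<bar>r - s\<bar>) = exp (- max 0 (\<bar>r - s\<bar> - real n))"
      by (auto simp: exp_add[symmetric] max_def)
    finally show "G n * exp (real n) * integral {0..2 * pi} (b n) \<le> G n * (4 * sqrt 2 * pi *
      (exp (- (r + s) / 2) * exp (- max 0 (\<bar>r - s\<bar> - real n))))"
      using G[of n] by (simp add: mult_left_mono mult.assoc)
  qed auto
  also have "\<dots> = 16 * pi * exp 1 * exp (- (r + s) / 2) *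
    (\<Sum>n<N. G n * exp (- max 0 (\<bar>r - s\<bar> - real n)))"
  proof -
    have "2 * c * exp 1 * (\<Sum>n<N. G n * (4 * c * pi * (E * h n)))
        = (c * c) * (8 * pi * exp 1 * E * (\<Sum>n<N. G n * h n))" for c E h
      by (simp add: sum_distrib_left mult_ac)
    from this[of "sqrt 2"] show ?thesis by simp
  qed
  finally show ?thesis
    by (simp add: r_def)
qed


text \<open>
As \<open>sinh (y + ln v) \<le> v sinh y\<close> for \<open>0 < v \<le> 1\<close>, the radius lags behind the time by at most
\<open>2 ln (1 / sin \<phi>)\<close>.  An exponential of rate \<open>1/4\<close> turns this delay into \<open>(sin \<phi>)\<^sup>-\<^sup>1\<^sup>/\<^sup>2\<close>, which is still
integrable at \<open>\<phi> = 0\<close>.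
\<close>

lemma wave_radius_bounds:
  assumes t: "t \<ge> 0" and u: "0 < \<phi>" "\<phi> \<le> pi / 2"
  shows "0 \<le> wave_radius t \<phi>" "wave_radius t \<phi> \<le> t"
    "exp ((t - wave_radius t \<phi>) / 4) \<le> sqrt (pi / 2) * \<phi> powr (- 1 / 2)"
proof -
  define s where "s = wave_radius t \<phi>"
  define v where "v = sin \<phi>"
  have v: "0 < v" "v \<le> 1" "2 * \<phi> / pi \<le> v"
    using u two_div_pi_mult_le_sin[of \<phi>] by (auto simp: v_def intro!: sin_gt_zero)
  have S: "sinh (s / 2) = sinh (t / 2) * v"
    by (simp add: s_def v_def sinh_half_wave_radius)
  have "0 \<le> sinh (s / 2)"
    using S t v by simp
  then show s0: "0 \<le> wave_radius t \<phi>"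
    by (simp add: s_def)
  have "sinh (s / 2) \<le> sinh (t / 2)"
    unfolding S using t v by (intro mult_left_le) auto
  then show "wave_radius t \<phi> \<le> t"
    by (simp add: s_def)
  have "sinh (t / 2 + ln v) \<le> sinh (s / 2)"
  proof -
    have "v \<le> inverse v"
      using v by (simp add: field_simps mult_le_one)
    then have "v * exp (- (t / 2)) \<le> inverse v * exp (- (t / 2))"
      by (intro mult_right_mono) auto
    moreover have "exp (- (t / 2 + ln v)) = inverse v * exp (- (t / 2))"
      using v by (simp only: exp_minus exp_add exp_ln inverse_mult_distrib mult.commute)
    moreover have "exp (t / 2 + ln v) = v * exp (t / 2)"
      using v by (simp add: exp_add)
    moreover have "sinh (t / 2) * v = (v * exp (t / 2) - v * exp (- (t / 2))) / 2"
      by (simp add: sinh_field_def algebra_simps)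
    ultimately show ?thesis
      unfolding S sinh_field_def[of "t / 2 + ln v"] by simp
  qed
  then have "(t - s) / 4 \<le> - (1 / 2) * ln v"
    by simp
  then have "exp ((t - s) / 4) \<le> v powr (- 1 / 2)"
    using v by (simp add: powr_def)
  also have "\<dots> \<le> (2 * \<phi> / pi) powr (- 1 / 2)"
    using v u by (intro powr_mono2') auto
  also have "\<dots> = (2 / pi) powr (- 1 / 2) * \<phi> powr (- 1 / 2)"
    using powr_mult[of "2 / pi" \<phi> "- 1 / 2"] by simp
  also have "(2 / pi) powr (- 1 / 2) = sqrt (pi / 2)"
    by (simp add: powr_minus powr_half_sqrt real_sqrt_divide)
  finally show "exp ((t - wave_radius t \<phi>) / 4) \<le> sqrt (pi / 2) * \<phi> powr (- 1 / 2)"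
    by (simp add: s_def)
qed

text \<open>
The factor \<open>cosh (t/2) sin \<phi> \<le> cosh (s/2) \<le> e\<^sup>s\<^sup>/\<^sup>2\<close> cancels the decay \<open>e\<^sup>-\<^sup>s\<^sup>/\<^sup>2\<close> of the circle mean and leaves
\<open>e\<^sup>-\<^sup>r\<^sup>/\<^sup>2\<close>.  The radius \<open>s\<close> in the remaining exponentials is replaced by \<open>t\<close> with \<open>wave_radius_bounds\<close>.
The factor in front is \<open>cosh (t/2)\<close> rather than \<open>sinh (t/2)\<close> so that the bound covers the time derivative
of \<open>I\<close> as well, which does not vanish at \<open>t = 0\<close>.
\<close>

lemma hemisphere_integral_le:
  fixes G :: "nat \<Rightarrow> real"
  assumes f: "continuous_on H2 f" and x: "x \<in> H2" and t: "t \<ge> 0"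
    and G: "\<And>n. G n \<ge> 0"
    and f0: "\<And>y. y \<in> H2 \<Longrightarrow> 0 \<le> f y"
    and fG: "\<And>y. y \<in> H2 \<Longrightarrow> f y \<le> exp (- hdist 0 y / 2) * G (nat \<lfloor>hdist 0 y\<rfloor>)"
    and N: "hdist 0 x + t < real N"
  shows "cosh (t / 2) * hemisphere_integral f t x \<le> 16 * pi\<^sup>2 * exp 1 * exp (- hdist 0 x / 2) *
    (\<Sum>n<N. G n * shell_decay n (t - hdist 0 x))"
proof -
  define r where "r = hdist 0 x"
  define K where "K = 16 * pi * exp (1::real)"
  define \<Sigma> where "\<Sigma> = (\<Sum>n<N. G n * shell_decay n (t - r))"
  have Sig: "\<Sigma> \<ge> 0"
    unfolding \<Sigma>_def by (intro sum_nonneg mult_nonneg_nonneg G) (simp add: shell_decay_def)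
  have c0: "0 \<le> angular_integral f x s" for s
    unfolding angular_integral_def
    by (rule integral_nonneg)
      (auto intro!: integrable_continuous_real continuous_on_compose2[OF f] continuous_intros f0
        simp: x hcircle_in_H2)
  have ci: "continuous_on {0..pi / 2} (\<lambda>\<phi>. cosh (t / 2) * (sin \<phi> * angular_integral f x (wave_radius t \<phi>)))"
    by (intro continuous_intros continuous_on_compose2[OF continuous_on_angular_integral[OF f x, of UNIV]]) auto
  have "cosh (t / 2) * hemisphere_integral f t x
      = integral {0..pi / 2} (\<lambda>\<phi>. cosh (t / 2) * (sin \<phi> * angular_integral f x (wave_radius t \<phi>)))"
    by (simp add: hemisphere_integral_iterated[OF f x])
  also have "\<dots> \<le> K * exp (- r / 2) * \<Sigma> * sqrt (pi / 2) * ((pi / 2) powr (- 1 / 2 + 1) / (- 1 / 2 + 1))"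
  proof (rule has_integral_le)
    show "((\<lambda>\<phi>. cosh (t / 2) * (sin \<phi> * angular_integral f x (wave_radius t \<phi>))) has_integral
      integral {0..pi / 2} (\<lambda>\<phi>. cosh (t / 2) * (sin \<phi> * angular_integral f x (wave_radius t \<phi>)))) {0..pi / 2}"
      by (intro integrable_integral integrable_continuous_real ci)
    show "((\<lambda>\<phi>. K * exp (- r / 2) * \<Sigma> * sqrt (pi / 2) * \<phi> powr (- 1 / 2)) has_integral
        K * exp (- r / 2) * \<Sigma> * sqrt (pi / 2) * ((pi / 2) powr (- 1 / 2 + 1) / (- 1 / 2 + 1))) {0..pi / 2}"
      by (intro has_integral_mult_right has_integral_powr_from_0) auto
    fix \<phi> :: real assume ph: "\<phi> \<in> {0..pi / 2}"
    show "cosh (t / 2) * (sin \<phi> * angular_integral f x (wave_radius t \<phi>))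
        \<le> K * exp (- r / 2) * \<Sigma> * sqrt (pi / 2) * \<phi> powr (- 1 / 2)"
    proof (cases "\<phi> = 0")
      case False
      with ph have ph: "0 < \<phi>" "\<phi> \<le> pi / 2" by auto
      define s where "s = wave_radius t \<phi>"
      note sb = wave_radius_bounds[OF t ph, folded s_def]
      have "cosh (t / 2) * (sin \<phi> * angular_integral f x s) = (cosh (t / 2) * sin \<phi>) * angular_integral f x s"
        by simp
      also have "\<dots> \<le> exp (s / 2) * angular_integral f x s"
      proof (rule mult_right_mono[OF _ c0])
        have "cosh (t / 2) * sin \<phi> \<le> cosh (s / 2)"
          unfolding s_def using ph by (intro cosh_mult_sin_le) auto
        then show "cosh (t / 2) * sin \<phi> \<le> exp (s / 2)"
          using cosh_le_exp[of "s / 2"] sb(1) by simp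
      qed
      also have "\<dots> \<le> exp (s / 2) * (K * exp (- (r + s) / 2) *
          (\<Sum>n<N. G n * exp (- max 0 (\<bar>r - s\<bar> - real n))))"
        unfolding K_def r_def using sb N
        by (intro mult_left_mono angular_integral_le f x G fG) auto
      also have "\<dots> = K * exp (- r / 2) * (\<Sum>n<N. G n * exp (- max 0 (\<bar>r - s\<bar> - real n)))"
      proof -
        have "s / 2 + - (r + s) / 2 = - r / 2"
          by (simp add: field_simps)
        then have "exp (s / 2) * exp (- (r + s) / 2) = exp (- r / 2)"
          by (metis exp_add)
        moreover have "exp (s / 2) * (K * exp (- (r + s) / 2) * Z) = K * (exp (s / 2) * exp (- (r + s) / 2)) * Z" for Z
          by (simp only: mult_ac)
        ultimately show ?thesis
          by simp
      qed
      also have "\<dots> \<le> K * exp (- r / 2) * (\<Sum>n<N. G n * (shell_decay n (t - r) * (sqrt (pi / 2) * \<phi> powr (- 1 / 2))))"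
      proof (intro mult_left_mono sum_mono G)
        fix n
        have "- max 0 (\<bar>r - s\<bar> - real n) \<le> - max 0 (\<bar>t - r\<bar> - real n) / 4 + (t - s) / 4"
        proof -
          have *: "max 0 (\<bar>t - r\<bar> - real n) \<le> max 0 (\<bar>r - s\<bar> - real n) + (t - s)"
            using sb(2) by (auto simp: max_def)
          have quarter: "- A \<le> - B / 4 + d / 4" if "B \<le> A + d" "0 \<le> A" for A B d :: real
            using that by simp
          show ?thesis
            by (rule quarter) (rule *, rule max.cobounded1)
        qed
        then have "exp (- max 0 (\<bar>r - s\<bar> - real n)) \<le> shell_decay n (t - r) * exp ((t - s) / 4)"
          by (simp add: shell_decay_def exp_add[symmetric])
        also have "\<dots> \<le> shell_decay n (t - r) * (sqrt (pi / 2) * \<phi> powr (- 1 / 2))"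
          by (intro mult_left_mono sb(3)) (simp add: shell_decay_def)
        finally show "exp (- max 0 (\<bar>r - s\<bar> - real n)) \<le> shell_decay n (t - r) * (sqrt (pi / 2) * \<phi> powr (- 1 / 2))" .
      qed (auto simp: K_def)
      also have "\<dots> = K * exp (- r / 2) * \<Sigma> * sqrt (pi / 2) * \<phi> powr (- 1 / 2)"
        by (simp add: \<Sigma>_def sum_distrib_left sum_distrib_right mult_ac)
      finally show ?thesis
        by (simp add: s_def)
    qed (use Sig in \<open>simp add: K_def\<close>)
  qed
  also have "\<dots> = K * exp (- r / 2) * \<Sigma> * pi"
  proof -
    have "sqrt (pi / 2) * ((pi / 2) powr (- 1 / 2 + 1) / (- 1 / 2 + 1)) = (sqrt (pi / 2) * sqrt (pi / 2)) * 2"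
      by (simp add: powr_half_sqrt del: real_sqrt_mult_self)
    also have "\<dots> = pi"
      by simp
    finally show ?thesis
      by (simp only: mult.assoc)
  qed
  also have "\<dots> = 16 * pi\<^sup>2 * exp 1 * exp (- r / 2) * \<Sigma>"
    by (simp add: K_def power2_eq_square)
  finally show ?thesis
    by (simp add: r_def \<Sigma>_def)
qed

section \<open>Regularising the kernel of the solution operator\<close>

text \<open>
Under the substitution \<open>2 cosh t - 2 cosh s = (2 sinh (t/2) cos \<phi>)\<^sup>2\<close>, and the factor \<open>cos \<phi>\<close> is cancelled by the
derivative of the radius.  The positive and the negative part of \<open>A\<close> are treated separately: for a
nonnegative integrand the substitution also yields the integrability of the singular left-hand side.
\<close>

lemma wave_kernel_substitution:
  fixes A :: "real \<Rightarrow> real"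
  assumes t: "t > 0" and A: "continuous_on UNIV A"
  defines "K \<equiv> \<lambda>s. sinh s / sqrt (2 * cosh t - 2 * cosh s)"
  shows "(LBINT s=0..t. K s * A s) =
    integral {0..pi / 2} (\<lambda>\<phi>. 2 * sinh (t / 2) * (sin \<phi> * A (wave_radius t \<phi>)))"
proof -
  define S where "S = sinh (t / 2)"
  have S: "S > 0" using t by (simp add: S_def)
  define g where "g = wave_radius t"
  define g' where "g' \<phi> = 2 * S * cos \<phi> / cosh (g \<phi> / 2)" for \<phi>
  have gd: "(g has_real_derivative g' \<phi>) (at \<phi>)" for \<phi>
    unfolding g_def g'_def S_def by (rule wave_radius_deriv_angle)
  have gc: "isCont g \<phi>" for \<phi>
    using gd by (rule DERIV_isCont)
  have den: "2 * cosh t - 2 * cosh (g \<phi>) = (2 * S * cos \<phi>)\<^sup>2" for \<phi>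
  proof -
    have "cosh t = 1 + 2 * S\<^sup>2"
      using cosh_double_cosh[of "t / 2"] by (simp add: S_def cosh_square_eq)
    moreover have "cosh (g \<phi>) = 1 + 2 * (S * sin \<phi>)\<^sup>2"
      using cosh_double_cosh[of "g \<phi> / 2"]
      by (simp add: cosh_square_eq g_def sinh_half_wave_radius S_def)
    ultimately have "2 * cosh t - 2 * cosh (g \<phi>) = 4 * S\<^sup>2 * (1 - (sin \<phi>)\<^sup>2)"
      by (simp add: power_mult_distrib algebra_simps)
    also have "\<dots> = 4 * S\<^sup>2 * (cos \<phi>)\<^sup>2"
      by (simp add: cos_squared_eq)
    finally show ?thesis
      by (simp add: power_mult_distrib)
  qed
  have Kg: "K (g \<phi>) * g' \<phi> = 2 * S * sin \<phi>" if "0 < \<phi>" "\<phi> < pi / 2" for \<phi>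
  proof -
    have c: "cos \<phi> > 0"
      using that by (intro cos_gt_zero) auto
    have "sqrt (2 * cosh t - 2 * cosh (g \<phi>)) = 2 * S * cos \<phi>"
      unfolding den using c S by simp
    moreover have "sinh (g \<phi>) = 2 * (S * sin \<phi>) * cosh (g \<phi> / 2)"
      using sinh_double[of "g \<phi> / 2"] by (simp add: g_def sinh_half_wave_radius S_def)
    ultimately show ?thesis
      using c S by (simp add: K_def g'_def field_simps)
  qed
  have main: "set_integrable lborel (einterval 0 t) (\<lambda>s. K s * B s)"
    "(LBINT s=0..t. K s * B s) = integral {0..pi / 2} (\<lambda>\<phi>. 2 * S * (sin \<phi> * B (g \<phi>)))"
    "(\<lambda>\<phi>. 2 * S * (sin \<phi> * B (g \<phi>))) integrable_on {0..pi / 2}"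
    if B: "continuous_on UNIV B" and B0: "\<And>s. B s \<ge> 0" for B :: "real \<Rightarrow> real"
  proof -
    have BC: "isCont B s" for s
      using B by (simp add: continuous_on_eq_continuous_at)
    have cont: "continuous_on {0..pi / 2} (\<lambda>\<phi>. 2 * S * (sin \<phi> * B (g \<phi>)))"
      by (intro continuous_intros continuous_on_compose2[OF B])
        (auto simp: g_def intro!: continuous_intros)
    then show "(\<lambda>\<phi>. 2 * S * (sin \<phi> * B (g \<phi>))) integrable_on {0..pi / 2}"
      by (rule integrable_continuous_real)
    have int: "set_integrable lborel {0..pi / 2} (\<lambda>\<phi>. 2 * S * (sin \<phi> * B (g \<phi>)))"
      using cont by (rule borel_integrable_atLeastAtMost')
    have eq: "K (g \<phi>) * B (g \<phi>) * g' \<phi> = 2 * S * (sin \<phi> * B (g \<phi>))" if "\<phi> \<in> {0<..<pi / 2}" for \<phi>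
      using Kg[of \<phi>] that by (simp add: mult_ac)
    have ei: "einterval 0 (ereal (pi / 2)) = {0<..<pi / 2}"
      by (auto simp: einterval_def zero_ereal_def)
    have int2: "set_integrable lborel (einterval 0 (ereal (pi / 2))) (\<lambda>\<phi>. K (g \<phi>) * B (g \<phi>) * g' \<phi>)"
      unfolding ei
      by (subst set_integrable_cong[OF refl refl eq])
        (auto intro: set_integrable_subset[OF int])
    have lim0: "((ereal \<circ> g \<circ> real_of_ereal) \<longlongrightarrow> 0) (at_right 0)"
    proof -
      have "(g \<longlongrightarrow> g 0) (at_right 0)"
        using continuous_at_imp_continuous_at_within[OF gc] by (simp add: continuous_within)
      then have "((ereal \<circ> g \<circ> real_of_ereal) \<longlongrightarrow> ereal (g 0)) (at_right (ereal 0))"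
        unfolding ereal_tendsto_simps .
      then show ?thesis
        by (simp add: zero_ereal_def g_def wave_radius_def)
    qed
    have lim1: "((ereal \<circ> g \<circ> real_of_ereal) \<longlongrightarrow> ereal t) (at_left (ereal (pi / 2)))"
    proof -
      have "(g \<longlongrightarrow> g (pi / 2)) (at_left (pi / 2))"
        using continuous_at_imp_continuous_at_within[OF gc] by (simp add: continuous_within)
      then have "((ereal \<circ> g \<circ> real_of_ereal) \<longlongrightarrow> ereal (g (pi / 2))) (at_left (ereal (pi / 2)))"
        unfolding ereal_tendsto_simps .
      then show ?thesis
        by (simp add: g_def wave_radius_def arsinh_sinh_real)
    qed
    have gpos: "g \<phi> > 0" if "0 < \<phi>" "\<phi> < pi / 2" for \<phi>
      using that t by (auto simp: g_def wave_radius_def intro!: mult_pos_pos sin_gt_zero)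
    have *: "0 < ereal (pi / 2)" by simp
    have contK: "isCont (\<lambda>s. K s * B s) (g \<phi>)" if "0 < \<phi>" "\<phi> < pi / 2" for \<phi>
    proof -
      have "2 * cosh t - 2 * cosh (g \<phi>) \<noteq> 0"
        unfolding den using S cos_gt_zero[of \<phi>] that by auto
      then show ?thesis
        unfolding K_def by (intro continuous_intros BC) auto
    qed
    have contg': "isCont g' \<phi>" for \<phi>
      unfolding g'_def by (intro continuous_intros gc) auto
    have Knn: "0 \<le> K (g \<phi>) * B (g \<phi>)" if "0 < \<phi>" "\<phi> < pi / 2" for \<phi>
      using gpos[OF that] den[of \<phi>] B0 unfolding K_def
      by (intro mult_nonneg_nonneg divide_nonneg_nonneg) auto
    have g'nn: "0 \<le> g' \<phi>" if "0 \<le> \<phi>" "\<phi> \<le> pi / 2" for \<phi>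
      unfolding g'_def using S cos_ge_zero[of \<phi>] that by auto
    note sub = interval_integral_substitution_nonneg[where f = "\<lambda>s. K s * B s" and g = g and g' = g',
        OF * gd contK contg' Knn g'nn lim0 lim1 int2]
    show "set_integrable lborel (einterval 0 t) (\<lambda>s. K s * B s)"
      by (rule sub(1)) auto
    have "(LBINT s=0..t. K s * B s) = (LBINT \<phi>=0..ereal (pi / 2). K (g \<phi>) * B (g \<phi>) * g' \<phi>)"
      by (rule sub(2)) auto
    also have "\<dots> = (LBINT \<phi>=0..ereal (pi / 2). 2 * S * (sin \<phi> * B (g \<phi>)))"
      by (rule interval_integral_cong) (auto simp: ei eq min_def max_def)
    also have "\<dots> = integral {0..pi / 2} (\<lambda>\<phi>. 2 * S * (sin \<phi> * B (g \<phi>)))"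
      using interval_integral_eq_integral[OF _ int] by (simp add: zero_ereal_def)
    finally show "(LBINT s=0..t. K s * B s) = integral {0..pi / 2} (\<lambda>\<phi>. 2 * S * (sin \<phi> * B (g \<phi>)))" .
  qed
  have P: "continuous_on UNIV (\<lambda>s. max (A s) 0)" "continuous_on UNIV (\<lambda>s. max (- A s) 0)"
    by (intro continuous_intros A)+
  have split: "A s = max (A s) 0 - max (- A s) 0" for s
    by (simp add: max_def)
  have "(LBINT s=0..t. K s * A s) = (LBINT s=0..t. K s * max (A s) 0 - K s * max (- A s) 0)"
    by (subst split) (simp add: right_diff_distrib)
  also have "\<dots> = (LBINT s=0..t. K s * max (A s) 0) - (LBINT s=0..t. K s * max (- A s) 0)"
    using main(1)[OF P(1)] main(1)[OF P(2)] t
    by (intro interval_lebesgue_integral_diff) (auto simp: interval_lebesgue_integrable_def)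
  also have "\<dots> = integral {0..pi / 2} (\<lambda>\<phi>. 2 * S * (sin \<phi> * max (A (g \<phi>)) 0) - 2 * S * (sin \<phi> * max (- A (g \<phi>)) 0))"
    using main(2,3)[OF P(1)] main(2,3)[OF P(2)]
    by (simp add: Henstock_Kurzweil_Integration.integral_diff)
  also have "\<dots> = integral {0..pi / 2} (\<lambda>\<phi>. 2 * S * (sin \<phi> * A (g \<phi>)))"
    by (rule Henstock_Kurzweil_Integration.integral_cong) (simp add: max_def algebra_simps)
  finally show ?thesis
    by (simp add: S_def g_def)
qed

lemma I_op_eq_hemisphere_integral:
  assumes f: "continuous_on H2 f" and x: "x \<in> H2"
  shows "I_op t x f = sinh (t / 2) / pi * hemisphere_integral f t x"
proof -
  have pos: "I_op t x f = sinh (t / 2) / pi * hemisphere_integral f t x" if t: "t > 0" for t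
  proof -
    have "I_op t x f = (LBINT s=0..t. sinh s / sqrt (2 * cosh t - 2 * cosh s) * (angular_integral f x s / (2 * pi)))"
      unfolding I_op_def using t
      by (auto intro!: interval_integral_cong
          simp: einterval_def zero_ereal_def circle_mean_eq[OF x] angular_integral_def)
    also have "\<dots> = integral {0..pi / 2} (\<lambda>\<phi>. 2 * sinh (t / 2) * (sin \<phi> * (angular_integral f x (wave_radius t \<phi>) / (2 * pi))))"
      using t by (rule wave_kernel_substitution) (intro continuous_intros continuous_on_angular_integral f x, simp)
    also have "\<dots> = integral {0..pi / 2} (\<lambda>\<phi>. sinh (t / 2) / pi * (sin \<phi> * angular_integral f x (wave_radius t \<phi>)))"
      by (rule Henstock_Kurzweil_Integration.integral_cong) (simp add: field_simps)
    also have "\<dots> = sinh (t / 2) / pi * hemisphere_integral f t x"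
      by (simp add: hemisphere_integral_iterated[OF f x])
    finally show ?thesis .
  qed
  consider "t > 0" | "t = 0" | "t < 0" by linarith
  then show ?thesis
  proof cases
    case 1
    then show ?thesis by (rule pos)
  next
    case 3
    have "I_op t x f = - I_op (- t) x f"
      using 3 by (simp add: I_op_def)
    also have "\<dots> = sinh (t / 2) / pi * hemisphere_integral f t x"
      using pos[of "- t"] 3 by (simp add: hemisphere_integral_minus[OF f x])
    finally show ?thesis .
  qed (simp add: I_op_def)
qed

section \<open>The time derivative of the solution operator\<close>

text \<open>
The velocity at angle \<open>\<theta>\<close> of the geodesic that leaves \<open>x\<close> with unit speed; \<open>s\<close> is the distance covered.
\<close>

definition radial_velocity :: "complex \<Rightarrow> real \<Rightarrow> real \<Rightarrow> complex" where
  "radial_velocity x s \<theta> = ((1 - (tanh (s / 2))\<^sup>2) / 2) *\<^sub>R cis \<theta> *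
     (of_real (1 - (cmod x)\<^sup>2) / (1 + cnj x * polar s \<theta>)\<^sup>2)"

lemma hcircle_has_radial_velocity:
  "x \<in> H2 \<Longrightarrow> ((\<lambda>s. hcircle x s \<theta>) has_vector_derivative radial_velocity x s \<theta>) (at s)"
  using field_vector_diff_chain_at[OF polar_deriv_r mobius_deriv[OF _ polar_in_H2]]
  by (simp add: o_def hcircle_eq radial_velocity_def)

lemma hnorm_radial_velocity:
  assumes x: "x \<in> H2"
  shows "hnorm (hcircle x s \<theta>) (radial_velocity x s \<theta>) = 1"
proof -
  have "1 - (tanh (s / 2))\<^sup>2 > 0"
    using H2_pos[OF polar_in_H2[of s \<theta>]] by (simp add: cmod_polar)
  then show ?thesis
    unfolding radial_velocity_def hcircle_eq hnorm_mobius[OF x polar_in_H2]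
    by (simp add: hnorm_eq polar_in_H2 cmod_polar)
qed

lemma continuous_on_radial_velocity [continuous_intros]:
  fixes X :: "'a::t2_space \<Rightarrow> complex"
  assumes "continuous_on A X" "continuous_on A S" "continuous_on A \<Theta>"
    and H: "\<And>p. p \<in> A \<Longrightarrow> X p \<in> H2"
  shows "continuous_on A (\<lambda>p. radial_velocity (X p) (S p) (\<Theta> p))"
proof -
  have *: "1 + cnj (X p) * (of_real (tanh (S p / 2)) * cis (\<Theta> p)) \<noteq> 0" if "p \<in> A" for p
    using mobius_denom[OF H[OF that] polar_in_H2] by (simp add: polar_def)
  have c: "continuous_on A (\<lambda>p. cis (\<Theta> p))"
    unfolding cis_conv_exp using assms by (intro continuous_intros)
  have t: "continuous_on A (\<lambda>p. tanh (S p / 2))"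
    using assms by (intro continuous_intros) auto
  show ?thesis
    unfolding radial_velocity_def polar_def
    by (intro continuous_intros c t assms) (use * in auto)
qed

lemma C1_H2_imp_continuous_on: "C1_H2 f \<Longrightarrow> continuous_on H2 f"
  unfolding C1_H2_def
  by (meson continuous_at_imp_continuous_on has_derivative_continuous)

lemma hgrad_bounds_derivative:
  assumes z: "z \<in> H2" and d: "(f has_derivative L) (at z)"
  shows "\<bar>L v\<bar> \<le> hnorm z (hgrad f z) * hnorm z v"
proof -
  have "f differentiable (at z)"
    using d by (auto simp: differentiable_def)
  then have "(f has_derivative hmetric z (hgrad f z)) (at z)"
    by (rule has_derivative_hgrad[OF z])
  then have L: "L v = hmetric z (hgrad f z) v"
    using has_derivative_unique[OF d] by blast
  have "\<bar>hgrad f z \<bullet> v\<bar> \<le> cmod (hgrad f z) * cmod v"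
    by (rule Cauchy_Schwarz_ineq2)
  then have "4 * \<bar>hgrad f z \<bullet> v\<bar> / (1 - (cmod z)\<^sup>2)\<^sup>2 \<le> 4 * (cmod (hgrad f z) * cmod v) / (1 - (cmod z)\<^sup>2)\<^sup>2"
    by (intro divide_right_mono) auto
  then show ?thesis
    unfolding L hmetric_def hnorm_eq[OF z] using H2_pos[OF z]
    by (simp add: abs_mult power2_eq_square mult_ac)
qed

lemma radial_derivative:
  assumes f: "C1_H2 f"
  obtains f' where
    "\<And>x s \<theta>. x \<in> H2 \<Longrightarrow> ((\<lambda>s. f (hcircle x s \<theta>)) has_real_derivative f' x s \<theta>) (at s)"
    "\<And>x s \<theta>. x \<in> H2 \<Longrightarrow> \<bar>f' x s \<theta>\<bar> \<le> hnorm (hcircle x s \<theta>) (hgrad f (hcircle x s \<theta>))"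
    "continuous_on (H2 \<times> UNIV) (\<lambda>(x, s, \<theta>). f' x s \<theta> :: real)"
proof -
  obtain D :: "complex \<Rightarrow> complex \<Rightarrow>\<^sub>L real" where
    D: "\<And>z. z \<in> H2 \<Longrightarrow> (f has_derivative blinfun_apply (D z)) (at z)" and cD: "continuous_on H2 D"
    using f unfolding C1_H2_def by blast
  define f' where "f' x s \<theta> = blinfun_apply (D (hcircle x s \<theta>)) (radial_velocity x s \<theta>)" for x s \<theta>
  show ?thesis
  proof
    fix x s \<theta> assume x: "x \<in> H2"
    have "((f \<circ> (\<lambda>s. hcircle x s \<theta>)) has_vector_derivative f' x s \<theta>) (at s)"
      unfolding f'_def
      by (rule vector_derivative_diff_chain_within[OF hcircle_has_radial_velocity[OF x]])
        (rule has_derivative_at_withinI, rule D, rule hcircle_in_H2, rule x)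
    then show "((\<lambda>s. f (hcircle x s \<theta>)) has_real_derivative f' x s \<theta>) (at s)"
      by (simp add: has_real_derivative_iff_has_vector_derivative o_def)
    show "\<bar>f' x s \<theta>\<bar> \<le> hnorm (hcircle x s \<theta>) (hgrad f (hcircle x s \<theta>))"
      using hgrad_bounds_derivative[OF hcircle_in_H2[OF x] D[OF hcircle_in_H2[OF x]]]
        hnorm_radial_velocity[OF x] by (metis f'_def mult.right_neutral)
  next
    show "continuous_on (H2 \<times> UNIV) (\<lambda>(x, s, \<theta>). f' x s \<theta>)"
      unfolding f'_def case_prod_unfold
      by (intro continuous_intros continuous_on_compose2[OF cD]) (auto simp: hcircle_in_H2)
  qed
qed

text \<open>
Differentiation under the integral sign.  The derivative of \<open>f\<close> along a geodesic is at most the norm of its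
gradient, and the radius moves with speed at most one, so \<open>J\<close> is bounded by the hemisphere integral of \<open>|\<nabla>f|\<close>.
The bound refers to a single continuous majorant \<open>w\<close> of \<open>|f| + |\<nabla>f|\<close>.
\<close>

lemma I_op_C1:
  assumes f: "C1_H2 f"
  obtains J where
    "\<And>t x. x \<in> H2 \<Longrightarrow> ((\<lambda>t. sinh (t / 2) / pi * hemisphere_integral f t x) has_real_derivative
        (cosh (t / 2) / 2 / pi * hemisphere_integral f t x + sinh (t / 2) / pi * J t x)) (at t)"
    "continuous_on (UNIV \<times> H2) (\<lambda>(t, x). J t x)"
    "\<And>t x w. x \<in> H2 \<Longrightarrow> continuous_on H2 w \<Longrightarrow>
        (\<And>y. y \<in> H2 \<Longrightarrow> \<bar>f y\<bar> + hnorm y (hgrad f y) \<le> w y) \<Longrightarrow>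
        cosh (t / 2) * \<bar>hemisphere_integral f t x\<bar> / 2 + \<bar>sinh (t / 2)\<bar> * \<bar>J t x\<bar> \<le> cosh (t / 2) * hemisphere_integral w t x"
proof -
  have cf: "continuous_on H2 f"
    using f by (rule C1_H2_imp_continuous_on)
  obtain f' where f': "\<And>x s \<theta>. x \<in> H2 \<Longrightarrow> ((\<lambda>s. f (hcircle x s \<theta>)) has_real_derivative f' x s \<theta>) (at s)"
    "\<And>x s \<theta>. x \<in> H2 \<Longrightarrow> \<bar>f' x s \<theta>\<bar> \<le> hnorm (hcircle x s \<theta>) (hgrad f (hcircle x s \<theta>))"
    "continuous_on (H2 \<times> UNIV) (\<lambda>(x, s, \<theta>). f' x s \<theta>)"
    using radial_derivative[OF f] by metis
  define box where "box = cbox (0, 0) (pi / 2, 2 * pi :: real)"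
  define v where "v t \<phi> = cosh (t / 2) * sin \<phi> / cosh (wave_radius t \<phi> / 2)" for t \<phi>
  define j where "j x t q = sin (fst q) * (f' x (wave_radius t (fst q)) (snd q) * v t (fst q))" for x t and q :: "real \<times> real"
  define J where "J t x = integral box (j x t)" for t x
  have v1: "0 \<le> v t \<phi>" "v t \<phi> \<le> 1" if "0 \<le> \<phi>" "\<phi> \<le> pi / 2" for t \<phi>
    using cosh_mult_sin_le[OF that, of t] that by (auto simp: v_def field_simps intro!: divide_nonneg_nonneg mult_nonneg_nonneg sin_ge_zero)
  have cv: "continuous_on A (\<lambda>p. v (T p) (\<Phi> p))" if "continuous_on A T" "continuous_on A \<Phi>"
    for A :: "'a::t2_space set" and T \<Phi>
    unfolding v_def by (intro continuous_intros that) auto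
  have cj: "continuous_on (A \<times> box) (\<lambda>z. j (X (fst z)) (T (fst z)) (snd z))"
    if "continuous_on A X" "continuous_on A T" "\<And>p. p \<in> A \<Longrightarrow> X p \<in> H2" for A :: "'b::t2_space set" and X T
  proof -
    have *: "continuous_on (A \<times> box) (\<lambda>z. (\<lambda>(x, s, \<theta>). f' x s \<theta>)
       (X (fst z), wave_radius (T (fst z)) (fst (snd z)), snd (snd z)))"
      by (intro continuous_on_compose2[OF f'(3)] continuous_intros
           continuous_on_compose2[OF that(1)] continuous_on_compose2[OF that(2)])
         (auto simp: that(3))
    show ?thesis
      unfolding j_def using *
      by (intro continuous_intros cv continuous_on_compose2[OF that(2)]) auto
  qed
  have ch: "continuous_on box (\<lambda>q. sin (fst q) * h (hcircle x (wave_radius t (fst q)) (snd q)))"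
    if "continuous_on H2 h" "x \<in> H2" for h :: "complex \<Rightarrow> real" and x t
    by (intro continuous_intros continuous_on_compose2[OF that(1)]) (auto simp: that(2) hcircle_in_H2)
  have hemisphere_integral_box: "hemisphere_integral h t x = integral box (\<lambda>q. sin (fst q) * h (hcircle x (wave_radius t (fst q)) (snd q)))" for h t x
    by (simp add: hemisphere_integral_def box_def case_prod_unfold)
  show ?thesis
  proof
    fix t x assume x: "x \<in> H2"
    have "((\<lambda>t. integral box (\<lambda>q. sin (fst q) * f (hcircle x (wave_radius t (fst q)) (snd q))))
        has_real_derivative integral box (j x t)) (at t within UNIV)"
      unfolding box_def
    proof (rule leibniz_rule_field_derivative)
      fix t and q :: "real \<times> real"
      have "((\<lambda>t. f (hcircle x (wave_radius t (fst q)) (snd q))) has_real_derivative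
          f' x (wave_radius t (fst q)) (snd q) * v t (fst q)) (at t)"
        unfolding v_def by (rule DERIV_chain2[OF f'(1)[OF x] wave_radius_deriv_time])
      then show "((\<lambda>t. sin (fst q) * f (hcircle x (wave_radius t (fst q)) (snd q))) has_real_derivative j x t q)
          (at t within UNIV)"
        unfolding j_def by (intro DERIV_cmult) simp
    next
      show "(\<lambda>q. sin (fst q) * f (hcircle x (wave_radius t (fst q)) (snd q))) integrable_on
          cbox (0, 0) (pi / 2, 2 * pi)" for t
        using ch[OF cf x] by (intro integrable_continuous) (simp add: box_def)
      show "continuous_on (UNIV \<times> cbox (0, 0) (pi / 2, 2 * pi)) (\<lambda>(t, q). j x t q)"
        using cj[of UNIV "\<lambda>_. x" "\<lambda>t. t"] x by (simp add: box_def case_prod_unfold)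
    qed auto
    then have "((\<lambda>t. hemisphere_integral f t x) has_real_derivative J t x) (at t)"
      by (simp add: hemisphere_integral_box J_def)
    then have "((\<lambda>t. sinh (t / 2) / pi * hemisphere_integral f t x) has_real_derivative
        (sinh (t / 2) / pi * J t x + cosh (t / 2) * (1 / 2) / pi * hemisphere_integral f t x)) (at t)"
      by (intro DERIV_mult') (auto intro!: derivative_eq_intros)
    then show "((\<lambda>t. sinh (t / 2) / pi * hemisphere_integral f t x) has_real_derivative
        (cosh (t / 2) / 2 / pi * hemisphere_integral f t x + sinh (t / 2) / pi * J t x)) (at t)"
      by (simp add: algebra_simps)
  next
    have "continuous_on ((UNIV \<times> H2) \<times> box) (\<lambda>(p, q). j (snd p) (fst p) q)"
      using cj[OF continuous_on_snd[OF continuous_on_id] continuous_on_fst[OF continuous_on_id],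
          of "UNIV \<times> H2"] by (auto simp: case_prod_unfold)
    then show "continuous_on (UNIV \<times> H2) (\<lambda>(t, x). J t x)"
      unfolding J_def box_def case_prod_unfold
      by (intro integral_continuous_on_param) (simp add: case_prod_unfold)
  next
    fix t x w assume x: "x \<in> H2" and w: "continuous_on H2 w"
      and le: "\<And>y. y \<in> H2 \<Longrightarrow> \<bar>f y\<bar> + hnorm y (hgrad f y) \<le> w y"
    have cjx: "continuous_on box (j x t)"
    proof -
      have "continuous_on (UNIV \<times> box) (\<lambda>z. j x (fst z) (snd z))"
        using cj[of UNIV "\<lambda>_. x" "\<lambda>t. t"] x by simp
      moreover have "continuous_on box (\<lambda>q. (t, q))"
        by (rule continuous_on_Pair[OF continuous_on_const continuous_on_id])
      ultimately have "continuous_on box (\<lambda>q. j x (fst (t, q)) (snd (t, q)))"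
        by (rule continuous_on_compose2) auto
      then show ?thesis by simp
    qed
    define a where "a q = sin (fst q) * f (hcircle x (wave_radius t (fst q)) (snd q))" for q
    have ca: "continuous_on box a"
      unfolding a_def using ch[OF cf x] .
    have i: "h integrable_on box" if "continuous_on box h" for h :: "real \<times> real \<Rightarrow> real"
      using that unfolding box_def by (rule integrable_continuous)
    have "cosh (t / 2) * \<bar>hemisphere_integral f t x\<bar> / 2 + \<bar>sinh (t / 2)\<bar> * \<bar>J t x\<bar>
        \<le> cosh (t / 2) * \<bar>hemisphere_integral f t x\<bar> + cosh (t / 2) * \<bar>J t x\<bar>"
    proof -
      have "\<bar>sinh (t / 2)\<bar> \<le> cosh (t / 2)"
        by (simp add: abs_le_iff sinh_def cosh_def)
      then show ?thesis
        by (intro add_mono mult_right_mono) auto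
    qed
    also have "\<dots> = cosh (t / 2) * (\<bar>integral box a\<bar> + \<bar>integral box (j x t)\<bar>)"
      by (simp add: hemisphere_integral_box J_def a_def[abs_def] algebra_simps)
    also have "\<dots> \<le> cosh (t / 2) * (integral box (\<lambda>q. \<bar>a q\<bar>) + integral box (\<lambda>q. \<bar>j x t q\<bar>))"
      using integral_norm_bound_integral[OF i[OF ca], of "\<lambda>q. \<bar>a q\<bar>"]
        integral_norm_bound_integral[OF i[OF cjx], of "\<lambda>q. \<bar>j x t q\<bar>"]
      by (intro mult_left_mono add_mono) (auto intro!: i continuous_intros ca cjx)
    also have "integral box (\<lambda>q. \<bar>a q\<bar>) + integral box (\<lambda>q. \<bar>j x t q\<bar>) = integral box (\<lambda>q. \<bar>a q\<bar> + \<bar>j x t q\<bar>)"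
      by (intro Henstock_Kurzweil_Integration.integral_add[symmetric] i continuous_intros ca cjx)
    also have "\<dots> \<le> hemisphere_integral w t x"
      unfolding hemisphere_integral_box
    proof (rule integral_le)
      fix q assume "q \<in> box"
      then have q: "0 \<le> fst q" "fst q \<le> pi / 2"
        by (cases q; simp add: box_def cbox_Pair_eq)+
      define y where "y = hcircle x (wave_radius t (fst q)) (snd q)"
      have y: "y \<in> H2"
        unfolding y_def by (rule hcircle_in_H2[OF x])
      have s0: "0 \<le> sin (fst q)"
        using q by (intro sin_ge_zero) auto
      have "\<bar>j x t q\<bar> = sin (fst q) * (\<bar>f' x (wave_radius t (fst q)) (snd q)\<bar> * v t (fst q))"
        using v1(1)[OF q] s0 by (simp add: j_def abs_mult)
      also have "\<dots> \<le> sin (fst q) * (hnorm y (hgrad f y) * 1)"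
        unfolding y_def using v1[OF q] s0 f'(2)[OF x]
        by (intro mult_left_mono mult_mono) (auto intro: order_trans[OF abs_ge_zero f'(2)[OF x]])
      finally have "\<bar>a q\<bar> + \<bar>j x t q\<bar> \<le> sin (fst q) * (\<bar>f y\<bar> + hnorm y (hgrad f y))"
        using s0 by (simp add: a_def y_def abs_mult distrib_left)
      also have "\<dots> \<le> sin (fst q) * w y"
        by (rule mult_left_mono[OF le[OF y] s0])
      finally show "\<bar>a q\<bar> + \<bar>j x t q\<bar> \<le> sin (fst q) * w (hcircle x (wave_radius t (fst q)) (snd q))"
        by (simp add: y_def)
    qed (intro i continuous_intros ca cjx ch w x)+
    finally show "cosh (t / 2) * \<bar>hemisphere_integral f t x\<bar> / 2 + \<bar>sinh (t / 2)\<bar> * \<bar>J t x\<bar> \<le> cosh (t / 2) * hemisphere_integral w t x"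
      by (simp add: mult_left_mono)
  qed
qed

section \<open>Decay of linear waves and of the Duhamel term\<close>

definition cone_weight :: "real \<Rightarrow> real \<Rightarrow> real \<Rightarrow> real" where
  "cone_weight a t r = exp (- r / 2) * (1 + \<bar>\<bar>t\<bar> - r\<bar>) powr (- a)"

lemma continuous_on_hdist_0: "continuous_on H2 (hdist 0)"
proof (rule continuous_on_eq)
  have "continuous_on H2 (\<lambda>x. artanh (cmod x))"
    by (rule continuous_on_compose2[OF continuous_on_artanh[of "{-1<..<1}"] continuous_on_norm[OF continuous_on_id]])
      (auto simp: H2_iff less_le_trans[OF _ norm_ge_zero])
  then show "continuous_on H2 (\<lambda>x. 2 * artanh (cmod x))"
    by (intro continuous_intros)
qed (simp add: hdist_0)

lemma one_plus_le_shell: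
  "1 + \<bar>d\<bar> \<le> (1 + real n) * (1 + max 0 (\<bar>d\<bar> - real n))"
proof -
  have "1 + \<bar>d\<bar> \<le> 1 + real n + max 0 (\<bar>d\<bar> - real n)"
    by simp
  also have "\<dots> \<le> 1 + real n + max 0 (\<bar>d\<bar> - real n) + real n * max 0 (\<bar>d\<bar> - real n)"
    by simp
  finally show ?thesis
    by (simp add: algebra_simps)
qed

lemma hemisphere_integral_abs_time: "continuous_on H2 f \<Longrightarrow> x \<in> H2 \<Longrightarrow> hemisphere_integral f \<bar>t\<bar> x = hemisphere_integral f t x"
  using hemisphere_integral_minus[of f x t] by (simp add: abs_if)

text \<open>
Here \<open>G(n)\<close> is a multiple of \<open>e\<^sup>-\<^sup>k\<^sup>n\<close>.  As \<open>1 + |d| \<le> (1 + n) (1 + max 0 (|d| - n))\<close>, one of the two exponentials absorbs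
each factor of \<open>(1 + |d|)\<^sup>a\<close>, and a geometric series remains.
\<close>

lemma linear_decay:
  fixes a k :: real
  assumes a: "a \<ge> 0" and k: "k > 0"
  defines "w \<equiv> \<lambda>y. cosh (hdist 0 y) powr (- k - 1 / 2)"
  shows "continuous_on H2 w"
    and "\<exists>K>0. \<forall>t. \<forall>x\<in>H2. cosh (t / 2) * hemisphere_integral w t x \<le> K * cone_weight a t (hdist 0 x)"
proof -
  show cw: "continuous_on H2 w"
    unfolding w_def by (intro continuous_intros continuous_on_hdist_0) auto
  obtain B1 where B1: "B1 > 0" "\<And>x. x \<ge> 0 \<Longrightarrow> (1 + x) powr a \<le> B1 * exp (1 / 4 * x)"
    using power_le_exp[of a "1 / 4"] a by auto
  obtain B2 where B2: "B2 > 0" "\<And>x. x \<ge> 0 \<Longrightarrow> (1 + x) powr a \<le> B2 * exp (k / 2 * x)"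
    using power_le_exp[of a "k / 2"] a k by auto
  define C where "C = 2 powr (k + 1 / 2)"
  have C: "C > 0" by (simp add: C_def)
  define G where "G n = C * exp (- k * real n)" for n
  define q where "q = exp (- k / 2)"
  have q: "0 < q" "q < 1" using k by (auto simp: q_def)
  have wle: "w y \<le> exp (- hdist 0 y / 2) * G (nat \<lfloor>hdist 0 y\<rfloor>)" if y: "y \<in> H2" for y
  proof -
    define \<rho> where "\<rho> = hdist 0 y"
    have rho: "\<rho> \<ge> 0" unfolding \<rho>_def by (rule hdist_0_nonneg[OF y])
    have "w y \<le> (exp \<rho> / 2) powr (- k - 1 / 2)"
      unfolding w_def \<rho>_def[symmetric] using cosh_ge_half_exp[of \<rho>] rho k
      by (intro powr_mono2') auto
    also have "\<dots> = C * exp (- k * \<rho>) * exp (- \<rho> / 2)"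
    proof -
      have "(exp \<rho> / 2) powr (- k - 1 / 2) = exp (\<rho> * (- k - 1 / 2)) * 2 powr (k + 1 / 2)"
        by (simp add: powr_def ln_div exp_add[symmetric] algebra_simps)
      also have "exp (\<rho> * (- k - 1 / 2)) = exp (- k * \<rho>) * exp (- \<rho> / 2)"
        by (simp add: exp_add[symmetric] algebra_simps)
      finally show ?thesis by (simp add: C_def)
    qed
    also have "\<dots> \<le> C * exp (- k * real (nat \<lfloor>\<rho>\<rfloor>)) * exp (- \<rho> / 2)"
    proof -
      have "real (nat \<lfloor>\<rho>\<rfloor>) \<le> \<rho>" using rho by simp
      then show ?thesis
        using k C by (intro mult_right_mono mult_left_mono) auto
    qed
    finally show ?thesis
      by (simp add: G_def \<rho>_def mult_ac)
  qed
  define K where "K = 16 * pi\<^sup>2 * exp 1 * (C * B1 * B2 * (1 / (1 - q)))"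
  have K: "K > 0"
    unfolding K_def using C B1(1) B2(1) q by simp
  show "\<exists>K>0. \<forall>t. \<forall>x\<in>H2. cosh (t / 2) * hemisphere_integral w t x \<le> K * cone_weight a t (hdist 0 x)"
  proof (intro exI[of _ K] conjI K allI ballI)
    fix t x assume x: "x \<in> H2"
    define r where "r = hdist 0 x"
    define d where "d = \<bar>t\<bar> - r"
    obtain N :: nat where N: "r + \<bar>t\<bar> < real N"
      using reals_Archimedean2 by blast
    have shell: "G n * shell_decay n d \<le> (1 + \<bar>d\<bar>) powr (- a) * (C * B1 * B2 * q ^ n)" for n
    proof -
      define y where "y = max 0 (\<bar>d\<bar> - real n)"
      have "(1 + \<bar>d\<bar>) powr a \<le> ((1 + real n) * (1 + y)) powr a"
        unfolding y_def using one_plus_le_shell[of d n] a by (intro powr_mono2) auto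
      also have "\<dots> = (1 + real n) powr a * (1 + y) powr a"
        by (rule powr_mult)
      also have "\<dots> \<le> (B2 * exp (k / 2 * real n)) * (B1 * exp (1 / 4 * y))"
        by (intro mult_mono B1 B2) (auto simp: y_def B2(1) less_imp_le)
      finally have "(1 + \<bar>d\<bar>) powr a * (G n * shell_decay n d) \<le>
          (B2 * exp (k / 2 * real n)) * (B1 * exp (1 / 4 * y)) * (G n * shell_decay n d)"
        using C by (intro mult_right_mono) (auto simp: G_def shell_decay_def)
      also have "\<dots> = C * B1 * B2 * (exp (k / 2 * real n) * exp (- k * real n)) * (exp (1 / 4 * y) * exp (- y / 4))"
        by (simp add: G_def shell_decay_def y_def mult_ac)
      also have "exp (k / 2 * real n) * exp (- k * real n) = q ^ n"
        by (simp add: q_def exp_add[symmetric] exp_of_nat_mult[symmetric] algebra_simps)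
      also have "exp (1 / 4 * y) * exp (- y / 4) = 1"
        by (simp add: exp_add[symmetric])
      finally show ?thesis
        by (simp add: powr_minus field_simps)
    qed
    have "cosh (t / 2) * hemisphere_integral w t x = cosh (\<bar>t\<bar> / 2) * hemisphere_integral w \<bar>t\<bar> x"
      using hemisphere_integral_abs_time[OF cw x] by (simp add: abs_if)
    also have "\<dots> \<le> 16 * pi\<^sup>2 * exp 1 * exp (- r / 2) * (\<Sum>n<N. G n * shell_decay n d)"
      unfolding r_def d_def using wle N C
      by (intro hemisphere_integral_le cw x) (auto simp: G_def w_def r_def)
    also have "\<dots> \<le> 16 * pi\<^sup>2 * exp 1 * exp (- r / 2) *
        (\<Sum>n<N. (1 + \<bar>d\<bar>) powr (- a) * (C * B1 * B2 * q ^ n))"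
      by (intro mult_left_mono sum_mono shell) auto
    also have "\<dots> = 16 * pi\<^sup>2 * exp 1 * exp (- r / 2) * ((1 + \<bar>d\<bar>) powr (- a) * (C * B1 * B2 * (\<Sum>n<N. q ^ n)))"
      by (simp add: sum_distrib_left)
    also have "\<dots> \<le> 16 * pi\<^sup>2 * exp 1 * exp (- r / 2) * ((1 + \<bar>d\<bar>) powr (- a) * (C * B1 * B2 * (1 / (1 - q))))"
    proof -
      have "(\<Sum>n<N. q ^ n) = (1 - q ^ N) / (1 - q)"
        using q by (simp add: sum_gp_strict)
      also have "\<dots> \<le> 1 / (1 - q)"
        using q by (intro divide_right_mono) auto
      finally show ?thesis
        using C B1(1) B2(1) by (intro mult_left_mono) auto
    qed
    also have "\<dots> = K * cone_weight a t (hdist 0 x)"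
      by (simp add: K_def cone_weight_def r_def d_def mult_ac)
    finally show "cosh (t / 2) * hemisphere_integral w t x \<le> K * cone_weight a t (hdist 0 x)" .
  qed
qed

definition duhamel :: "(real \<Rightarrow> complex \<Rightarrow> real) \<Rightarrow> real \<Rightarrow> complex \<Rightarrow> real" where
  "duhamel h t x = (LBINT \<tau>=0..t. I_op (t - \<tau>) x (h \<tau>))"

lemma continuous_on_slice:
  assumes "continuous_on (UNIV \<times> H2) (\<lambda>(\<tau>, y). h \<tau> y)"
  shows "continuous_on H2 (h \<tau>)"
proof -
  have "continuous_on H2 (\<lambda>y. (\<lambda>(\<tau>, y). h \<tau> y) (\<tau>, y))"
    by (rule continuous_on_compose2[OF assms]) (auto intro!: continuous_on_Pair continuous_on_const continuous_on_id)
  then show ?thesis by simp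
qed

lemma continuous_on_I_op:
  fixes T S :: "'a::t2_space \<Rightarrow> real"
  assumes h: "continuous_on (UNIV \<times> H2) (\<lambda>(\<tau>, y). h \<tau> y)"
    and T: "continuous_on P T" and S: "continuous_on P S" and X: "continuous_on P X"
    and XH: "\<And>p. p \<in> P \<Longrightarrow> X p \<in> H2"
  shows "continuous_on P (\<lambda>p. I_op (T p) (X p) (h (S p)))"
proof -
  have "continuous_on (P \<times> H2) (\<lambda>z. (\<lambda>(\<tau>, y). h \<tau> y) (S (fst z), snd z))"
    by (rule continuous_on_compose2[OF h])
      (auto intro!: continuous_on_Pair continuous_on_compose2[OF S] continuous_on_fst continuous_on_snd continuous_on_id)
  then have "continuous_on P (\<lambda>p. sinh (T p / 2) / pi * hemisphere_integral (h (S p)) (T p) (X p))"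
    by (intro continuous_intros continuous_on_hemisphere_integral T X XH) (auto simp: case_prod_unfold)
  then show ?thesis
    by (rule continuous_on_eq) (simp add: I_op_eq_hemisphere_integral[OF continuous_on_slice[OF h] XH])
qed

text \<open>
The fixed domain of integration gives continuity in \<open>(t, x)\<close> and treats both signs of \<open>t\<close> at once.
\<close>

lemma duhamel_eq_unit_integral:
  assumes h: "continuous_on (UNIV \<times> H2) (\<lambda>(\<tau>, y). h \<tau> y)" and x: "x \<in> H2"
  shows "duhamel h t x = t * integral {0..1} (\<lambda>\<sigma>. I_op (t - t * \<sigma>) x (h (t * \<sigma>)))"
proof -
  have c: "continuous_on A (\<lambda>\<tau>. I_op (t - \<tau>) x (h \<tau>))" for A
    by (rule continuous_on_I_op[OF h]) (auto intro!: continuous_intros simp: x)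
  have c': "continuous_on A (\<lambda>\<sigma>. I_op (t - t * \<sigma>) x (h (t * \<sigma>)))" for A
    by (rule continuous_on_I_op[OF h]) (auto intro!: continuous_intros simp: x)
  have "(LBINT \<sigma>=ereal 0..ereal 1. t *\<^sub>R (\<lambda>\<tau>. I_op (t - \<tau>) x (h \<tau>)) (t * \<sigma>))
      = (LBINT \<tau>=ereal (t * 0)..ereal (t * 1). I_op (t - \<tau>) x (h \<tau>))"
    by (rule interval_integral_substitution_finite[where g = "\<lambda>\<sigma>. t * \<sigma>" and g' = "\<lambda>_. t"])
      (auto intro!: derivative_eq_intros c)
  then have "duhamel h t x = (LBINT \<sigma>=ereal 0..ereal 1. t * I_op (t - t * \<sigma>) x (h (t * \<sigma>)))"
    by (simp add: duhamel_def zero_ereal_def)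
  also have "\<dots> = integral {0..1} (\<lambda>\<sigma>. t * I_op (t - t * \<sigma>) x (h (t * \<sigma>)))"
    by (rule interval_integral_eq_integral) (auto intro!: borel_integrable_atLeastAtMost' continuous_intros c')
  finally show ?thesis by simp
qed

lemma continuous_on_duhamel:
  assumes h: "continuous_on (UNIV \<times> H2) (\<lambda>(\<tau>, y). h \<tau> y)"
  shows "continuous_on (UNIV \<times> H2) (\<lambda>(t, x). duhamel h t x)"
proof -
  have "continuous_on ((UNIV \<times> H2) \<times> cbox 0 1) (\<lambda>z. I_op (fst (fst z) - fst (fst z) * snd z) (snd (fst z)) (h (fst (fst z) * snd z)))"
    by (rule continuous_on_I_op[OF h]) (auto intro!: continuous_intros)
  then have "continuous_on (UNIV \<times> H2) (\<lambda>p. integral (cbox 0 1) (\<lambda>\<sigma>. I_op (fst p - fst p * \<sigma>) (snd p) (h (fst p * \<sigma>))))"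
    by (intro integral_continuous_on_param) (simp add: case_prod_unfold)
  then have "continuous_on (UNIV \<times> H2) (\<lambda>p. fst p * integral {0..1} (\<lambda>\<sigma>. I_op (fst p - fst p * \<sigma>) (snd p) (h (fst p * \<sigma>))))"
    by (intro continuous_intros) simp
  then show ?thesis
    by (rule continuous_on_eq) (auto simp: duhamel_eq_unit_integral[OF h])
qed

lemma duhamel_reflect:
  assumes h: "continuous_on (UNIV \<times> H2) (\<lambda>(\<tau>, y). h \<tau> y)" and x: "x \<in> H2"
  shows "duhamel h (- t) x = duhamel (\<lambda>\<tau>. h (- \<tau>)) t x"
proof -
  have h': "continuous_on (UNIV \<times> H2) (\<lambda>(\<tau>, y). h (- \<tau>) y)"
  proof -
    have "continuous_on (UNIV \<times> H2) (\<lambda>z. (\<lambda>(\<tau>, y). h \<tau> y) (- fst z, snd z))"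
      by (rule continuous_on_compose2[OF h]) (auto intro!: continuous_intros)
    then show ?thesis by (simp add: case_prod_unfold)
  qed
  have "I_op (- s) x (h \<tau>) = - I_op s x (h \<tau>)" for s \<tau>
    by (simp add: I_op_eq_hemisphere_integral[OF continuous_on_slice[OF h] x] hemisphere_integral_minus[OF continuous_on_slice[OF h] x])
  then have "I_op (- t - - t * \<sigma>) x (h (- t * \<sigma>)) = - I_op (t - t * \<sigma>) x (h (- (t * \<sigma>)))" for \<sigma>
    by (metis minus_diff_eq minus_diff_minus minus_mult_left)
  then show ?thesis
    by (simp add: duhamel_eq_unit_integral[OF h x] duhamel_eq_unit_integral[OF h' x])
qed

lemma duhamel_diff:
  assumes h: "continuous_on (UNIV \<times> H2) (\<lambda>(\<tau>, y). h \<tau> y)" "continuous_on (UNIV \<times> H2) (\<lambda>(\<tau>, y). g \<tau> y)"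
    and x: "x \<in> H2"
  shows "duhamel h t x - duhamel g t x = duhamel (\<lambda>\<tau> y. h \<tau> y - g \<tau> y) t x"
proof -
  have hg: "continuous_on (UNIV \<times> H2) (\<lambda>(\<tau>, y). h \<tau> y - g \<tau> y)"
    using h by (auto simp: case_prod_unfold intro!: continuous_intros)
  have hemisphere_integral_diff: "hemisphere_integral (\<lambda>y. f y - f' y) s x = hemisphere_integral f s x - hemisphere_integral f' s x"
    if "continuous_on H2 f" "continuous_on H2 f'" for f f' s
  proof -
    have "angular_integral (\<lambda>y. f y - f' y) x s = angular_integral f x s - angular_integral f' x s" for s
      unfolding angular_integral_def
      by (intro Henstock_Kurzweil_Integration.integral_diff integrable_continuous_real)
        (auto intro!: continuous_intros continuous_on_compose2[OF that(1)] continuous_on_compose2[OF that(2)]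
          simp: x hcircle_in_H2)
    moreover have "(\<lambda>\<phi>. sin \<phi> * angular_integral u x (wave_radius s \<phi>)) integrable_on {0..pi / 2}"
      if "continuous_on H2 u" for u
      by (intro integrable_continuous_real continuous_intros
          continuous_on_compose2[OF continuous_on_angular_integral[OF that x, of UNIV]]) auto
    ultimately show ?thesis
      using that
      by (simp add: hemisphere_integral_iterated x continuous_on_diff right_diff_distrib
          Henstock_Kurzweil_Integration.integral_diff)
  qed
  have i: "(\<lambda>\<sigma>. I_op (t - t * \<sigma>) x (u (t * \<sigma>))) integrable_on {0..1}"
    if "continuous_on (UNIV \<times> H2) (\<lambda>(\<tau>, y). u \<tau> y)" for u
    by (intro integrable_continuous_real continuous_on_I_op[OF that]) (auto intro!: continuous_intros simp: x)
  have "I_op s x (\<lambda>y. h \<tau> y - g \<tau> y) = I_op s x (h \<tau>) - I_op s x (g \<tau>)" for s \<tau>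
    using continuous_on_slice[OF h(1)] continuous_on_slice[OF h(2)]
    by (simp add: I_op_eq_hemisphere_integral x continuous_on_diff hemisphere_integral_diff right_diff_distrib)
  then show ?thesis
    by (simp add: duhamel_eq_unit_integral[OF _ x] h hg i Henstock_Kurzweil_Integration.integral_diff
        right_diff_distrib[symmetric])
qed

text \<open>
For \<open>0 \<le> \<tau> \<le> t\<close> the estimate of hemisphere integrals applies to \<open>h(\<tau>)\<close> with
\<open>G(n) = A 2\<^sup>a (1+n)\<^sup>-\<^sup>b (1+|\<tau>-n|)\<^sup>-\<^sup>a\<close>, where \<open>2\<^sup>a\<close> accounts for the replacement of \<open>|y|\<close> by its integer part.
With \<open>d = t - r\<close> the argument \<open>(t - \<tau>) - r\<close> is \<open>d - \<tau>\<close>, so \<open>shell_weight_pointwise\<close> extracts the factor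
\<open>(1 + |d|)\<^sup>-\<^sup>a\<close>; what is left is integrated over \<open>\<tau>\<close> uniformly in \<open>n\<close> and summed over \<open>n\<close>.
Negative times follow by reflection.
\<close>

lemma duhamel_decay:
  fixes a b :: real
  assumes a: "a > 1" and ab: "b - a > 1"
  shows "\<exists>K>0. \<forall>h A t. \<forall>x\<in>H2. continuous_on (UNIV \<times> H2) (\<lambda>(\<tau>, y). h \<tau> y) \<longrightarrow> A \<ge> 0 \<longrightarrow>
    (\<forall>\<tau>. \<forall>y\<in>H2. \<bar>h \<tau> y\<bar> \<le> A * (1 + hdist 0 y) powr (- b) * cone_weight a \<tau> (hdist 0 y)) \<longrightarrow>
    \<bar>duhamel h t x\<bar> \<le> K * A * cone_weight a t (hdist 0 x)"
proof -
  obtain B where B: "B > 0" "\<And>d \<tau> n. (1 + \<bar>d\<bar>) powr a *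
      ((1 + \<bar>\<tau> - real n\<bar>) powr (- a) * (1 + real n) powr (- b) * shell_decay n (\<tau> - d))
    \<le> B * (1 + real n) powr (a - b) * ((1 + \<bar>\<tau> - real n\<bar>) powr (- a) + (1 + \<bar>\<tau> - d\<bar>) powr (- a))"
    using shell_weight_pointwise[of a b] a by (auto simp only: less_imp_le)
  have sm: "summable (\<lambda>n. (1 + real n) powr (a - b))"
  proof -
    have "summable (\<lambda>n. real (Suc n) powr (a - b))"
      using ab by (subst summable_Suc_iff) (simp add: summable_real_powr_iff)
    then show ?thesis by (simp add: add.commute)
  qed
  define Z where "Z = (\<Sum>n. (1 + real n) powr (a - b))"
  have Zpos: "Z > 0"
    unfolding Z_def by (rule suminf_pos[OF sm]) (auto intro: powr_gt_zero[THEN iffD2])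
  define K where "K = 16 * pi * exp 1 * 2 powr a * B * (Z * (4 / (a - 1)))"
  have K: "K > 0"
    unfolding K_def using B Zpos a by simp
  have main: "\<bar>duhamel h t x\<bar> \<le> K * A * cone_weight a t (hdist 0 x)"
    if h: "continuous_on (UNIV \<times> H2) (\<lambda>(\<tau>, y). h \<tau> y)" and A: "A \<ge> 0"
      and hb: "\<And>\<tau> y. y \<in> H2 \<Longrightarrow> \<bar>h \<tau> y\<bar> \<le> A * (1 + hdist 0 y) powr (- b) * cone_weight a \<tau> (hdist 0 y)"
      and x: "x \<in> H2" and t: "t \<ge> 0" for h A t x
  proof -
    define r where "r = hdist 0 x"
    define d where "d = t - r"
    obtain N :: nat where N: "r + t < real N"
      using reals_Archimedean2 by blast
    define C where "C = 16 * pi * exp 1 * exp (- r / 2) * ((1 + \<bar>d\<bar>) powr (- a) * (A * 2 powr a * B))"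
    have C: "C \<ge> 0"
      unfolding C_def using A B by simp
    define R where "R \<tau> = (\<Sum>n<N. (1 + real n) powr (a - b) *
        ((1 + \<bar>\<tau> - real n\<bar>) powr (- a) + (1 + \<bar>\<tau> - d\<bar>) powr (- a)))" for \<tau>
    have pw: "\<bar>I_op (t - \<tau>) x (h \<tau>)\<bar> \<le> C * R \<tau>" if tau: "\<tau> \<in> {0..t}" for \<tau>
    proof -
      define G where "G n = A * 2 powr a * ((1 + \<bar>\<tau> - real n\<bar>) powr (- a) * (1 + real n) powr (- b))" for n :: nat
      have c: "continuous_on H2 (h \<tau>)" by (rule continuous_on_slice[OF h])
      have c': "continuous_on H2 (\<lambda>y. \<bar>h \<tau> y\<bar>)" by (intro continuous_intros c)
      have hG: "\<bar>h \<tau> y\<bar> \<le> exp (- hdist 0 y / 2) * G (nat \<lfloor>hdist 0 y\<rfloor>)" if y: "y \<in> H2" for y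
      proof -
        define \<rho> where "\<rho> = hdist 0 y"
        define n where "n = nat \<lfloor>\<rho>\<rfloor>"
        have rho: "\<rho> \<ge> 0" unfolding \<rho>_def by (rule hdist_0_nonneg[OF y])
        then have n: "real n \<le> \<rho>" "\<rho> \<le> real n + 1"
          unfolding n_def by linarith+
        have "(1 + \<rho>) powr (- b) \<le> (1 + real n) powr (- b)"
          using n a ab by (intro powr_mono2') auto
        moreover have "(1 + \<bar>\<tau> - \<rho>\<bar>) powr (- a) \<le> 2 powr a * (1 + \<bar>\<tau> - real n\<bar>) powr (- a)"
        proof -
          have "(1 + \<bar>\<tau> - \<rho>\<bar>) powr (- a) \<le> ((1 + \<bar>\<tau> - real n\<bar>) / 2) powr (- a)"
          proof (rule powr_mono2')
            have near: "\<bar>\<tau> - real n\<bar> \<le> \<bar>\<tau> - \<rho>\<bar> + 1"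
              using n by linarith
            have half: "(1 + u) / 2 \<le> 1 + e" if "u \<le> e + 1" "0 \<le> e" for u e :: real
              using that by simp
            show "(1 + \<bar>\<tau> - real n\<bar>) / 2 \<le> 1 + \<bar>\<tau> - \<rho>\<bar>"
              by (rule half[OF near abs_ge_zero])
          qed (use a in auto)
          also have "\<dots> = 2 powr a * (1 + \<bar>\<tau> - real n\<bar>) powr (- a)"
            by (simp add: powr_divide powr_minus field_simps)
          finally show ?thesis .
        qed
        ultimately have "(1 + \<rho>) powr (- b) * (1 + \<bar>\<tau> - \<rho>\<bar>) powr (- a)
            \<le> (1 + real n) powr (- b) * (2 powr a * (1 + \<bar>\<tau> - real n\<bar>) powr (- a))"
          by (intro mult_mono) auto
        then have "exp (- \<rho> / 2) * A * ((1 + \<rho>) powr (- b) * (1 + \<bar>\<tau> - \<rho>\<bar>) powr (- a))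
            \<le> exp (- \<rho> / 2) * A * ((1 + real n) powr (- b) * (2 powr a * (1 + \<bar>\<tau> - real n\<bar>) powr (- a)))"
          using A by (intro mult_left_mono) auto
        then show ?thesis
          using hb[OF y, of \<tau>] tau
          by (simp add: cone_weight_def \<rho>_def[symmetric] G_def n_def[symmetric] mult_ac)
      qed
      have "\<bar>I_op (t - \<tau>) x (h \<tau>)\<bar> = sinh ((t - \<tau>) / 2) / pi * \<bar>hemisphere_integral (h \<tau>) (t - \<tau>) x\<bar>"
        using tau by (simp add: I_op_eq_hemisphere_integral[OF c x] abs_mult)
      also have "\<dots> \<le> cosh ((t - \<tau>) / 2) / pi * hemisphere_integral (\<lambda>y. \<bar>h \<tau> y\<bar>) (t - \<tau>) x"
      proof (intro mult_mono divide_right_mono)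
        show "sinh ((t - \<tau>) / 2) \<le> cosh ((t - \<tau>) / 2)"
          by (simp add: sinh_le_cosh_real)
        show "\<bar>hemisphere_integral (h \<tau>) (t - \<tau>) x\<bar> \<le> hemisphere_integral (\<lambda>y. \<bar>h \<tau> y\<bar>) (t - \<tau>) x"
          by (rule abs_hemisphere_integral_le[OF c c' x]) simp
      qed auto
      also have "\<dots> = (cosh ((t - \<tau>) / 2) * hemisphere_integral (\<lambda>y. \<bar>h \<tau> y\<bar>) (t - \<tau>) x) / pi"
        by simp
      also have "\<dots> \<le> (16 * pi\<^sup>2 * exp 1 * exp (- hdist 0 x / 2) *
          (\<Sum>n<N. G n * shell_decay n ((t - \<tau>) - hdist 0 x))) / pi"
        using tau N A hG
        by (intro divide_right_mono hemisphere_integral_le c' x) (auto simp: G_def r_def)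
      also have "\<dots> = 16 * pi * exp 1 * exp (- r / 2) * (\<Sum>n<N. G n * shell_decay n (\<tau> - d))"
      proof -
        have "shell_decay n ((t - \<tau>) - r) = shell_decay n (\<tau> - d)" for n
        proof -
          have "\<bar>(t - \<tau>) - r\<bar> = \<bar>\<tau> - d\<bar>"
            unfolding d_def by linarith
          then show ?thesis by (simp only: shell_decay_def)
        qed
        then show ?thesis
          by (simp add: r_def power2_eq_square)
      qed
      also have "\<dots> \<le> 16 * pi * exp 1 * exp (- r / 2) * (\<Sum>n<N. (1 + \<bar>d\<bar>) powr (- a) * (A * 2 powr a * B) *
          ((1 + real n) powr (a - b) * ((1 + \<bar>\<tau> - real n\<bar>) powr (- a) + (1 + \<bar>\<tau> - d\<bar>) powr (- a))))"
      proof (intro mult_left_mono sum_mono)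
        fix n
        define M where "M = (1 + \<bar>\<tau> - real n\<bar>) powr (- a) * (1 + real n) powr (- b) * shell_decay n (\<tau> - d)"
        define L where "L = (1 + real n) powr (a - b) * ((1 + \<bar>\<tau> - real n\<bar>) powr (- a) + (1 + \<bar>\<tau> - d\<bar>) powr (- a))"
        have "(1 + \<bar>d\<bar>) powr a * M \<le> B * L"
          using B(2)[of d \<tau> n] by (simp add: M_def L_def mult.assoc)
        then have "M \<le> (1 + \<bar>d\<bar>) powr (- a) * (B * L)"
          by (simp add: powr_minus field_simps)
        then have "A * 2 powr a * M \<le> A * 2 powr a * ((1 + \<bar>d\<bar>) powr (- a) * (B * L))"
          using A by (intro mult_left_mono) auto
        then show "G n * shell_decay n (\<tau> - d) \<le> (1 + \<bar>d\<bar>) powr (- a) * (A * 2 powr a * B) *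
          ((1 + real n) powr (a - b) * ((1 + \<bar>\<tau> - real n\<bar>) powr (- a) + (1 + \<bar>\<tau> - d\<bar>) powr (- a)))"
          by (simp add: G_def M_def L_def mult_ac)
      qed auto
      also have "\<dots> = C * R \<tau>"
        by (simp add: C_def R_def sum_distrib_left mult_ac)
      finally show ?thesis .
    qed
    have cI: "continuous_on {0..t} (\<lambda>\<tau>. I_op (t - \<tau>) x (h \<tau>))"
      by (rule continuous_on_I_op[OF h]) (auto intro!: continuous_intros simp: x)
    have cp: "continuous_on {0..t} (\<lambda>\<tau>. (1 + \<bar>\<tau> - c\<bar>) powr (- a))" for c
      by (intro continuous_intros) (auto simp: add_pos_nonneg less_imp_neq[symmetric])
    have iR: "(\<lambda>\<tau>. C * R \<tau>) integrable_on {0..t}"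
      unfolding R_def by (intro integrable_continuous_real continuous_intros cp)
    have "duhamel h t x = integral {0..t} (\<lambda>\<tau>. I_op (t - \<tau>) x (h \<tau>))"
      unfolding duhamel_def zero_ereal_def
      by (rule interval_integral_eq_integral[OF t]) (rule borel_integrable_atLeastAtMost'[OF cI])
    then have "\<bar>duhamel h t x\<bar> \<le> integral {0..t} (\<lambda>\<tau>. C * R \<tau>)"
      using integral_norm_bound_integral[OF integrable_continuous_real[OF cI] iR] pw by simp
    also have "\<dots> = C * (\<Sum>n<N. (1 + real n) powr (a - b) *
        (integral {0..t} (\<lambda>\<tau>. (1 + \<bar>\<tau> - real n\<bar>) powr (- a)) + integral {0..t} (\<lambda>\<tau>. (1 + \<bar>\<tau> - d\<bar>) powr (- a))))"
    proof -
      have "integral {0..t} (\<lambda>\<tau>. (1 + \<bar>\<tau> - real n\<bar>) powr (- a) + (1 + \<bar>\<tau> - d\<bar>) powr (- a)) =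
          integral {0..t} (\<lambda>\<tau>. (1 + \<bar>\<tau> - real n\<bar>) powr (- a)) + integral {0..t} (\<lambda>\<tau>. (1 + \<bar>\<tau> - d\<bar>) powr (- a))" for n :: nat
        by (intro Henstock_Kurzweil_Integration.integral_add integrable_continuous_real cp)
      moreover have "(\<lambda>\<tau>. (1 + real n) powr (a - b) * ((1 + \<bar>\<tau> - real n\<bar>) powr (- a) + (1 + \<bar>\<tau> - d\<bar>) powr (- a)))
          integrable_on {0..t}" for n :: nat
        by (intro integrable_continuous_real continuous_intros cp)
      ultimately show ?thesis
        unfolding R_def by (simp add: integral_sum)
    qed
    also have "\<dots> \<le> C * (\<Sum>n<N. (1 + real n) powr (a - b) * (2 / (a - 1) + 2 / (a - 1)))"
      by (intro mult_left_mono sum_mono add_mono integral_power_decay_le a t C) auto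
    also have "\<dots> = C * ((\<Sum>n<N. (1 + real n) powr (a - b)) * (4 / (a - 1)))"
      by (simp add: sum_distrib_right sum_divide_distrib)
    also have "\<dots> \<le> C * (Z * (4 / (a - 1)))"
      unfolding Z_def using a C by (intro mult_left_mono mult_right_mono sum_le_suminf sm) auto
    also have "\<dots> = K * A * cone_weight a t (hdist 0 x)"
      using t by (simp add: C_def K_def cone_weight_def r_def d_def mult_ac)
    finally show ?thesis .
  qed
  show ?thesis
  proof (intro exI[of _ K] conjI K allI ballI impI)
    fix h A t x
    assume x: "x \<in> H2" and h: "continuous_on (UNIV \<times> H2) (\<lambda>(\<tau>, y). h \<tau> y)" and A: "(A::real) \<ge> 0"
      and hb: "\<forall>\<tau>. \<forall>y\<in>H2. \<bar>h \<tau> y\<bar> \<le> A * (1 + hdist 0 y) powr (- b) * cone_weight a \<tau> (hdist 0 y)"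
    show "\<bar>duhamel h t x\<bar> \<le> K * A * cone_weight a t (hdist 0 x)"
    proof (cases "t \<ge> 0")
      case True
      then show ?thesis using hb by (intro main h A x) auto
    next
      case False
      have "continuous_on (UNIV \<times> H2) (\<lambda>z. (\<lambda>(\<tau>, y). h \<tau> y) (- fst z, snd z))"
        by (rule continuous_on_compose2[OF h]) (auto intro!: continuous_intros)
      then have h': "continuous_on (UNIV \<times> H2) (\<lambda>(\<tau>, y). h (- \<tau>) y)"
        by (simp add: case_prod_unfold)
      have "\<bar>h (- \<tau>) y\<bar> \<le> A * (1 + hdist 0 y) powr (- b) * cone_weight a \<tau> (hdist 0 y)" if "y \<in> H2" for \<tau> y
        using hb that by (metis cone_weight_def abs_minus_cancel)
      then have "\<bar>duhamel (\<lambda>\<tau>. h (- \<tau>)) (- t) x\<bar> \<le> K * A * cone_weight a (- t) (hdist 0 x)"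
        using False by (intro main h' A x) auto
      then show ?thesis
        using duhamel_reflect[OF h x, of "- t"] by (simp add: cone_weight_def)
    qed
  qed
qed

section \<open>Contraction and the existence theorem\<close>

text \<open>
Banach's fixed point theorem for the norm \<open>sup |u| / W\<close> on functions that are continuous on \<open>D\<close>.  The weight may
vanish, so the iteration is carried out with pointwise inequalities; as \<open>W \<le> 1\<close> the convergence is uniform
and the limit continuous.
\<close>

lemma weighted_contraction_fixpoint:
  fixes \<Phi> :: "('a::topological_space \<Rightarrow> real) \<Rightarrow> 'a \<Rightarrow> real" and W :: "'a \<Rightarrow> real"
    and D :: "'a set" and \<kappa> :: real
  defines "good u \<equiv> continuous_on D u \<and> (\<forall>z\<in>D. \<bar>u z\<bar> \<le> \<kappa> * W z)"
  assumes W: "\<And>z. z \<in> D \<Longrightarrow> 0 \<le> W z" "\<And>z. z \<in> D \<Longrightarrow> W z \<le> 1" and \<kappa>: "\<kappa> \<ge> 0"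
    and self: "\<And>u. good u \<Longrightarrow> good (\<Phi> u)"
    and contr: "\<And>u v c z. good u \<Longrightarrow> good v \<Longrightarrow> c \<ge> 0 \<Longrightarrow> (\<And>z. z \<in> D \<Longrightarrow> \<bar>u z - v z\<bar> \<le> c * W z) \<Longrightarrow>
      z \<in> D \<Longrightarrow> \<bar>\<Phi> u z - \<Phi> v z\<bar> \<le> c / 2 * W z"
  shows "\<exists>u. good u \<and> (\<forall>z\<in>D. \<Phi> u z = u z)"
proof -
  define U where "U n = (\<Phi> ^^ n) (\<lambda>_. 0)" for n
  have U0: "U 0 = (\<lambda>_. 0)" and USuc: "U (Suc n) = \<Phi> (U n)" for n
    by (simp_all add: U_def)
  have good: "good (U n)" for n
  proof (induction n)
    case 0
    show ?case using W \<kappa> by (auto simp: U0 good_def)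
  next
    case (Suc n)
    then show ?case unfolding USuc by (rule self)
  qed
  have step: "\<bar>U (Suc n) z - U n z\<bar> \<le> \<kappa> * (1 / 2) ^ n * W z" if "z \<in> D" for n z
    using that
  proof (induction n arbitrary: z)
    case 0
    then show ?case
      using good[of "Suc 0"] by (simp add: U0 good_def)
  next
    case (Suc n)
    have "\<bar>\<Phi> (U (Suc n)) z - \<Phi> (U n) z\<bar> \<le> \<kappa> * (1 / 2) ^ n / 2 * W z"
      using \<kappa> by (intro contr good Suc) auto
    then show ?case by (simp add: USuc)
  qed
  have far: "\<bar>U (n + j) z - U n z\<bar> \<le> 2 * \<kappa> * (1 / 2) ^ n * (1 - (1 / 2) ^ j) * W z" if z: "z \<in> D" for n j z
  proof (induction j)
    case (Suc j)
    have "\<bar>U (n + Suc j) z - U n z\<bar> \<le> \<bar>U (Suc (n + j)) z - U (n + j) z\<bar> + \<bar>U (n + j) z - U n z\<bar>"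
      by simp
    also have "\<dots> \<le> \<kappa> * (1 / 2) ^ (n + j) * W z + 2 * \<kappa> * (1 / 2) ^ n * (1 - (1 / 2) ^ j) * W z"
      by (intro add_mono step Suc z)
    also have "\<dots> = 2 * \<kappa> * (1 / 2) ^ n * (1 - (1 / 2) ^ Suc j) * W z"
      by (simp add: power_add algebra_simps)
    finally show ?case .
  qed simp
  define u where "u z = (\<Sum>k. U (Suc k) z - U k z)" for z
  have lim: "uniform_limit D U u sequentially"
  proof -
    have "uniform_limit D (\<lambda>n z. \<Sum>k<n. U (Suc k) z - U k z) u sequentially"
      unfolding u_def
    proof (rule Weierstrass_m_test)
      show "norm (U (Suc n) z - U n z) \<le> \<kappa> * (1 / 2) ^ n" if "z \<in> D" for n z
      proof -
        have "\<kappa> * (1 / 2) ^ n * W z \<le> \<kappa> * (1 / 2) ^ n"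
          using W[OF that] \<kappa> by (intro mult_left_le) auto
        then show ?thesis
          using step[OF that, of n] by simp
      qed
      show "summable (\<lambda>n. \<kappa> * (1 / 2 :: real) ^ n)"
        by (intro summable_mult summable_geometric) simp
    qed
    moreover have "(\<Sum>k<n. U (Suc k) z - U k z) = U n z" for n z
      using sum_lessThan_telescope[of "\<lambda>k. U k z" n] by (simp add: U0)
    ultimately show ?thesis
      by simp
  qed
  have pt: "(\<lambda>n. U n z) \<longlonglongrightarrow> u z" if "z \<in> D" for z
    using lim that by (rule tendsto_uniform_limitI)
  have gu: "good u"
    unfolding good_def
  proof (intro conjI ballI)
    show "continuous_on D u"
      using good by (intro uniform_limit_theorem[OF _ lim]) (auto simp: good_def)
    show "\<bar>u z\<bar> \<le> \<kappa> * W z" if z: "z \<in> D" for z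
      by (rule LIMSEQ_le_const2[OF tendsto_rabs[OF pt[OF z]]])
        (use good z in \<open>auto simp: good_def\<close>)
  qed
  have near: "\<bar>u z - U n z\<bar> \<le> 2 * \<kappa> * (1 / 2) ^ n * W z" if z: "z \<in> D" for n z
  proof -
    have "(\<lambda>j. \<bar>U (j + n) z - U n z\<bar>) \<longlonglongrightarrow> \<bar>u z - U n z\<bar>"
      by (intro tendsto_intros LIMSEQ_ignore_initial_segment pt z)
    then show ?thesis
    proof (rule LIMSEQ_le_const2, intro exI allI impI)
      fix j
      have "2 * \<kappa> * (1 / 2) ^ n * (1 - (1 / 2) ^ j) * W z \<le> 2 * \<kappa> * (1 / 2) ^ n * 1 * W z"
        using \<kappa> W[OF z] by (intro mult_right_mono mult_left_mono) auto
      then show "\<bar>U (j + n) z - U n z\<bar> \<le> 2 * \<kappa> * (1 / 2) ^ n * W z"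
        using far[OF z, of n j] by (simp add: add.commute)
    qed
  qed
  have "\<Phi> u z = u z" if z: "z \<in> D" for z
  proof -
    have "(\<lambda>n. \<Phi> (U n) z) \<longlonglongrightarrow> \<Phi> u z"
    proof (rule LIM_zero_cancel, rule Lim_null_comparison)
      show "\<forall>\<^sub>F n in sequentially. norm (\<Phi> (U n) z - \<Phi> u z) \<le> 2 * \<kappa> * W z / 2 * (1 / 2) ^ n"
      proof (rule always_eventually, rule allI)
        fix n
        have "\<bar>\<Phi> u z - \<Phi> (U n) z\<bar> \<le> 2 * \<kappa> * (1 / 2) ^ n / 2 * W z"
          using \<kappa> by (intro contr gu good near z) auto
        then show "norm (\<Phi> (U n) z - \<Phi> u z) \<le> 2 * \<kappa> * W z / 2 * (1 / 2) ^ n"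
          by (simp add: abs_minus_commute mult_ac)
      qed
      have "(\<lambda>n. 2 * \<kappa> * W z / 2 * (1 / 2) ^ n) \<longlonglongrightarrow> 2 * \<kappa> * W z / 2 * 0"
        by (intro tendsto_intros LIMSEQ_power_zero) simp
      then show "(\<lambda>n. 2 * \<kappa> * W z / 2 * (1 / 2) ^ n) \<longlonglongrightarrow> 0" by simp
    qed
    moreover have "(\<lambda>n. \<Phi> (U n) z) \<longlonglongrightarrow> u z"
      using LIMSEQ_Suc[OF pt[OF z]] by (simp add: USuc)
    ultimately show ?thesis
      by (rule LIMSEQ_unique)
  qed
  then show ?thesis
    using gu by blast
qed

text \<open>
With \<open>\<kappa> = e\<^sup>-\<^sup>L\<close> the arguments satisfy \<open>ln (1/|\<xi>|) \<ge> L + \<rho>/2\<close>, and \<open>L + \<rho>/2\<close> is at least \<open>L\<close> and at least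
\<open>(1 + \<rho>)/2\<close>.  The exponent \<open>p - 1\<close> is divided between these two bounds: the power \<open>L\<^sup>-\<^sup>\<eta>\<close> makes the constant as
small as desired, the other one gives the decay in \<open>\<rho>\<close>.
\<close>

lemma log_nonlinearity_lipschitz:
  fixes p C \<delta> \<eta> b M :: real and F :: "real \<Rightarrow> real"
  assumes F: "F C1_differentiable_on UNIV" and F0: "deriv F 0 = 0"
    and C: "C > 0" and \<delta>: "0 < \<delta>"
    and bound: "\<And>v. 0 < \<bar>v\<bar> \<Longrightarrow> \<bar>v\<bar> \<le> \<delta> \<Longrightarrow> \<bar>deriv F v\<bar> \<le> C * ln (1 / \<bar>v\<bar>) powr (1 - p)"
    and p: "p - 1 = b + \<eta>" and b: "b \<ge> 0" and \<eta>: "\<eta> > 0" and M: "M > 0"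
  shows "\<exists>\<kappa>>0. \<forall>\<rho>\<ge>0. \<forall>u v. \<bar>u\<bar> \<le> \<kappa> * exp (- \<rho> / 2) \<longrightarrow> \<bar>v\<bar> \<le> \<kappa> * exp (- \<rho> / 2) \<longrightarrow>
    \<bar>F u - F v\<bar> \<le> M * (1 + \<rho>) powr (- b) * \<bar>u - v\<bar>"
proof -
  define L where "L = max (max 1 (ln (1 / \<delta>))) ((C * 2 powr b / M) powr (1 / \<eta>))"
  have L: "L \<ge> 1" "ln (1 / \<delta>) \<le> L" "(C * 2 powr b / M) powr (1 / \<eta>) \<le> L"
    by (auto simp: L_def)
  have LM: "C * 2 powr b * L powr (- \<eta>) \<le> M"
  proof -
    have "C * 2 powr b / M = ((C * 2 powr b / M) powr (1 / \<eta>)) powr \<eta>"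
      using C M \<eta> by (simp add: powr_powr)
    also have "\<dots> \<le> L powr \<eta>"
      using L \<eta> by (intro powr_mono2) auto
    finally show ?thesis
      using M L by (simp add: powr_minus field_simps)
  qed
  have DF: "(F has_real_derivative deriv F x) (at x)" for x
  proof -
    have "F differentiable (at x)"
      using F by (simp add: C1_differentiable_on_eq)
    then show ?thesis
      by (simp add: DERIV_deriv_iff_real_differentiable)
  qed
  have small: "\<bar>deriv F \<xi>\<bar> \<le> M * (1 + \<rho>) powr (- b)" if "\<rho> \<ge> 0" and xi: "\<bar>\<xi>\<bar> \<le> exp (- L) * exp (- \<rho> / 2)" for \<xi> \<rho>
  proof (cases "\<xi> = 0")
    case True
    then show ?thesis using F0 M by simp
  next
    case False
    have e: "exp (- L) * exp (- \<rho> / 2) = exp (- (L + \<rho> / 2))"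
      by (simp add: exp_add[symmetric])
    have "exp (- (L + \<rho> / 2)) \<le> exp (- ln (1 / \<delta>))"
      using L that(1) by simp
    also have "\<dots> = \<delta>"
      using \<delta> by (simp add: exp_minus)
    finally have "\<bar>\<xi>\<bar> \<le> \<delta>"
      using xi e by simp
    then have "\<bar>deriv F \<xi>\<bar> \<le> C * ln (1 / \<bar>\<xi>\<bar>) powr (1 - p)"
      using False by (intro bound) auto
    also have "ln (1 / \<bar>\<xi>\<bar>) powr (1 - p) \<le> (L + \<rho> / 2) powr (1 - p)"
    proof (rule powr_mono2')
      have "ln \<bar>\<xi>\<bar> \<le> ln (exp (- (L + \<rho> / 2)))"
        using False xi e by (subst ln_le_cancel_iff) auto
      then show "L + \<rho> / 2 \<le> ln (1 / \<bar>\<xi>\<bar>)"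
        using False by (simp add: ln_div)
    qed (use p b \<eta> L that(1) in auto)
    also have "(L + \<rho> / 2) powr (1 - p) = (L + \<rho> / 2) powr (- b) * (L + \<rho> / 2) powr (- \<eta>)"
    proof -
      have "1 - p = - b + - \<eta>" using p by simp
      then show ?thesis by (simp only: powr_add)
    qed
    also have "\<dots> \<le> ((1 + \<rho>) / 2) powr (- b) * L powr (- \<eta>)"
      using L b \<eta> that(1) by (intro mult_mono powr_mono2') auto
    also have "((1 + \<rho>) / 2) powr (- b) = 2 powr b * (1 + \<rho>) powr (- b)"
      by (simp add: powr_divide powr_minus field_simps)
    finally have "\<bar>deriv F \<xi>\<bar> \<le> C * (2 powr b * (1 + \<rho>) powr (- b) * L powr (- \<eta>))"
      using C by simp
    also have "\<dots> = (C * 2 powr b * L powr (- \<eta>)) * (1 + \<rho>) powr (- b)"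
      by simp
    also have "\<dots> \<le> M * (1 + \<rho>) powr (- b)"
      by (rule mult_right_mono[OF LM]) simp
    finally show ?thesis .
  qed
  show ?thesis
  proof (intro exI[of _ "exp (- L)"] conjI allI impI)
    fix \<rho> u v :: real
    assume rho: "0 \<le> \<rho>" and uv: "\<bar>u\<bar> \<le> exp (- L) * exp (- \<rho> / 2)" "\<bar>v\<bar> \<le> exp (- L) * exp (- \<rho> / 2)"
    have "norm (F u - F v) \<le> (M * (1 + \<rho>) powr (- b)) * norm (u - v)"
    proof (rule field_differentiable_bound[where S = "cball 0 (exp (- L) * exp (- \<rho> / 2))"])
      show "(F has_field_derivative deriv F z) (at z within cball 0 (exp (- L) * exp (- \<rho> / 2)))" for z
        by (rule has_field_derivative_at_within[OF DF])
      show "norm (deriv F z) \<le> M * (1 + \<rho>) powr (- b)" if "z \<in> cball 0 (exp (- L) * exp (- \<rho> / 2))" for z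
        using small[OF rho, of z] that by simp
    qed (use uv in auto)
    then show "\<bar>F u - F v\<bar> \<le> M * (1 + \<rho>) powr (- b) * \<bar>u - v\<bar>"
      by simp
  qed simp
qed

text \<open>
All three contributions to the linear solution are controlled by the hemisphere integral of the one majorant
\<open>w\<close>: \<open>I_op_C1\<close> covers both parts of the time derivative, and \<open>|sinh| \<le> cosh\<close> covers \<open>I(t, x, u\<^sub>1)\<close>.
\<close>

lemma linear_solution:
  fixes u0 u1 w :: "complex \<Rightarrow> real"
  assumes u0: "C1_H2 u0" and u1: "continuous_on H2 u1" and w: "continuous_on H2 w"
    and le: "\<And>y. y \<in> H2 \<Longrightarrow> \<bar>u0 y\<bar> + \<bar>u1 y\<bar> + hnorm y (hgrad u0 y) \<le> w y"
  shows "\<And>t x. x \<in> H2 \<Longrightarrow> (\<lambda>s. I_op s x u0) differentiable (at t)"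
    and "continuous_on (UNIV \<times> H2) (\<lambda>(t, x). deriv (\<lambda>s. I_op s x u0) t + I_op t x u1)"
    and "\<And>t x. x \<in> H2 \<Longrightarrow> \<bar>deriv (\<lambda>s. I_op s x u0) t + I_op t x u1\<bar> \<le> 2 / pi * (cosh (t / 2) * hemisphere_integral w t x)"
proof -
  have c0: "continuous_on H2 u0"
    using u0 by (rule C1_H2_imp_continuous_on)
  obtain J where J: "\<And>t x. x \<in> H2 \<Longrightarrow> ((\<lambda>t. sinh (t / 2) / pi * hemisphere_integral u0 t x) has_real_derivative
        (cosh (t / 2) / 2 / pi * hemisphere_integral u0 t x + sinh (t / 2) / pi * J t x)) (at t)"
    "continuous_on (UNIV \<times> H2) (\<lambda>(t, x). J t x)"
    "\<And>t x w. x \<in> H2 \<Longrightarrow> continuous_on H2 w \<Longrightarrow>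
        (\<And>y. y \<in> H2 \<Longrightarrow> \<bar>u0 y\<bar> + hnorm y (hgrad u0 y) \<le> w y) \<Longrightarrow>
        cosh (t / 2) * \<bar>hemisphere_integral u0 t x\<bar> / 2 + \<bar>sinh (t / 2)\<bar> * \<bar>J t x\<bar> \<le> cosh (t / 2) * hemisphere_integral w t x"
    using I_op_C1[OF u0] by blast
  have D: "((\<lambda>s. I_op s x u0) has_real_derivative
      (cosh (t / 2) / 2 / pi * hemisphere_integral u0 t x + sinh (t / 2) / pi * J t x)) (at t)" if "x \<in> H2" for t x
    using J(1)[OF that] by (simp add: I_op_eq_hemisphere_integral[OF c0 that])
  show "(\<lambda>s. I_op s x u0) differentiable (at t)" if "x \<in> H2" for t x
    using D[OF that] real_differentiable_def by blast
  have dv: "deriv (\<lambda>s. I_op s x u0) t = cosh (t / 2) / 2 / pi * hemisphere_integral u0 t x + sinh (t / 2) / pi * J t x"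
    if "x \<in> H2" for t x
    using D[OF that] by (rule DERIV_imp_deriv)
  have ch: "continuous_on (UNIV \<times> H2) (\<lambda>p. hemisphere_integral f (fst p) (snd p))" if "continuous_on H2 f" for f
    by (rule continuous_on_hemisphere_integral)
      (auto intro!: continuous_intros continuous_on_compose2[OF that] simp: case_prod_unfold)
  have "continuous_on (UNIV \<times> H2) (\<lambda>p. cosh (fst p / 2) / 2 / pi * hemisphere_integral u0 (fst p) (snd p)
      + sinh (fst p / 2) / pi * J (fst p) (snd p) + sinh (fst p / 2) / pi * hemisphere_integral u1 (fst p) (snd p))"
    using J(2) by (intro continuous_intros ch c0 u1) (auto simp: case_prod_unfold)
  then show "continuous_on (UNIV \<times> H2) (\<lambda>(t, x). deriv (\<lambda>s. I_op s x u0) t + I_op t x u1)"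
    by (rule continuous_on_eq) (auto simp: dv I_op_eq_hemisphere_integral[OF u1])
  show "\<bar>deriv (\<lambda>s. I_op s x u0) t + I_op t x u1\<bar> \<le> 2 / pi * (cosh (t / 2) * hemisphere_integral w t x)" if x: "x \<in> H2" for t x
  proof -
    have h0: "0 \<le> hnorm y (hgrad u0 y)" if "y \<in> H2" for y
      using H2_pos[OF that] by (simp add: hnorm_eq[OF that])
    have w1: "\<bar>u0 y\<bar> + hnorm y (hgrad u0 y) \<le> w y" "\<bar>u1 y\<bar> \<le> w y" if "y \<in> H2" for y
      using le[OF that] h0[OF that] by linarith+
    have "\<bar>hemisphere_integral u1 t x\<bar> \<le> hemisphere_integral w t x"
      by (rule abs_hemisphere_integral_le[OF u1 w x w1(2)])
    then have "\<bar>sinh (t / 2)\<bar> * \<bar>hemisphere_integral u1 t x\<bar> \<le> cosh (t / 2) * hemisphere_integral w t x"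
      by (intro mult_mono) (auto simp: abs_le_iff sinh_def cosh_def)
    moreover have "cosh (t / 2) * \<bar>hemisphere_integral u0 t x\<bar> / 2 + \<bar>sinh (t / 2)\<bar> * \<bar>J t x\<bar> \<le> cosh (t / 2) * hemisphere_integral w t x"
      by (rule J(3)[OF x w w1(1)])
    moreover have "deriv (\<lambda>s. I_op s x u0) t + I_op t x u1 =
        1 / pi * (cosh (t / 2) * hemisphere_integral u0 t x / 2 + sinh (t / 2) * J t x + sinh (t / 2) * hemisphere_integral u1 t x)"
      by (simp add: dv[OF x] I_op_eq_hemisphere_integral[OF u1 x] field_simps)
    then have "\<bar>deriv (\<lambda>s. I_op s x u0) t + I_op t x u1\<bar> =
        1 / pi * \<bar>cosh (t / 2) * hemisphere_integral u0 t x / 2 + sinh (t / 2) * J t x + sinh (t / 2) * hemisphere_integral u1 t x\<bar>"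
      by (simp add: abs_mult)
    moreover have "\<bar>cosh (t / 2) * hemisphere_integral u0 t x / 2 + sinh (t / 2) * J t x + sinh (t / 2) * hemisphere_integral u1 t x\<bar>
        \<le> cosh (t / 2) * \<bar>hemisphere_integral u0 t x\<bar> / 2 + \<bar>sinh (t / 2)\<bar> * \<bar>J t x\<bar> + \<bar>sinh (t / 2)\<bar> * \<bar>hemisphere_integral u1 t x\<bar>"
      by (rule order_trans[OF abs_triangle_ineq add_mono[OF order_trans[OF abs_triangle_ineq]]])
        (auto simp: abs_mult)
    ultimately have "\<bar>deriv (\<lambda>s. I_op s x u0) t + I_op t x u1\<bar> \<le> 1 / pi * (2 * (cosh (t / 2) * hemisphere_integral w t x))"
      by (simp add: divide_right_mono)
    then show ?thesis by simp
  qed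
qed

theorem theorem1p1:
  fixes p k C \<delta> :: real and F :: "real \<Rightarrow> real"
  assumes "p > 3" and "k > 0"
    and "F C1_differentiable_on UNIV" and "F 0 = 0" and "deriv F 0 = 0"
    and "C > 0" and "0 < \<delta>" and "\<delta> < 1"
    and "\<And>v. 0 < \<bar>v\<bar> \<Longrightarrow> \<bar>v\<bar> \<le> \<delta> \<Longrightarrow> \<bar>deriv F v\<bar> \<le> C * ln (1 / \<bar>v\<bar>) powr (1 - p)"
  shows "\<exists>\<epsilon>\<^sub>0>0. \<forall>\<epsilon>. \<bar>\<epsilon>\<bar> < \<epsilon>\<^sub>0 \<longrightarrow>
    (\<forall>u0 u1. C1_H2 u0 \<longrightarrow> continuous_on H2 u1 \<longrightarrow>
       (\<forall>x\<in>H2. \<bar>u0 x\<bar> + \<bar>u1 x\<bar> + hnorm x (hgrad u0 x) \<le> cosh (hdist 0 x) powr (- k - 1 / 2)) \<longrightarrow>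
       (\<exists>u. global_weak_solution F \<epsilon> u0 u1 u))"
proof -
  \<comment> \<open>The excess of \<open>p - 1\<close> over \<open>2\<close> is \<open>4 \<eta>\<close>: one share each makes \<open>a > 1\<close> and gives the small constant, and the
    other two make \<open>b - a > 1\<close>.\<close>
  define \<eta> where "\<eta> = (p - 3) / 4"
  define a where "a = 1 + \<eta>"
  define b where "b = 2 + 3 * \<eta>"
  have \<eta>: "\<eta> > 0" and a: "a > 1" and ab: "b - a > 1" and b: "b \<ge> 0" and p: "p - 1 = b + \<eta>"
    using \<open>p > 3\<close> by (auto simp: \<eta>_def a_def b_def field_simps)
  define W where "W z = cone_weight a (fst z) (hdist 0 (snd z))" for z :: "real \<times> complex"
  have W0: "0 \<le> W z" and We: "W z \<le> exp (- hdist 0 (snd z) / 2)" for z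
  proof -
    have "(1 + \<bar>\<bar>fst z\<bar> - hdist 0 (snd z)\<bar>) powr (- a) \<le> (1 + \<bar>\<bar>fst z\<bar> - hdist 0 (snd z)\<bar>) powr 0"
      using a by (intro powr_mono) auto
    also have "\<dots> \<le> 1"
      by simp
    finally show "W z \<le> exp (- hdist 0 (snd z) / 2)"
      unfolding W_def cone_weight_def by (intro mult_left_le) auto
  qed (simp add: W_def cone_weight_def)
  have W1: "W z \<le> 1" if "z \<in> UNIV \<times> H2" for z
    using We[of z] hdist_0_nonneg[of "snd z"] that by (auto intro: order_trans)
  obtain K where K: "K > 0" and Duh: "\<And>h A t x. x \<in> H2 \<Longrightarrow> continuous_on (UNIV \<times> H2) (\<lambda>(\<tau>, y). h \<tau> y) \<Longrightarrow> A \<ge> 0 \<Longrightarrow>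
    (\<And>\<tau> y. y \<in> H2 \<Longrightarrow> \<bar>h \<tau> y\<bar> \<le> A * (1 + hdist 0 y) powr (- b) * cone_weight a \<tau> (hdist 0 y)) \<Longrightarrow>
    \<bar>duhamel h t x\<bar> \<le> K * A * cone_weight a t (hdist 0 x)"
    using duhamel_decay[OF a ab] by blast
  define w where "w y = cosh (hdist 0 y) powr (- k - 1 / 2)" for y
  obtain K1 where cw: "continuous_on H2 w" and K1: "K1 > 0"
    "\<And>t x. x \<in> H2 \<Longrightarrow> cosh (t / 2) * hemisphere_integral w t x \<le> K1 * cone_weight a t (hdist 0 x)"
    using linear_decay[of a k] a \<open>k > 0\<close> unfolding w_def[abs_def] by auto
  \<comment> \<open>The Lipschitz constant of \<open>F\<close> for which the Duhamel term is a contraction with factor \<open>1/2\<close>.\<close>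
  define M where "M = 1 / (2 * K)"
  have M: "M > 0" using K by (simp add: M_def)
  obtain \<kappa> where \<kappa>: "\<kappa> > 0" and Lip: "\<And>\<rho> u v. \<rho> \<ge> 0 \<Longrightarrow> \<bar>u\<bar> \<le> \<kappa> * exp (- \<rho> / 2) \<Longrightarrow> \<bar>v\<bar> \<le> \<kappa> * exp (- \<rho> / 2) \<Longrightarrow>
    \<bar>F u - F v\<bar> \<le> M * (1 + \<rho>) powr (- b) * \<bar>u - v\<bar>"
    using log_nonlinearity_lipschitz[of F C \<delta> p b \<eta> M] assms p b \<eta> M by blast
  have cF: "continuous_on UNIV F"
    by (rule C1_differentiable_imp_continuous_on[OF assms(3)])
  \<comment> \<open>Data of this size keep the linear part within half of the radius \<open>\<kappa>\<close>, and the Duhamel term uses the other half.\<close>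
  show ?thesis
  proof (intro exI[of _ "\<kappa> * pi / (4 * K1)"] conjI allI impI)
    show "\<kappa> * pi / (4 * K1) > 0"
      using \<kappa> K1 by simp
    fix \<epsilon> u0 u1
    assume eps: "\<bar>\<epsilon>\<bar> < \<kappa> * pi / (4 * K1)" and u0: "C1_H2 u0" and u1: "continuous_on H2 u1"
      and data: "\<forall>x\<in>H2. \<bar>u0 x\<bar> + \<bar>u1 x\<bar> + hnorm x (hgrad u0 x) \<le> cosh (hdist 0 x) powr (- k - 1 / 2)"
    have le: "\<bar>u0 y\<bar> + \<bar>u1 y\<bar> + hnorm y (hgrad u0 y) \<le> w y" if "y \<in> H2" for y
      using data that by (simp add: w_def)
    note lin = linear_solution[OF u0 u1 cw le]
    define l where "l z = \<epsilon> * (deriv (\<lambda>s. I_op s (snd z) u0) (fst z) + I_op (fst z) (snd z) u1)"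
      for z :: "real \<times> complex"
    have cl: "continuous_on (UNIV \<times> H2) l"
    proof -
      have "continuous_on (UNIV \<times> H2) (\<lambda>(t, x). deriv (\<lambda>s. I_op s x u0) t + I_op t x u1)"
        by (rule lin(2))
      then show ?thesis
        unfolding l_def by (intro continuous_on_mult[OF continuous_on_const]) (simp add: case_prod_unfold)
    qed
    have ll: "\<bar>l z\<bar> \<le> \<kappa> / 2 * W z" if "z \<in> UNIV \<times> H2" for z
    proof -
      have z: "snd z \<in> H2" using that by auto
      have "\<bar>l z\<bar> \<le> (\<kappa> * pi / (4 * K1)) * (2 / pi * (K1 * W z))"
        unfolding l_def abs_mult W_def
        by (intro mult_mono order_trans[OF lin(3)[OF _ z]] mult_left_mono K1(2) z less_imp_le[OF eps]) (auto simp: \<kappa> K1 less_imp_le)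
      also have "\<dots> = \<kappa> / 2 * W z"
        using K1(1) by simp
      finally show ?thesis .
    qed
    define H where "H u = (\<lambda>\<tau> y. F (u (\<tau>, y)))" for u :: "real \<times> complex \<Rightarrow> real"
    define \<Phi> where "\<Phi> u z = l z + duhamel (H u) (fst z) (snd z)" for u and z :: "real \<times> complex"
    define good where "good u \<longleftrightarrow> continuous_on (UNIV \<times> H2) u \<and> (\<forall>z\<in>UNIV \<times> H2. \<bar>u z\<bar> \<le> \<kappa> * W z)"
      for u :: "real \<times> complex \<Rightarrow> real"
    have cH: "continuous_on (UNIV \<times> H2) (\<lambda>(\<tau>, y). H u \<tau> y)" if "good u" for u
      using that unfolding good_def H_def case_prod_unfold
      by (auto intro!: continuous_on_compose2[OF cF])
    have LipH: "\<bar>F (u (\<tau>, y)) - F (v (\<tau>, y))\<bar> \<le> M * c * (1 + hdist 0 y) powr (- b) * cone_weight a \<tau> (hdist 0 y)"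
      if "y \<in> H2" "\<bar>u (\<tau>, y)\<bar> \<le> \<kappa> * W (\<tau>, y)" "\<bar>v (\<tau>, y)\<bar> \<le> \<kappa> * W (\<tau>, y)"
        "\<bar>u (\<tau>, y) - v (\<tau>, y)\<bar> \<le> c * W (\<tau>, y)" for u v c \<tau> y
    proof -
      have W': "\<kappa> * W (\<tau>, y) \<le> \<kappa> * exp (- hdist 0 y / 2)"
        using We[of "(\<tau>, y)"] \<kappa> by simp
      have "\<bar>F (u (\<tau>, y)) - F (v (\<tau>, y))\<bar> \<le> M * (1 + hdist 0 y) powr (- b) * \<bar>u (\<tau>, y) - v (\<tau>, y)\<bar>"
        using that W' by (intro Lip hdist_0_nonneg) auto
      also have "\<dots> \<le> M * (1 + hdist 0 y) powr (- b) * (c * W (\<tau>, y))"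
        using that(4) M by (intro mult_left_mono) auto
      finally show ?thesis
        by (simp add: W_def mult_ac)
    qed
    have contr: "\<bar>\<Phi> u z - \<Phi> v z\<bar> \<le> c / 2 * W z"
      if u: "good u" and v: "good v" and c: "c \<ge> 0" and uv: "\<And>z. z \<in> UNIV \<times> H2 \<Longrightarrow> \<bar>u z - v z\<bar> \<le> c * W z"
        and z: "z \<in> UNIV \<times> H2" for u v c z
    proof -
      have zH: "snd z \<in> H2" using z by auto
      have "\<Phi> u z - \<Phi> v z = duhamel (\<lambda>\<tau> y. H u \<tau> y - H v \<tau> y) (fst z) (snd z)"
        using duhamel_diff[OF cH[OF u] cH[OF v] zH] by (simp add: \<Phi>_def)
      moreover have "\<bar>duhamel (\<lambda>\<tau> y. H u \<tau> y - H v \<tau> y) (fst z) (snd z)\<bar> \<le> K * (M * c) * cone_weight a (fst z) (hdist 0 (snd z))"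
      proof (rule Duh[OF zH])
        show "continuous_on (UNIV \<times> H2) (\<lambda>(\<tau>, y). H u \<tau> y - H v \<tau> y)"
          using cH[OF u] cH[OF v] unfolding case_prod_unfold by (rule continuous_on_diff)
        show "\<bar>H u \<tau> y - H v \<tau> y\<bar> \<le> M * c * (1 + hdist 0 y) powr (- b) * cone_weight a \<tau> (hdist 0 y)"
          if "y \<in> H2" for \<tau> y
          unfolding H_def using u v uv that by (intro LipH) (auto simp: good_def)
      qed (use M c in simp)
      ultimately show ?thesis
        using K by (simp add: M_def W_def)
    qed
    have self: "good (\<Phi> u)" if u: "good u" for u
      unfolding good_def
    proof (intro conjI ballI)
      show "continuous_on (UNIV \<times> H2) (\<Phi> u)"
        unfolding \<Phi>_def using cl continuous_on_duhamel[OF cH[OF u]]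
        by (intro continuous_intros) (auto simp: case_prod_unfold)
      fix z :: "real \<times> complex" assume z: "z \<in> UNIV \<times> H2"
      then have zH: "snd z \<in> H2" by auto
      have "\<bar>duhamel (H u) (fst z) (snd z)\<bar> \<le> K * (M * \<kappa>) * cone_weight a (fst z) (hdist 0 (snd z))"
      proof (rule Duh[OF zH cH[OF u]])
        show "\<bar>H u \<tau> y\<bar> \<le> M * \<kappa> * (1 + hdist 0 y) powr (- b) * cone_weight a \<tau> (hdist 0 y)"
          if "y \<in> H2" for \<tau> y
          using LipH[of y u \<tau> "\<lambda>_. 0" \<kappa>] u W0[of "(\<tau>, y)"] \<kappa> that \<open>F 0 = 0\<close>
          by (auto simp: good_def H_def)
      qed (use M \<kappa> in simp)
      also have "\<dots> = \<kappa> / 2 * W z"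
        using K by (simp add: M_def W_def)
      finally show "\<bar>\<Phi> u z\<bar> \<le> \<kappa> * W z"
        using ll[OF z] unfolding \<Phi>_def by linarith
    qed
    have "\<exists>u. good u \<and> (\<forall>z\<in>UNIV \<times> H2. \<Phi> u z = u z)"
      by (rule weighted_contraction_fixpoint[where W = W and D = "UNIV \<times> H2" and \<kappa> = \<kappa> and \<Phi> = \<Phi>,
            folded good_def, OF W0 W1 less_imp_le[OF \<kappa>] self contr])
    then obtain u where u: "good u" and fp: "\<And>z. z \<in> UNIV \<times> H2 \<Longrightarrow> \<Phi> u z = u z"
      by blast
    have "global_weak_solution F \<epsilon> u0 u1 (\<lambda>t x. u (t, x))"
      unfolding global_weak_solution_def
    proof (intro conjI allI ballI)
      show "continuous_on (UNIV \<times> H2) (\<lambda>(t, x). u (t, x))"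
        using u by (simp add: good_def case_prod_unfold)
      fix t x assume x: "x \<in> H2"
      show "(\<lambda>s. I_op s x u0) differentiable (at t)"
        by (rule lin(1)[OF _ x])
      show "u (t, x) = \<epsilon> * (deriv (\<lambda>s. I_op s x u0) t + I_op t x u1)
          + (LBINT \<tau>=0..t. I_op (t - \<tau>) x (\<lambda>y. F (u (\<tau>, y))))"
        using fp[of "(t, x)"] x by (simp add: \<Phi>_def l_def duhamel_def H_def)
    qed
    then show "\<exists>u. global_weak_solution F \<epsilon> u0 u1 u"
      by blast
  qed
qed

end
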